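(* Let $\alpha\in(0,1/6)$ be an irrational number, let $(X,\varphi)$ be the Sturmian shift arising from the $\alpha$-rotation on $\mathbb{T}=\mathbb{R}/\mathbb{Z}$, and let $U\subset X$ be the clopen subset corresponding to the interval $[0,\alpha)\subset\mathbb{T}$. Let $\sigma_U\in[[\varphi]]$ be defined by \[ \sigma_U(x)=\begin{cases}\varphi(x)&x\in U\\ \varphi^{-1}(x)&x\in\varphi(U)\\ x&\text{otherwise,}\end{cases} \] and let $G\subset[[\varphi]]$ be the subgroup generated by $\varphi$ and $\sigma_U$. Then: (1) The commutator subgroup $D([[\varphi]])$ is contained in $G$. (2) The subgroup $G$ is normal in $[[\varphi]]$ and $[[\varphi]]/G\cong\mathbb{Z}/2\mathbb{Z}$.
   Context: Sturmian shift: for irrational $\alpha\in(0,1/6)$ and $t\in\mathbb{T}=\mathbb{R}/\mathbb{Z}$, let $\omega(t)\in\{0,1\}^{\mathbb{Z}}$ be the coding $\omega(t)_k=1$ if $t+k\alpha\in[0,\alpha)$ mod $1$, and $\omega(t)_k=0$ otherwise. Let $X$ be the closure of $\{\omega(t)\mid t\in\mathbb{T}\}$ in $\{0,1\}^{\mathbb{Z}}$ and let $\varphi:X\to X$ be the restriction of the shift, $\varphi(x)_k=x_{k+1}$, so that $\varphi(\omega(t))=\omega(t+\alpha)$. Then $X$ is a Cantor set and $\varphi$ is a minimal homeomorphism. The clopen set corresponding to the interval $[0,\alpha)$ is $U=\{x\in X\mid x_0=1\}$, which is the closure of $\{\omega(t)\mid t\in[0,\alpha)\}$; for $n\in\mathbb{Z}$,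 $\varphi^n(U)$ corresponds to $[n\alpha,(n+1)\alpha)$. In particular $U\cap\varphi(U)=\emptyset$. Topological full group: $[[\varphi]]$ is the group (under composition) of all homeomorphisms $\psi:X\to X$ for which there exists a continuous map $c:X\to\mathbb{Z}$ such that $\psi(x)=\varphi^{c(x)}(x)$ for all $x\in X$. $D(\Gamma)$ denotes the commutator subgroup of a group $\Gamma$. *)

theory Defs
  imports
    "HOL-Analysis.Analysis"
    "HOL-Algebra.Bij"
    "HOL-Algebra.Generated_Groups"
    "HOL-Algebra.Elementary_Groups"
begin

text \<open>
  The Cantor space \<open>{0,1}^\<int>\<close> is the type \<^typ>\<open>int \<Rightarrow> bool\<close>, with \<^const>\<open>True\<close> for the symbol 1.
  Its type-class topology is the product of the discrete topologies.
\<close>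

definition sturmian_coding :: "real \<Rightarrow> real \<Rightarrow> int \<Rightarrow> bool"
  where "sturmian_coding \<alpha> t = (\<lambda>k. frac (t + of_int k * \<alpha>) \<in> {0..<\<alpha>})"

text \<open>A point of \<open>\<real>/\<int>\<close> is given by any real representative; the coding is 1-periodic in it.\<close>

definition sturmian_space :: "real \<Rightarrow> (int \<Rightarrow> bool) set"
  where "sturmian_space \<alpha> = closure (range (sturmian_coding \<alpha>))"

definition sturmian_shift :: "real \<Rightarrow> (int \<Rightarrow> bool) \<Rightarrow> (int \<Rightarrow> bool)"
  where "sturmian_shift \<alpha> = (\<lambda>x\<in>sturmian_space \<alpha>. \<lambda>k. x (k + 1))"

definition sturmian_cylinder :: "real \<Rightarrow> (int \<Rightarrow> bool) set"
  where "sturmian_cylinder \<alpha> = {x \<in> sturmian_space \<alpha>. x 0}"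

text \<open>
  Self-maps of \<open>X\<close> are represented extensionally (\<^const>\<open>undefined\<close> outside \<open>X\<close>), as in
  \<^const>\<open>BijGroup\<close>, so that equality of maps is equality on \<open>X\<close>.  The power
  \<open>\<phi> [^]\<^bsub>BijGroup X\<^esub> n\<close> with \<open>n :: int\<close> is the \<open>n\<close>-fold iterate, also for negative \<open>n\<close>.
\<close>

definition topological_full_group ::
    "'a::topological_space set \<Rightarrow> ('a \<Rightarrow> 'a) \<Rightarrow> ('a \<Rightarrow> 'a) monoid"
  where "topological_full_group X \<phi> = BijGroup X
    \<lparr>carrier := {\<psi> \<in> carrier (BijGroup X).
       (\<exists>\<psi>'. homeomorphism X X \<psi> \<psi>') \<and>
       (\<exists>c :: 'a \<Rightarrow> int. continuous_on X c \<and>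
          (\<forall>x\<in>X. \<psi> x = (\<phi> [^]\<^bsub>BijGroup X\<^esub> c x) x))}\<rparr>"

definition swap_along ::
    "'a set \<Rightarrow> ('a \<Rightarrow> 'a) \<Rightarrow> 'a set \<Rightarrow> ('a \<Rightarrow> 'a)"
  where "swap_along X \<phi> U = (\<lambda>x\<in>X.
    if x \<in> U then \<phi> x
    else if x \<in> \<phi> ` U then (inv\<^bsub>BijGroup X\<^esub> \<phi>) x
    else x)"

end

theory Submission
  imports Defs
begin

text \<open>
  The orbit of the point \<open>0\<close> of the circle is dense in the Sturmian shift, so an element of the full
  group is determined by the permutation \<open>g\<close> of \<open>\<int>\<close> that it induces on this orbit; the permutations
  that arise are those whose displacement \<open>g n - n\<close> depends only on a bounded window of the coding around \<open>n\<close>.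
  Composing with a power of the shift makes the flux through a cut vanish, after which \<open>g\<close> can be
  corrected near the visits to a short arc so that it preserves the blocks between consecutive visits.
  Hence the full group is generated by the shift and by the exchanges of two disjoint translates of an arc.

  As \<open>\<alpha> < 1 / 6\<close>, two 3-cycles of consecutive translates of \<open>[0, \<alpha>)\<close> can overlap in a single arc,
  and their commutator is a 3-cycle of translates of that arc. So modulo \<open>G\<close> an exchange depends only on the
  length \<open>k \<alpha> - m\<close> of its arc, and additively so. Exchanges of arcs of length in \<open>2 (\<int> + \<alpha> \<int>)\<close> are
  squares modulo \<open>G\<close> and the exchange for the length \<open>\<alpha>\<close> is \<open>\<sigma>\<close>, so only the parity of \<open>m\<close>
  matters and \<open>G\<close> has index at most 2.

  The index is not 1: evaluate a word in the generators on the coding of the rotation by \<open>p / q\<close>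
  with \<open>p\<close> even and \<open>q\<close> odd. On \<open>\<int> / q\<close> both generators are even, but for \<open>p / q\<close> close to \<open>\<alpha>\<close>
  the exchange of the arc \<open>[m \<alpha>, 1)\<close>, \<open>m = \<lfloor>1 / \<alpha>\<rfloor>\<close>, with its image is odd.
\<close>

section \<open>Compositions and exchanges\<close>

text \<open>The bound 1/6 comes from the two 3-cycles: each occupies three consecutive arcs of
  length \<alpha>, and when the triples overlap in one short arc they cover slightly less than 6
  \<alpha>. With 6 \<alpha> < 1 they cannot meet a second time around the circle.

  Additivity modulo G presupposes that exchanges normalize G, which is part of the claim. It is
  settled first for short arcs: such an exchange equals, modulo G, one whose support misses that of
  \<open>\<sigma>\<close> and which therefore commutes with \<open>\<sigma>\<close>. Longer arcs are
  products of short ones.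

  For the lower bound no invariant has to be defined on the full group. An equation between an
  exchange and a word is tested on bounded windows, and all such windows of a close enough rational
  rotation occur in the Sturmian coding, so the equation passes to permutations of Z/q. There q odd
  makes the rotation an even permutation, and p even makes \<open>\<sigma>\<close>, a product of p
  disjoint transpositions, even. The arc [m \<alpha>, 1) turns into a set of q - m p residues, an
  odd number, so its exchange is odd.\<close>

inductive_set compositions :: "('a \<Rightarrow> 'a) set \<Rightarrow> ('a \<Rightarrow> 'a) set" for S where
  id: "id \<in> compositions S"
| step: "s \<in> S \<Longrightarrow> f \<in> compositions S \<Longrightarrow> s \<circ> f \<in> compositions S"

lemma compositions_base:
  assumes "s \<in> S"
  shows "s \<in> compositions S"
proof -
  have "s \<circ> id \<in> compositions S"
    by (rule compositions.step[OF assms compositions.id])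
  then show ?thesis by (simp only: comp_id)
qed

lemma compositions_comp:
  assumes "f \<in> compositions S" "g \<in> compositions S"
  shows "f \<circ> g \<in> compositions S"
  using assms(1)
proof induction
  case id
  show ?case unfolding id_comp by (rule assms(2))
next
  case (step s f)
  show ?case unfolding comp_assoc by (rule compositions.step[OF step(1) step.IH])
qed

lemma compositions_subset:
  assumes "S \<subseteq> compositions T" "f \<in> compositions S"
  shows "f \<in> compositions T"
  using assms(2)
proof induction
  case id
  show ?case by (rule compositions.id)
next
  case (step s f)
  show ?case by (rule compositions_comp[OF subsetD[OF assms(1) step(1)] step.IH])
qed

lemma bij_compositions:
  assumes "\<And>s. s \<in> S \<Longrightarrow> bij s" "f \<in> compositions S"
  shows "bij f"
  using assms(2)
proof induction
  case id
  show ?case by (rule bij_id)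
next
  case (step s f)
  show ?case by (rule bij_comp[OF step.IH assms(1)[OF step(1)]])
qed

text \<open>The generating sets used below contain the inverses of their elements, so the generated
  monoid is already the generated group.\<close>

lemma inv_compositions:
  assumes "\<And>s. s \<in> S \<Longrightarrow> bij s" "\<And>s. s \<in> S \<Longrightarrow> inv_into UNIV s \<in> compositions S" "f \<in> compositions S"
  shows "inv_into UNIV f \<in> compositions S"
  using assms(3)
proof induction
  case id
  show ?case unfolding inv_id by (rule compositions.id)
next
  case (step s f)
  have eq: "inv_into UNIV (s \<circ> f) = inv_into UNIV f \<circ> inv_into UNIV s"
    by (rule o_inv_distrib[OF assms(1)[OF step(1)] bij_compositions[OF assms(1) step(2)]])
  show ?case
    unfolding eq by (rule compositions_comp[OF step.IH assms(2)[OF step(1)]])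
qed

definition translation :: "int \<Rightarrow> int \<Rightarrow> int" where
  "translation k = (\<lambda>n. n + k)"

lemma translation_apply [simp]: "translation k n = n + k"
  by (simp add: translation_def)

lemma translation_comp: "translation i \<circ> translation j = translation (i + j)"
  by (auto simp: translation_def)

lemma translation_0: "translation 0 = id"
  by (auto simp: translation_def)

lemma bij_translation [simp]: "bij (translation k)"
  by (rule o_bij[of "translation (-k)"]) (simp_all add: translation_comp translation_0)

lemma inv_translation: "inv_into UNIV (translation k) = translation (- k)"
  by (rule inv_unique_comp) (simp_all add: translation_comp translation_0)

definition shift_set :: "int set \<Rightarrow> int \<Rightarrow> int set" where
  "shift_set V i = {n. n - i \<in> V}"

lemma mem_shift_set [simp]: "n \<in> shift_set V i \<longleftrightarrow> n - i \<in> V"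
  by (simp add: shift_set_def)

definition disjoint_shifts :: "int set \<Rightarrow> int \<Rightarrow> int \<Rightarrow> bool" where
  "disjoint_shifts V i j \<longleftrightarrow> (\<forall>n. n - i \<in> V \<longrightarrow> n - j \<notin> V)"

text \<open>The involution swapping V + i and V + j by translation. If distinct translates overlap,
  the first branch wins and the map need not be a bijection, hence the companion condition
  \<open>disjoint_shifts\<close> throughout.\<close>

definition exch :: "int set \<Rightarrow> int \<Rightarrow> int \<Rightarrow> int \<Rightarrow> int" where
  "exch V i j n = (if n - i \<in> V then n - i + j else if n - j \<in> V then n - j + i else n)"

lemma disjoint_shiftsD: "disjoint_shifts V i j \<Longrightarrow> n - i \<in> V \<Longrightarrow> n - j \<in> V \<Longrightarrow> False"
  by (auto simp: disjoint_shifts_def)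

lemma disjoint_shifts_diff:
  assumes "disjoint_shifts V i j" "j' - i' = j - i"
  shows "disjoint_shifts V i' j'"
  unfolding disjoint_shifts_def
proof (intro allI impI notI)
  fix n assume "n - i' \<in> V" "n - j' \<in> V"
  moreover have "n - i' = (n - i' + i) - i" "n - j' = (n - i' + i) - j" using assms(2) by simp_all
  ultimately show False using assms(1) unfolding disjoint_shifts_def by metis
qed

lemma disjoint_shifts_mono: "disjoint_shifts V i j \<Longrightarrow> W \<subseteq> V \<Longrightarrow> disjoint_shifts W i j"
  by (auto simp: disjoint_shifts_def)

lemma disjoint_shifts_shift_set:
  "disjoint_shifts (shift_set V o') i j \<longleftrightarrow> disjoint_shifts V i j"
proof -
  have "disjoint_shifts (shift_set V o') i j \<longleftrightarrow> disjoint_shifts V (i + o') (j + o')"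
    by (simp add: disjoint_shifts_def algebra_simps)
  also have "\<dots> \<longleftrightarrow> disjoint_shifts V i j"
    by (auto intro: disjoint_shifts_diff)
  finally show ?thesis .
qed

lemma exch_shift_set: "exch (shift_set V o') i j = exch V (i + o') (j + o')"
  by (auto simp: exch_def fun_eq_iff algebra_simps)

lemma exch_sym: "disjoint_shifts V i j \<Longrightarrow> exch V i j = exch V j i"
  by (auto simp: exch_def fun_eq_iff dest: disjoint_shiftsD)

lemma exch_involutory:
  assumes "disjoint_shifts V i j"
  shows "exch V i j \<circ> exch V i j = id"
proof
  fix n
  show "(exch V i j \<circ> exch V i j) n = id n"
    using disjoint_shiftsD[OF assms, of n] disjoint_shiftsD[OF assms, of "n - i + j"]
    by (auto simp: exch_def)
qed

lemma exch_same: "exch V i i = id"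
  by (rule ext) (simp add: exch_def)

lemma bij_exch: "disjoint_shifts V i j \<Longrightarrow> bij (exch V i j)"
  using exch_involutory o_bij by blast

lemma inv_exch: "disjoint_shifts V i j \<Longrightarrow> inv_into UNIV (exch V i j) = exch V i j"
  by (simp add: exch_involutory inv_unique_comp)

lemma translation_exch: "translation k \<circ> exch V i j = exch V (i + k) (j + k) \<circ> translation k"
  by (auto simp: exch_def fun_eq_iff algebra_simps)

text \<open>The two factors have disjoint supports. The second piece is stored with its base moved
  back by \<open>d\<close>, so \<open>d\<close> reappears in both indices. This is the source of
  additivity in the length of an arc.\<close>

lemma exch_Un:
  assumes "V = V1 \<union> shift_set V2 d" "V1 \<inter> shift_set V2 d = {}" "disjoint_shifts V i j"
  shows "exch V i j = exch V1 i j \<circ> exch V2 (i + d) (j + d)"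
proof
  fix n
  have a: "\<And>m. m - i \<in> V \<Longrightarrow> m - j \<in> V \<Longrightarrow> False" using assms(3) by (rule disjoint_shiftsD)
  have V: "\<And>m. m \<in> V \<longleftrightarrow> m \<in> V1 \<or> m - d \<in> V2" using assms(1) by auto
  have d: "\<And>m. m \<in> V1 \<Longrightarrow> m - d \<in> V2 \<Longrightarrow> False" using assms(2) by auto
  have s: "n - (i + d) = n - i - d" "n - (j + d) = n - j - d" by simp_all
  show "exch V i j n = (exch V1 i j \<circ> exch V2 (i + d) (j + d)) n"
    unfolding exch_def comp_def s
    using a[of n] a[of "n - i + j"] a[of "n - j + i"] d[of "n - i"] d[of "n - j"]
    by (auto simp: V)
qed

lemma exch_commute:
  assumes "\<And>n. n - i \<in> V \<or> n - j \<in> V \<Longrightarrow> n - k \<in> W \<or> n - l \<in> W \<Longrightarrow> False"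
  shows "exch V i j \<circ> exch W k l = exch W k l \<circ> exch V i j"
proof
  fix n
  show "(exch V i j \<circ> exch W k l) n = (exch W k l \<circ> exch V i j) n"
    using assms[of n] assms[of "n - i + j"] assms[of "n - j + i"] assms[of "n - k + l"] assms[of "n - l + k"]
    unfolding exch_def comp_def
    by (cases "n - i \<in> V"; cases "n - j \<in> V"; cases "n - k \<in> W"; cases "n - l \<in> W") auto
qed

text \<open>The choice of the floor \<open>i\<close> is unambiguous only if the translates \<open>V + i\<close> are disjoint.\<close>

definition tower_perm :: "int set \<Rightarrow> int set \<Rightarrow> (int \<Rightarrow> int) \<Rightarrow> int \<Rightarrow> int" where
  "tower_perm V W \<pi> n = (if \<exists>i\<in>W. n - i \<in> V then
     let i = (SOME i. i \<in> W \<and> n - i \<in> V) in n - i + \<pi> i else n)"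

lemma tower_perm_in:
  assumes "\<And>i j. i \<in> W \<Longrightarrow> j \<in> W \<Longrightarrow> i \<noteq> j \<Longrightarrow> disjoint_shifts V i j" "i \<in> W" "n - i \<in> V"
  shows "tower_perm V W \<pi> n = n - i + \<pi> i"
proof -
  have "(SOME i. i \<in> W \<and> n - i \<in> V) = i"
    using assms by (intro some_equality) (auto dest: disjoint_shiftsD)
  then show ?thesis using assms by (auto simp: tower_perm_def)
qed

lemma tower_perm_out:
  assumes "\<And>i. i \<in> W \<Longrightarrow> n - i \<notin> V"
  shows "tower_perm V W \<pi> n = n"
  using assms by (auto simp: tower_perm_def)

text \<open>A permutation of the floors is a product of transpositions, and a transposition of two
  floors is realised by an exchange.\<close>

lemma tower_perm_mem_compositions:
  assumes W: "finite W" "\<And>i j. i \<in> W \<Longrightarrow> j \<in> W \<Longrightarrow> i \<noteq> j \<Longrightarrow> disjoint_shifts V i j"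
    and "\<pi> permutes W"
    and S: "\<And>i j. disjoint_shifts V i j \<Longrightarrow> exch V i j \<in> S"
  shows "tower_perm V W \<pi> \<in> compositions S"
  using \<open>\<pi> permutes W\<close> \<open>finite W\<close>
proof (induction rule: permutes_induct)
  case id
  have "tower_perm V W id n = n" for n
    using tower_perm_in[OF W(2)] tower_perm_out[of W n V id] by (cases "\<exists>i\<in>W. n - i \<in> V") auto
  then have eq: "tower_perm V W id = id" by (simp add: fun_eq_iff)
  show ?case unfolding eq by (rule compositions.id)
next
  case (swap a b p)
  have "tower_perm V W (Transposition.transpose a b \<circ> p) = exch V a b \<circ> tower_perm V W p"
  proof
    fix n
    show "tower_perm V W (Transposition.transpose a b \<circ> p) n = (exch V a b \<circ> tower_perm V W p) n"
    proof (cases "\<exists>i\<in>W. n - i \<in> V")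
      case True
      then obtain i where i: "i \<in> W" "n - i \<in> V" by blast
      have p: "p i \<in> W" using i \<open>p permutes W\<close> by (simp add: permutes_in_image)
      let ?m = "n - i + p i"
      have m: "?m - p i \<in> V" using i by simp
      have "?m - a \<in> V \<Longrightarrow> p i = a" "?m - b \<in> V \<Longrightarrow> p i = b"
        using m p swap W(2) disjoint_shiftsD by metis+
      then have "exch V a b ?m = n - i + Transposition.transpose a b (p i)"
        using m by (auto simp: exch_def Transposition.transpose_def)
      then show ?thesis by (simp add: tower_perm_in[OF W(2) i])
    next
      case False
      then show ?thesis using swap by (auto simp: tower_perm_out exch_def)
    qed
  qed
  note eq = this
  have exch: "exch V a b \<in> compositions S"
  proof (cases "a = b")
    case False
    then show ?thesis using swap S W(2) by (intro compositions_base) auto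
  qed (simp add: exch_same compositions.id)
  show ?case unfolding eq by (rule compositions_comp[OF exch swap.IH])
qed

section \<open>Arcs of the rotation\<close>

lemma frac_eqI:
  fixes x y :: real
  assumes "x = y + of_int k" "0 \<le> y" "y < 1"
  shows "frac x = y"
  using assms by (simp add: frac_unique_iff)

locale irrational_rotation =
  fixes \<alpha> :: real
  assumes \<alpha>_pos: "0 < \<alpha>" and \<alpha>_less: "\<alpha> < 1 / 6" and \<alpha>_irrational: "\<alpha> \<notin> \<rat>"
begin

definition \<theta> :: "int \<Rightarrow> real" where
  "\<theta> n = frac (of_int n * \<alpha>)"

lemma \<theta>_ge_0: "0 \<le> \<theta> n" and \<theta>_less_1: "\<theta> n < 1"
  by (simp_all add: \<theta>_def frac_lt_1)

lemma \<theta>_0 [simp]: "\<theta> 0 = 0"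
  by (simp add: \<theta>_def)

lemma \<theta>_1: "\<theta> 1 = \<alpha>"
  using \<alpha>_pos \<alpha>_less by (simp add: \<theta>_def frac_eq)

lemma \<theta>_decomp: "of_int n * \<alpha> = \<theta> n + of_int \<lfloor>of_int n * \<alpha>\<rfloor>"
  by (simp add: \<theta>_def frac_def)

lemma \<theta>_eqI:
  assumes "of_int n * \<alpha> = y + of_int k" "0 \<le> y" "y < 1"
  shows "\<theta> n = y"
  unfolding \<theta>_def using assms by (rule frac_eqI)

lemma \<theta>_add: "\<theta> (m + n) = (if \<theta> m + \<theta> n < 1 then \<theta> m + \<theta> n else \<theta> m + \<theta> n - 1)"
  by (simp add: \<theta>_def distrib_right frac_add)

lemma \<theta>_diff: "\<theta> (m - n) = (if \<theta> n \<le> \<theta> m then \<theta> m - \<theta> n else \<theta> m - \<theta> n + 1)"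
proof (cases "\<theta> (m - n) + \<theta> n < 1")
  case True
  then have "\<theta> m = \<theta> (m - n) + \<theta> n" using \<theta>_add[of "m - n" n] by simp
  then show ?thesis using \<theta>_ge_0[of "m - n"] by auto
next
  case False
  then have "\<theta> m = \<theta> (m - n) + \<theta> n - 1" using \<theta>_add[of "m - n" n] by simp
  moreover have "\<theta> (m - n) < 1" by (rule \<theta>_less_1)
  ultimately show ?thesis by (smt (verit))
qed

lemma \<theta>_eq_0: "\<theta> n = 0 \<longleftrightarrow> n = 0"
proof
  assume "\<theta> n = 0"
  then have "of_int n * \<alpha> = of_int \<lfloor>of_int n * \<alpha>\<rfloor>" using \<theta>_decomp[of n] by simp
  show "n = 0"
  proof (rule ccontr)
    assume "n \<noteq> 0"
    then have "\<alpha> = of_int \<lfloor>of_int n * \<alpha>\<rfloor> / of_int n"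
      using \<open>of_int n * \<alpha> = _\<close> by (simp add: field_simps)
    then show False using \<alpha>_irrational by (metis Rats_divide Rats_of_int)
  qed
qed simp

lemma \<theta>_inj: "\<theta> m = \<theta> n \<longleftrightarrow> m = n"
  using \<theta>_diff[of m n] \<theta>_eq_0[of "m - n"] by auto

lemma \<theta>_pos: "n \<noteq> 0 \<Longrightarrow> 0 < \<theta> n"
  using \<theta>_eq_0[of n] \<theta>_ge_0[of n] by linarith

lemma \<theta>_uminus: "n \<noteq> 0 \<Longrightarrow> \<theta> (- n) = 1 - \<theta> n"
  using \<theta>_diff[of 0 n] \<theta>_pos[of n] by simp

lemma \<theta>_mult:
  assumes "of_int i * \<theta> s \<ge> 0" "of_int i * \<theta> s < 1"
  shows "\<theta> (i * s) = of_int i * \<theta> s"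
proof (rule \<theta>_eqI)
  show "of_int (i * s) * \<alpha> = of_int i * \<theta> s + of_int (i * \<lfloor>of_int s * \<alpha>\<rfloor>)"
    using arg_cong[OF \<theta>_decomp[of s], of "\<lambda>x. of_int i * x"] by (simp add: distrib_left mult.assoc)
qed (use assms in auto)

lemma \<theta>_small:
  assumes "0 < d"
  obtains k where "0 < \<theta> k" "\<theta> k < d"
proof -
  \<comment> \<open>Kronecker density aimed at the midpoint of the interval from 0 to
    \<open>min d 1\<close>, with error below half its length, which keeps the result strictly
    inside. The term \<open>min d 1/2\<close> parses as \<open>(min d 1) / 2\<close>.\<close>
  obtain h k :: int where k: "k > 0" "\<bar>of_int k * \<alpha> - of_int h - min d 1/2\<bar> < min d 1/2"
    using sequence_of_fractional_parts_is_dense[OF \<alpha>_irrational, of "min d 1/2" "min d 1/2"] assms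
    by (metis half_gt_zero min_less_iff_conj zero_less_one)
  have "\<theta> k = of_int k * \<alpha> - of_int h"
    by (rule \<theta>_eqI[of _ _ h]) (use k assms in \<open>auto simp: abs_less_iff field_simps\<close>)
  then show thesis using that[of k] k by (auto simp: abs_less_iff field_simps)
qed

lemma \<theta>_small_avoiding:
  assumes "finite D" "0 \<notin> D"
  obtains k where "0 < \<theta> k" "\<And>d. d \<in> D \<Longrightarrow> \<theta> k < \<theta> d" "\<theta> k < \<alpha>"
proof -
  have "0 < Min (insert \<alpha> (\<theta> ` D))"
    using assms \<alpha>_pos by (subst Min_gr_iff) (auto intro!: \<theta>_pos)
  then obtain k where "0 < \<theta> k" "\<theta> k < Min (insert \<alpha> (\<theta> ` D))" using \<theta>_small by blast
  then show thesis using that[of k] assms by auto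
qed

text \<open>Up to translation by integers, \<open>A k\<close> ranges over all arcs with end points in the orbit of \<open>0\<close>.\<close>

definition A :: "int \<Rightarrow> int set" where
  "A k = {n. \<theta> n < \<theta> k}"

lemma mem_A: "n \<in> A k \<longleftrightarrow> \<theta> n < \<theta> k"
  by (simp add: A_def)

lemma A_split:
  assumes "\<theta> l \<le> \<theta> k"
  shows "A k = A l \<union> shift_set (A (k - l)) l" "A l \<inter> shift_set (A (k - l)) l = {}"
proof -
  have *: "\<theta> (k - l) = \<theta> k - \<theta> l" using assms by (simp add: \<theta>_diff)
  show "A k = A l \<union> shift_set (A (k - l)) l"
    using assms unfolding set_eq_iff by (auto simp: A_def * \<theta>_diff split: if_splits)
  show "A l \<inter> shift_set (A (k - l)) l = {}"
  proof -
    have "\<not> \<theta> (n - l) < \<theta> k - \<theta> l" if "\<theta> n < \<theta> l" for n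
      using that \<theta>_diff[of n l] \<theta>_ge_0[of n] \<theta>_less_1[of k] by (simp split: if_splits)
    then show ?thesis by (auto simp: A_def *)
  qed
qed

text \<open>Two translates of a nonempty arc meet exactly when the left end point of one lies in the
  other; these end points, \<open>j\<close> and \<open>i\<close>, are the witnesses used
  below.\<close>

lemma disjoint_A_iff: "disjoint_shifts (A k) i j \<longleftrightarrow> \<theta> k = 0 \<or> \<theta> k \<le> \<theta> (j - i) \<and> \<theta> k \<le> \<theta> (i - j)"
proof
  assume *: "disjoint_shifts (A k) i j"
  show "\<theta> k = 0 \<or> \<theta> k \<le> \<theta> (j - i) \<and> \<theta> k \<le> \<theta> (i - j)"
  proof (rule ccontr)
    assume "\<not> ?thesis"
    then have "\<theta> k > 0" "\<theta> (j - i) < \<theta> k \<or> \<theta> (i - j) < \<theta> k" using \<theta>_ge_0[of k] by linarith+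
    then show False
      using disjoint_shiftsD[OF *, of j] disjoint_shiftsD[OF *, of i] by (auto simp: mem_A)
  qed
next
  assume *: "\<theta> k = 0 \<or> \<theta> k \<le> \<theta> (j - i) \<and> \<theta> k \<le> \<theta> (i - j)"
  show "disjoint_shifts (A k) i j"
    unfolding disjoint_shifts_def
  proof (intro allI impI notI)
    fix n assume n: "n - i \<in> A k" "n - j \<in> A k"
    have "\<theta> (j - i) = \<theta> ((n - i) - (n - j))" "\<theta> (i - j) = \<theta> ((n - j) - (n - i))" by simp_all
    then show False
      using n * \<theta>_ge_0[of "n-i"] \<theta>_ge_0[of "n - j"] unfolding mem_A \<theta>_diff
      by (auto split: if_splits)
  qed
qed

lemma disjoint_A_mono:
  "disjoint_shifts (A k) i j \<Longrightarrow> \<theta> l \<le> \<theta> k \<Longrightarrow> disjoint_shifts (A l) i j"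
  by (erule disjoint_shifts_mono) (auto simp: A_def)

lemma disjoint_A_split:
  assumes "disjoint_shifts (A k) i j" "\<theta> l \<le> \<theta> k"
  shows "disjoint_shifts (A l) i j" "disjoint_shifts (A (k - l)) i j"
    "disjoint_shifts (A (k - l)) (i + l) (j + l)"
proof -
  have "\<theta> (k - l) \<le> \<theta> k" using assms by (simp add: \<theta>_diff \<theta>_ge_0)
  then show "disjoint_shifts (A l) i j" "disjoint_shifts (A (k - l)) i j"
    using assms disjoint_A_mono by blast+
  then show "disjoint_shifts (A (k - l)) (i + l) (j + l)"
    by (auto intro: disjoint_shifts_diff)
qed

lemma exch_A_split:
  assumes "disjoint_shifts (A k) i j" "\<theta> l \<le> \<theta> k"
  shows "exch (A k) i j = exch (A l) i j \<circ> exch (A (k - l)) (i + l) (j + l)"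
  by (rule exch_Un[OF A_split[OF assms(2)] assms(1)])

section \<open>The subgroup generated by the shift and the basic exchange\<close>

abbreviation \<sigma> :: "int \<Rightarrow> int" where
  "\<sigma> \<equiv> exch (A 1) 0 1"

text \<open>What the group G becomes on the orbit of 0; \<open>generate_eq\<close> makes this
  precise. The inverse translation is listed because \<open>compositions\<close> only builds a
  monoid.\<close>

definition GZ :: "(int \<Rightarrow> int) set" where
  "GZ = compositions {translation 1, translation (- 1), \<sigma>}"

lemma \<theta>_upto5:
  assumes "d \<in> {0..5}"
  shows "\<theta> d = of_int d * \<alpha>"
proof -
  have "of_int d * \<alpha> \<le> 5 * \<alpha>" using assms \<alpha>_pos by (intro mult_right_mono) auto
  then have "of_int d * \<alpha> < 1" using \<alpha>_less by linarith
  moreover have "0 \<le> of_int d * \<alpha>" using assms \<alpha>_pos by auto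
  ultimately show ?thesis using \<theta>_mult[of d 1] by (simp add: \<theta>_1)
qed

text \<open>The place where 1/6 enters: for a distance d from 1 to 5 both d \<alpha> and 1 - d
  \<alpha> must be at least \<alpha>, and the second bound at d = 5 says 6 \<alpha> \<le> 1.\<close>

lemma disjoint_A1: 
  assumes "\<bar>i - j\<bar> \<in> {1..5}"
  shows "disjoint_shifts (A 1) i j"
proof -
  note pos = \<theta>_upto5
  have "\<theta> (j - i) \<ge> \<alpha> \<and> \<theta> (i - j) \<ge> \<alpha>"
  proof -
    have neg: "\<theta> (- d) = 1 - of_int d * \<alpha>" if "d \<in> {1..5}" for d
      using that pos[of d] \<theta>_uminus[of d] by auto
    have bd: "\<alpha> \<le> of_int d * \<alpha> \<and> of_int d * \<alpha> \<le> 5 * \<alpha>" if "d \<in> {1..5}" for d :: int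
      using that \<alpha>_pos by auto
    show ?thesis
    proof (cases "i < j")
      case True
      then have "j - i \<in> {1..5}" using assms by auto
      moreover have "i - j = - (j - i)" by simp
      ultimately show ?thesis using pos[of "j - i"] neg[of "j - i"] bd[of "j - i"] \<alpha>_less by simp
    next
      case False
      then have "i - j \<in> {1..5}" using assms by auto
      moreover have "j - i = - (i - j)" by simp
      ultimately show ?thesis using pos[of "i - j"] neg[of "i - j"] bd[of "i - j"] \<alpha>_less by simp
    qed
  qed
  then show ?thesis by (simp add: disjoint_A_iff \<theta>_1)
qed

lemma disjoint_A1_01: "disjoint_shifts (A 1) 0 1"
  by (rule disjoint_A1) simp

lemma bij_\<sigma>: "bij \<sigma>"
  by (rule bij_exch[OF disjoint_A1_01])

lemma GZ_comp: "f \<in> GZ \<Longrightarrow> g \<in> GZ \<Longrightarrow> f \<circ> g \<in> GZ"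
  unfolding GZ_def by (rule compositions_comp)

lemma id_GZ: "id \<in> GZ"
  unfolding GZ_def by (rule compositions.id)

lemma bij_GZ: "f \<in> GZ \<Longrightarrow> bij f"
  unfolding GZ_def by (erule bij_compositions[rotated]) (auto simp: bij_\<sigma>)

lemma \<sigma>_GZ: "\<sigma> \<in> GZ"
  unfolding GZ_def by (rule compositions_base) simp

lemma inv_GZ: "f \<in> GZ \<Longrightarrow> inv_into UNIV f \<in> GZ"
  unfolding GZ_def
proof (erule inv_compositions[rotated 2])
  fix s assume s: "s \<in> {translation 1, translation (- 1), \<sigma>}"
  then show "bij s" by (auto simp: bij_\<sigma>)
  have "inv_into UNIV s \<in> {translation 1, translation (- 1), \<sigma>}"
    using s by (auto simp: inv_translation inv_exch[OF disjoint_A1_01])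
  then show "inv_into UNIV s \<in> compositions {translation 1, translation (- 1), \<sigma>}"
    by (rule compositions_base)
qed

lemma translation_GZ: "translation k \<in> GZ"
proof (induction k rule: int_induct[of _ 0])
  case base
  show ?case unfolding translation_0 by (rule id_GZ)
next
  case (step1 i)
  have "translation 1 \<in> GZ" unfolding GZ_def by (rule compositions_base) simp
  from GZ_comp[OF step1(2) this] show ?case by (simp only: translation_comp)
next
  case (step2 i)
  have "translation (-1) \<in> GZ" unfolding GZ_def by (rule compositions_base) simp
  from GZ_comp[OF step2(2) this] show ?case by (simp only: translation_comp diff_conv_add_uminus)
qed

lemma GZ_cancel_left: "f \<in> GZ \<Longrightarrow> f \<circ> g \<in> GZ \<Longrightarrow> g \<in> GZ"
  using GZ_comp[OF inv_GZ, of f "f \<circ> g"] bij_GZ[of f]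
  by (simp add: o_assoc bij_is_inj)

lemma GZ_cancel_right: "f \<in> GZ \<Longrightarrow> g \<circ> f \<in> GZ \<Longrightarrow> g \<in> GZ"
  using GZ_comp[OF _ inv_GZ, of "g \<circ> f" f] bij_GZ[of f]
  by (simp add: comp_assoc surj_iff[THEN iffD1] bij_is_surj)

lemma translation_conj_GZ:
  assumes "f \<in> GZ"
  shows "translation k \<circ> f \<circ> translation (- k) \<in> GZ"
  by (intro GZ_comp translation_GZ assms)

lemma exch_translate: "translation k \<circ> exch V i j \<circ> translation (- k) = exch V (i + k) (j + k)"
  by (simp add: translation_exch comp_assoc translation_comp translation_0)

lemma exch2_translate:
  "translation k \<circ> (exch V i j \<circ> exch W p q) \<circ> translation (- k)
    = exch V (i + k) (j + k) \<circ> exch W (p + k) (q + k)"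
  by (simp add: fun_eq_iff exch_def) (simp add: algebra_simps)

lemma exch_A1_adjacent_GZ: "exch (A 1) i (i + 1) \<in> GZ"
  using translation_conj_GZ[OF \<sigma>_GZ, of i] by (simp add: exch_translate add.commute)

end

text \<open>The commutator of two 3-cycles of sets that meet in a single common set is a 3-cycle.\<close>

lemma three_cycle_commutator:
  fixes V :: "int set"
  assumes V: "\<And>i j. \<bar>i - j\<bar> \<in> {1, 2} \<Longrightarrow> disjoint_shifts V i j"
    and XY: "\<And>d. d \<in> {-2..1} \<Longrightarrow> disjoint_shifts V 0 (s - d)"
  defines "x \<equiv> exch V 0 1 \<circ> exch V (-1) 0"
    and "y \<equiv> exch V (s - 1) s \<circ> exch V s (s + 1)"
  defines "W \<equiv> {n. n - 1 \<in> V \<and> n - (s - 1) \<in> V}"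
  shows "y \<circ> x = exch W (-1) 0 \<circ> exch W 0 1 \<circ> (x \<circ> y)"
proof
  fix n
  define P where "P m \<longleftrightarrow> m \<in> V" for m
  define Q where "Q m \<longleftrightarrow> m - s \<in> V" for m
  have P1: "P m \<Longrightarrow> \<not> P (m + 1)" and P2: "P m \<Longrightarrow> \<not> P (m + 2)" for m
    using V[of 1 0] V[of 2 0] disjoint_shiftsD[of V 1 0 "m + 1"] disjoint_shiftsD[of V 2 0 "m + 2"]
    by (auto simp: P_def)
  have Q1: "Q m \<Longrightarrow> \<not> Q (m + 1)" and Q2: "Q m \<Longrightarrow> \<not> Q (m + 2)" for m
    using P1[of "m - s"] P2[of "m - s"] by (simp_all add: P_def Q_def algebra_simps)
  \<comment> \<open>The floors of \<open>x\<close> and \<open>y\<close> are V + a and V + s + b with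
    a, b in {-1, 0, 1}. The hypothesis excludes common points for every value of a - b except 2, so
    V + 1 and V + s - 1 are the only floors that may meet, and \<open>W\<close> is their
    intersection.\<close>
  have PQ: "P m \<Longrightarrow> \<not> Q (m + d)" if "d \<in> {-2..1}" for m d
    using XY[OF that] disjoint_shiftsD[of V 0 "s - d" m] by (auto simp: P_def Q_def algebra_simps)
  have PQ: "P m \<Longrightarrow> \<not> Q (m - 2)" "P m \<Longrightarrow> \<not> Q (m - 1)" "P m \<Longrightarrow> \<not> Q m" "P m \<Longrightarrow> \<not> Q (m + 1)" for m
    using PQ[of "-2" m] PQ[of "-1" m] PQ[of 0 m] PQ[of 1 m] by auto
  have x: "x m = (if P (m + 1) then m + 2 else if P m \<or> P (m - 1) then m - 1 else m)" for m
    using P1[of m] P1[of "m - 1"] P2[of "m - 1"] P1[of "m - 2"] P2[of "m - 2"] by (auto simp: x_def exch_def P_def)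
  have y: "y m = (if Q m \<or> Q (m + 1) then m + 1 else if Q (m - 1) then m - 2 else m)" for m
    using Q1[of m] Q1[of "m - 1"] Q2[of "m - 1"] Q1[of "m + 1"] Q2[of m] by (auto simp: y_def exch_def Q_def algebra_simps)
  have W: "m \<in> W \<longleftrightarrow> P (m - 1) \<and> Q (m + 1)" for m
    by (simp add: W_def P_def Q_def algebra_simps)
  have c: "(exch W (-1) 0 \<circ> exch W 0 1) m = (if P (m - 1) \<and> Q (m + 1) \<or> P m \<and> Q (m + 2) then m + 1
      else if P (m - 2) \<and> Q m then m - 2 else m)" for m
    using P1[of "m - 1"] P1[of "m - 2"] P2[of "m - 2"] P2[of "m - 1"] by (auto simp: exch_def W algebra_simps)
  have "y (x n) = (exch W (-1) 0 \<circ> exch W 0 1) (x (y n))"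
  proof (cases "P (n + 1) \<or> P n \<or> P (n - 1)")
    case True
    then consider "P (n + 1)" | "P n" | "P (n - 1)" by blast
    then show ?thesis
    proof cases
      case 1
      then show ?thesis
        using PQ[OF 1] P1[OF 1] P1[of n] by (simp add: x y c[unfolded comp_apply] algebra_simps)
    next
      case 2
      then show ?thesis
        using PQ[OF 2] P1[OF 2] P1[of "n - 1"] by (simp add: x y c[unfolded comp_apply] algebra_simps)
    next
      case 3
      then show ?thesis
        using PQ[OF 3] P1[OF 3] P2[OF 3] PQ[of "n + 2"] P1[of "n - 2"] by (auto simp: x y c[unfolded comp_apply] algebra_simps)
    qed
  next
    case False
    then have xn: "x n = n" by (simp add: x)
    consider "Q n" | "Q (n + 1)" | "Q (n - 1)" | "\<not> Q n" "\<not> Q (n + 1)" "\<not> Q (n - 1)" by blast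
    then show ?thesis
    proof cases
      case 1
      then show ?thesis using False PQ[of "n + 2"] P1[of "n + 1"] unfolding xn by (auto simp: x y c[unfolded comp_apply] algebra_simps)
    next
      case 2
      then show ?thesis using False PQ[of "n + 2"] P1[of "n + 1"] unfolding xn by (auto simp: x y c[unfolded comp_apply] algebra_simps)
    next
      case 3
      then show ?thesis
        using False PQ[of "n - 2"] Q1[of "n - 2"] Q1[of "n - 1"] Q2[of "n - 1"] unfolding xn
        by (auto simp: x y c[unfolded comp_apply] algebra_simps)
    next
      case 4
      then show ?thesis using False by (simp add: xn y) (simp add: x c[unfolded comp_apply])
    qed
  qed
  then show "(y \<circ> x) n = (exch W (-1) 0 \<circ> exch W 0 1 \<circ> (x \<circ> y)) n"
    by (simp only: comp_apply)
qed

text \<open>The identity (i l) = (j l)(i j)(j l) for transpositions, read on three pairwise disjoint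
  floors.\<close>

lemma exch_conj_exch:
  assumes "disjoint_shifts V i j" "disjoint_shifts V j l" "disjoint_shifts V i l"
  shows "exch V i l = exch V j l \<circ> exch V i j \<circ> exch V j l"
proof
  fix n
  consider "n - i \<in> V" | "n - j \<in> V" | "n - l \<in> V" | "n - i \<notin> V" "n - j \<notin> V" "n - l \<notin> V" by blast
  then show "exch V i l n = (exch V j l \<circ> exch V i j \<circ> exch V j l) n"
  proof cases
    case 1
    then have "n - j \<notin> V" "n - l \<notin> V" using assms disjoint_shiftsD by blast+
    then show ?thesis using 1 by (simp add: exch_def)
  next
    case 2
    then have "n - i \<notin> V" "n - l \<notin> V" using assms disjoint_shiftsD by blast+
    moreover have "n - j + l - i \<notin> V" "n - j + l - j \<notin> V"
      using 2 disjoint_shiftsD[OF assms(3), of "n - j + l"] disjoint_shiftsD[OF assms(2), of "n - j + l"] by auto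
    ultimately show ?thesis using 2 by (simp add: exch_def)
  next
    case 3
    then have "n - i \<notin> V" "n - j \<notin> V" using assms disjoint_shiftsD by blast+
    moreover have "n - l + j - i \<notin> V" "n - l + i - j \<notin> V" "n - l + i - l \<notin> V"
      using 3 disjoint_shiftsD[OF assms(1), of "n - l + j"] disjoint_shiftsD[OF assms(1), of "n - l + i"]
        disjoint_shiftsD[OF assms(3), of "n - l + i"] by auto
    ultimately show ?thesis using 3 by (simp add: exch_def)
  next
    case 4
    then show ?thesis by (simp add: exch_def)
  qed
qed

section \<open>Exchanges of short arcs modulo \<open>GZ\<close>\<close>

context irrational_rotation
begin

text \<open>Each 3-cycle is a product of two translates of \<open>\<sigma>\<close>, so the
  commutator lies in \<open>GZ\<close>. It is a 3-cycle on translates of the common arc, which a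
  power of the shift then brings to position \<open>i\<close>. A 3-cycle is a product of two
  exchanges, hence the form of the conclusion.\<close>

lemma exch_adjacent_GZ:
  assumes "0 < \<theta> k" "\<theta> k < \<alpha>"
  shows "exch (A k) i (i + 1) \<circ> exch (A k) (i + 1) (i + 2) \<in> GZ"
proof -
  \<comment> \<open>With this offset the arcs V + 1 and V + s - 1 are [\<alpha>, 2\<alpha>) and
    [2\<alpha> - \<theta> k, 3\<alpha> - \<theta> k). They overlap in [2\<alpha> - \<theta> k,
    2\<alpha>), which is \<open>A k\<close> translated by 2 - k.\<close>
  define s where "s = 3 - k"
  define x y where "x = exch (A 1) 0 1 \<circ> exch (A 1) (-1) 0"
    and "y = exch (A 1) (s - 1) s \<circ> exch (A 1) s (s + 1)"
  define W where "W = {n. n - 1 \<in> A 1 \<and> n - (s - 1) \<in> A 1}"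
  have x: "x \<in> GZ" using exch_A1_adjacent_GZ[of 0] exch_A1_adjacent_GZ[of "-1"]
    unfolding x_def by (intro GZ_comp) simp_all
  have y: "y \<in> GZ" using exch_A1_adjacent_GZ[of "s - 1"] exch_A1_adjacent_GZ[of s]
    unfolding y_def by (intro GZ_comp) simp_all
  have "y \<circ> x = exch W (-1) 0 \<circ> exch W 0 1 \<circ> (x \<circ> y)"
    unfolding x_def y_def W_def
  proof (rule three_cycle_commutator)
    show "disjoint_shifts (A 1) i j" if "\<bar>i - j\<bar> \<in> {1, 2}" for i j
      by (rule disjoint_A1) (use that in auto)
    \<comment> \<open>Here 3 - d runs from 2 to 5, so the distance on the circle lies strictly
      between \<alpha> and 5 \<alpha>, and 6 \<alpha> < 1 handles the other way around.\<close>
    show "disjoint_shifts (A 1) 0 (s - d)" if d: "d \<in> {-2..1}" for d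
    proof -
      have *: "2 * \<alpha> \<le> of_int (3 - d) * \<alpha>" "of_int (3 - d) * \<alpha> \<le> 5 * \<alpha>"
        using d \<alpha>_pos by (auto intro!: mult_right_mono)
      have 3: "\<theta> (3 - d) = of_int (3 - d) * \<alpha>" using \<theta>_upto5[of "3 - d"] d by simp
      then have "\<theta> k \<le> \<theta> (3 - d)" using * assms by linarith
      then have "\<theta> (3 - d - k) = of_int (3 - d) * \<alpha> - \<theta> k"
        using 3 \<theta>_diff[of "3 - d" k] by simp
      moreover have sd: "s - d = 3 - d - k" by (simp add: s_def)
      ultimately have "\<alpha> < \<theta> (s - d)" "\<theta> (s - d) < 5 * \<alpha>"
        using * assms unfolding sd by linarith+
      moreover from this have "\<theta> (- (s - d)) = 1 - \<theta> (s - d)"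
        using \<alpha>_pos by (intro \<theta>_uminus) auto
      ultimately show ?thesis using \<alpha>_less by (simp add: disjoint_A_iff \<theta>_1)
    qed
  qed
  then have "(exch W (-1) 0 \<circ> exch W 0 1) \<circ> (x \<circ> y) \<in> GZ" using GZ_comp[OF y x] by (simp only:)
  then have *: "exch W (-1) 0 \<circ> exch W 0 1 \<in> GZ" by (rule GZ_cancel_right[OF GZ_comp[OF x y]])
  have W_eq: "W = shift_set (A k) (2 - k)"
  proof (rule Set.set_eqI)
    fix n
    define u where "u = n - (2 - k)"
    have e: "n - 1 = u - (k - 1)" "n - (s - 1) = u" by (simp_all add: u_def s_def)
    have k1: "\<theta> (k - 1) = \<theta> k - \<alpha> + 1" using assms \<theta>_diff[of k 1] by (simp add: \<theta>_1)
    have "n \<in> W \<longleftrightarrow> \<theta> (u - (k - 1)) < \<alpha> \<and> \<theta> u < \<alpha>"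
      unfolding W_def mem_Collect_eq e mem_A \<theta>_1 ..
    moreover have "\<theta> (u - (k - 1)) = (if \<theta> k - \<alpha> + 1 \<le> \<theta> u then \<theta> u - (\<theta> k - \<alpha> + 1) else \<theta> u - (\<theta> k - \<alpha> + 1) + 1)"
      unfolding \<theta>_diff[of u "k - 1"] k1 ..
    ultimately show "n \<in> W \<longleftrightarrow> n \<in> shift_set (A k) (2 - k)"
      using assms \<theta>_ge_0[of u] \<theta>_less_1[of u] \<alpha>_less unfolding mem_shift_set mem_A u_def[symmetric]
      by (auto split: if_splits)
  qed
  have "exch (A k) (1 - k) (2 - k) \<circ> exch (A k) (2 - k) (3 - k) \<in> GZ"
  proof -
    have "- 1 + (2 - k) = 1 - k" "0 + (2 - k) = 2 - k" "1 + (2 - k) = 3 - k" by simp_all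
    then show ?thesis using * by (simp only: W_eq exch_shift_set)
  qed
  moreover have "1 - k + (i + k - 1) = i" "2 - k + (i + k - 1) = i + 1" "3 - k + (i + k - 1) = i + 2" by simp_all
  ultimately show ?thesis
    using translation_conj_GZ[of _ "i + k - 1"] exch2_translate[of "i + k - 1"] by metis
qed

text \<open>For involutions f and g, \<open>f \<circ> g \<in> GZ\<close> says that both lie in the
  same coset of \<open>GZ\<close>. This is transitivity of that relation; \<open>GZ_sym\<close> is
  its symmetry.\<close>

lemma GZ_trans:
  assumes "f \<circ> g \<in> GZ" "g \<circ> h \<in> GZ" "g \<circ> g = id"
  shows "f \<circ> h \<in> GZ"
proof -
  have "(f \<circ> g) \<circ> (g \<circ> h) = f \<circ> (g \<circ> g) \<circ> h" by (simp only: comp_assoc)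
  also have "\<dots> = f \<circ> h" unfolding assms(3) by (simp only: comp_id)
  finally show ?thesis using GZ_comp[OF assms(1,2)] by simp
qed

lemma GZ_sym:
  assumes "f \<circ> g \<in> GZ" "f \<circ> f = id" "g \<circ> g = id"
  shows "g \<circ> f \<in> GZ"
proof -
  have "(f \<circ> g) \<circ> (g \<circ> f) = f \<circ> (g \<circ> g) \<circ> f" "(g \<circ> f) \<circ> (f \<circ> g) = g \<circ> (f \<circ> f) \<circ> g"
    by (simp_all only: comp_assoc)
  then have "inv_into UNIV (f \<circ> g) = g \<circ> f"
    using assms by (intro inv_unique_comp) simp_all
  then show ?thesis using inv_GZ[OF assms(1)] by simp
qed

lemma exch_all_adjacent_GZ:
  assumes k: "0 < \<theta> k" "\<theta> k < \<alpha>"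
  shows "exch (A k) i (i + 1) \<circ> exch (A k) j (j + 1) \<in> GZ"
proof -
  have d: "disjoint_shifts (A k) i (i + 1)" for i
    by (rule disjoint_A_mono[of 1]) (use k in \<open>auto simp: \<theta>_1 intro: disjoint_A1\<close>)
  have inv: "exch (A k) i (i + 1) \<circ> exch (A k) i (i + 1) = id" for i
    by (rule exch_involutory[OF d])
  have up: "exch (A k) i (i + 1) \<circ> exch (A k) (i + int n) (i + int n + 1) \<in> GZ" for i n
  proof (induction n)
    case 0
    show ?case unfolding of_nat_0 add_0_right inv by (rule id_GZ)
  next
    case (Suc n)
    have "exch (A k) (i + int n) (i + int n + 1) \<circ> exch (A k) (i + int n + 1) (i + int n + 2) \<in> GZ"
      by (rule exch_adjacent_GZ[OF k])
    moreover have "i + int (Suc n) = i + int n + 1" "i + int (Suc n) + 1 = i + int n + 2" by simp_all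
    ultimately show ?case using GZ_trans[OF Suc _ inv] by (simp only:)
  qed
  show ?thesis
  proof (cases "i \<le> j")
    case True
    then show ?thesis using up[of i "nat (j - i)"] by simp
  next
    case False
    then show ?thesis using GZ_sym[OF up[of j "nat (i - j)"] inv] inv[of i] by simp
  qed
qed

text \<open>Short enough that translates by distinct integers at distance at most \<open>L\<close>
  are disjoint. For a general arc two translates can be disjoint while the intermediate ones are
  not, and then conjugating through intermediate floors is impossible.\<close>

definition tiny :: "int \<Rightarrow> int \<Rightarrow> bool" where
  "tiny L k \<longleftrightarrow> \<theta> k < \<alpha> \<and> (\<forall>d. d \<noteq> 0 \<longrightarrow> \<bar>d\<bar> \<le> L \<longrightarrow> \<theta> k < \<theta> d)"

lemma tiny_exists:
  obtains k where "tiny L k" "0 < \<theta> k"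
proof -
  obtain k where "0 < \<theta> k" "\<And>d. d \<in> {-L..L} - {0} \<Longrightarrow> \<theta> k < \<theta> d" "\<theta> k < \<alpha>"
    using \<theta>_small_avoiding[of "{-L..L} - {0}"] by auto
  then show thesis using that[of k] by (auto simp: tiny_def abs_le_iff)
qed

lemma tiny_mono: "tiny L k \<Longrightarrow> \<theta> l \<le> \<theta> k \<Longrightarrow> tiny L l"
  unfolding tiny_def by (meson order.strict_trans1)

lemma disjoint_tiny: "tiny L k \<Longrightarrow> i \<noteq> j \<Longrightarrow> \<bar>i - j\<bar> \<le> L \<Longrightarrow> disjoint_shifts (A k) i j"
  unfolding tiny_def disjoint_A_iff by (auto simp: abs_minus_commute intro!: less_imp_le)

text \<open>Induction on the distance of the floors. With a the adjacent exchange of ?j, ?j + 1 and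
  b that of i, ?j, the new exchange is a b a. Multiplied by a on the right it becomes a b, a product
  of two exchanges already known to be congruent, so the step works before normality is
  available.\<close>

lemma exch_tiny_up:
  assumes k: "0 < \<theta> k" "tiny L k" and "int n < L"
  shows "exch (A k) i (i + 1 + int n) \<circ> exch (A k) 0 1 \<in> GZ"
  using \<open>int n < L\<close>
proof (induction n)
  case 0
  have "i + 1 + int 0 = i + 1" "(1 :: int) = 0 + 1" by simp_all
  then show ?case using exch_all_adjacent_GZ[of k i 0] k unfolding tiny_def by metis
next
  case (Suc n)
  let ?j = "i + 1 + int n"
  have d: "disjoint_shifts (A k) i ?j" "disjoint_shifts (A k) ?j (?j + 1)" "disjoint_shifts (A k) i (?j + 1)"
    "disjoint_shifts (A k) 0 1"
    using Suc by (auto intro!: disjoint_tiny[OF k(2)])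
  let ?a = "exch (A k) ?j (?j + 1)" and ?b = "exch (A k) i ?j"
  have inv: "?a \<circ> ?a = id" "?b \<circ> ?b = id" "exch (A k) 0 1 \<circ> exch (A k) 0 1 = id"
    using d by (simp_all only: exch_involutory)
  have IH: "?b \<circ> exch (A k) 0 1 \<in> GZ" by (rule Suc.IH) (use Suc.prems in simp)
  have a: "?a \<circ> exch (A k) 0 1 \<in> GZ"
    using exch_all_adjacent_GZ[of k ?j 0] k unfolding tiny_def add_0_left by blast
  have "?a \<circ> ?b \<in> GZ" by (rule GZ_trans[OF a GZ_sym[OF IH inv(2,3)] inv(3)])
  moreover have "exch (A k) i (?j + 1) \<circ> ?a = ?a \<circ> ?b"
    unfolding exch_conj_exch[OF d(1,2,3)] comp_assoc inv comp_id ..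
  ultimately have "exch (A k) i (?j + 1) \<circ> ?a \<in> GZ" by simp
  moreover have "i + 1 + int (Suc n) = ?j + 1" by simp
  ultimately show ?case using GZ_trans[OF _ a inv(1)] by (simp only:)
qed

lemma exch_tiny_01:
  assumes k: "0 < \<theta> k" "tiny L k" and "i \<noteq> j" "\<bar>i - j\<bar> \<le> L"
  shows "exch (A k) i j \<circ> exch (A k) 0 1 \<in> GZ"
proof -
  have *: "exch (A k) i j \<circ> exch (A k) 0 1 \<in> GZ" if "i < j" "j - i \<le> L" for i j
    using exch_tiny_up[OF k, of "nat (j - i - 1)" i] that by simp
  show ?thesis
  proof (cases "i < j")
    case True
    then show ?thesis using assms * by auto
  next
    case False
    then have "exch (A k) j i \<circ> exch (A k) 0 1 \<in> GZ" using assms * by auto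
    then show ?thesis using exch_sym[OF disjoint_tiny[OF assms(2-4)]] by simp
  qed
qed

lemma exch_tiny:
  assumes k: "tiny L k" and ij: "i \<noteq> j" "\<bar>i - j\<bar> \<le> L" and ij': "i' \<noteq> j'" "\<bar>i' - j'\<bar> \<le> L"
  shows "exch (A k) i j \<circ> exch (A k) i' j' \<in> GZ"
proof (cases "\<theta> k = 0")
  case True
  then have "A k = {}" using \<theta>_ge_0 by (auto simp: A_def not_less)
  then have "exch (A k) i j \<circ> exch (A k) i' j' = id" by (auto simp: exch_def)
  then show ?thesis using id_GZ by (simp only:)
next
  case False
  then have pos: "0 < \<theta> k" using \<theta>_ge_0[of k] by simp
  have inv: "exch (A k) i' j' \<circ> exch (A k) i' j' = id"
    by (rule exch_involutory[OF disjoint_tiny[OF k ij']])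
  have inv1: "exch (A k) 0 1 \<circ> exch (A k) 0 1 = id"
    by (rule exch_involutory[OF disjoint_tiny[OF k]]) (use ij in auto)
  show ?thesis
    by (rule GZ_trans[OF exch_tiny_01[OF pos k ij] GZ_sym[OF exch_tiny_01[OF pos k ij'] inv inv1] inv1])
qed

section \<open>Exchanges normalize \<open>GZ\<close>, and only the length of the arc matters\<close>

definition normalizers :: "(int \<Rightarrow> int) set" where
  "normalizers = {f. bij f \<and> (\<forall>h\<in>GZ. f \<circ> h \<circ> inv_into UNIV f \<in> GZ)}"

lemma normalizersI:
  assumes "bij f" and gen: "\<And>s. s \<in> {translation 1, translation (- 1), \<sigma>} \<Longrightarrow> f \<circ> s \<circ> inv_into UNIV f \<in> GZ"
  shows "f \<in> normalizers"
proof -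
  let ?g = "inv_into UNIV f"
  have gf: "?g \<circ> f = id" and fg: "f \<circ> ?g = id"
    using \<open>bij f\<close> by (simp_all only: bij_is_inj inv_o_cancel bij_is_surj surj_iff[symmetric])
  have "f \<circ> h \<circ> ?g \<in> GZ" if "h \<in> GZ" for h
    using that unfolding GZ_def
  proof induction
    case id
    show ?case unfolding comp_id fg by (rule compositions.id)
  next
    case (step s h)
    have "f \<circ> (s \<circ> h) \<circ> ?g = (f \<circ> s \<circ> ?g) \<circ> (f \<circ> h \<circ> ?g)"
      by (metis comp_assoc comp_id gf)
    moreover have "(f \<circ> s \<circ> ?g) \<circ> (f \<circ> h \<circ> ?g) \<in> GZ"
      using GZ_comp gen[OF step(1)] step.IH unfolding GZ_def by blast
    ultimately show ?case unfolding GZ_def by (simp only:)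
  qed
  then show ?thesis using assms by (simp add: normalizers_def)
qed

lemma normalizers_comp:
  assumes "f \<in> normalizers" "g \<in> normalizers"
  shows "f \<circ> g \<in> normalizers"
proof -
  have "bij f" "bij g" using assms by (auto simp: normalizers_def)
  then have "inv_into UNIV (f \<circ> g) = inv_into UNIV g \<circ> inv_into UNIV f" by (rule o_inv_distrib)
  moreover have "f \<circ> (g \<circ> h \<circ> inv_into UNIV g) \<circ> inv_into UNIV f \<in> GZ" if "h \<in> GZ" for h
    using that assms unfolding normalizers_def by blast
  ultimately have "(f \<circ> g) \<circ> h \<circ> inv_into UNIV (f \<circ> g) \<in> GZ" if "h \<in> GZ" for h
    using that by (simp only: comp_assoc)
  then show ?thesis using \<open>bij f\<close> \<open>bij g\<close> by (auto simp: normalizers_def intro: bij_comp)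
qed

lemma normalizers_involution:
  assumes "f \<in> normalizers" "f \<circ> f = id" "h \<in> GZ"
  shows "f \<circ> h \<circ> f \<in> GZ"
proof -
  have "inv_into UNIV f = f" using assms(2) by (intro inv_unique_comp)
  then show ?thesis using assms unfolding normalizers_def by auto
qed

text \<open>Write T for the exchange. Conjugating a translation by T gives T times a translate of T,
  times the translation, and tiny exchanges agree modulo \<open>GZ\<close>. For
  \<open>\<sigma>\<close>, T is replaced by T', the exchange of the floors 2 and 3: its support
  misses that of \<open>\<sigma>\<close>, so T' commutes with \<open>\<sigma>\<close> and T \<sigma>
  T = (T T') \<sigma> (T' T).\<close>

lemma exch_tiny_normalizers:
  assumes k: "tiny L k" and ij: "i \<noteq> j" "\<bar>i - j\<bar> \<le> L"
  shows "exch (A k) i j \<in> normalizers"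
proof -
  let ?T = "exch (A k) i j" and ?T' = "exch (A k) 2 3"
  have L: "1 \<le> L" using ij by auto
  have d: "disjoint_shifts (A k) i j" by (rule disjoint_tiny[OF k ij])
  have d': "disjoint_shifts (A k) 2 3" using L by (intro disjoint_tiny[OF k]) auto
  have inv: "inv_into UNIV ?T = ?T" by (rule inv_exch[OF d])
  have TT': "?T' \<circ> ?T' = id" by (rule exch_involutory[OF d'])
  show ?thesis
  proof (rule normalizersI)
    show "bij ?T" by (rule bij_exch[OF d])
    have tr: "?T \<circ> translation m \<circ> ?T \<in> GZ" for m
    proof -
      have "?T \<circ> translation m \<circ> ?T = ?T \<circ> exch (A k) (i + m) (j + m) \<circ> translation m"
        by (simp only: comp_assoc translation_exch)
      moreover have "?T \<circ> exch (A k) (i + m) (j + m) \<in> GZ"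
        by (rule exch_tiny[OF k ij]) (use ij in auto)
      ultimately show ?thesis using GZ_comp[OF _ translation_GZ] by (simp only:)
    qed
    have comm: "?T' \<circ> \<sigma> = \<sigma> \<circ> ?T'"
    proof (rule exch_commute)
      fix n assume n: "n - 2 \<in> A k \<or> n - 3 \<in> A k" "n - 0 \<in> A 1 \<or> n - 1 \<in> A 1"
      have "A k \<subseteq> A 1" using k by (auto simp: tiny_def A_def \<theta>_1)
      then have "n - 2 \<in> A 1 \<or> n - 3 \<in> A 1" using n by blast
      then show False
        using n(2) disjoint_shiftsD[OF disjoint_A1[of 2 0], of n] disjoint_shiftsD[OF disjoint_A1[of 2 1], of n]
          disjoint_shiftsD[OF disjoint_A1[of 3 0], of n] disjoint_shiftsD[OF disjoint_A1[of 3 1], of n] by auto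
    qed
    have "?T \<circ> \<sigma> \<circ> ?T = (?T \<circ> ?T') \<circ> \<sigma> \<circ> (?T' \<circ> ?T)"
    proof -
      have "(?T \<circ> ?T') \<circ> \<sigma> \<circ> (?T' \<circ> ?T) = ?T \<circ> (?T' \<circ> \<sigma>) \<circ> ?T' \<circ> ?T" by (simp only: comp_assoc)
      also have "\<dots> = ?T \<circ> \<sigma> \<circ> (?T' \<circ> ?T') \<circ> ?T" unfolding comm by (simp only: comp_assoc)
      also have "\<dots> = ?T \<circ> \<sigma> \<circ> ?T" unfolding TT' by (simp only: comp_id)
      finally show ?thesis by simp
    qed
    moreover have "?T \<circ> ?T' \<in> GZ" "?T' \<circ> ?T \<in> GZ"
      using exch_tiny[OF k ij, of 2 3] exch_tiny[OF k _ _ ij, of 2 3] L by auto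
    ultimately have \<sigma>: "?T \<circ> \<sigma> \<circ> ?T \<in> GZ" using GZ_comp \<sigma>_GZ by simp
    show "?T \<circ> s \<circ> inv_into UNIV ?T \<in> GZ" if "s \<in> {translation 1, translation (- 1), \<sigma>}" for s
      using that \<sigma> tr unfolding inv by auto
  qed
qed

text \<open>Every arc is a finite disjoint union of arcs that are arbitrarily small.\<close>

lemma arc_induct:
  assumes "0 < \<theta> l"
    and small: "\<And>k d. \<theta> k \<le> \<theta> l \<Longrightarrow> P k d"
    and split: "\<And>k d. \<theta> l \<le> \<theta> k \<Longrightarrow> P (k - l) (d + l) \<Longrightarrow> P k d"
  shows "P k d"
proof -
  obtain r :: nat where "\<theta> k \<le> of_nat r * \<theta> l"
    using ex_less_of_nat_mult[OF \<open>0 < \<theta> l\<close>, of "\<theta> k"] by (auto intro: less_imp_le)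
  then show ?thesis
  proof (induction r arbitrary: k d)
    case 0
    then show ?case using assms(1) by (intro small) simp
  next
    case (Suc r k d)
    show ?case
    proof (cases "\<theta> k \<le> \<theta> l")
      case False
      then have "\<theta> (k - l) = \<theta> k - \<theta> l" by (simp add: \<theta>_diff)
      then have "\<theta> (k - l) \<le> of_nat r * \<theta> l" using Suc.prems by (simp add: algebra_simps)
      then have "P (k - l) (d + l)" by (rule Suc.IH)
      then show ?thesis using False by (intro split[of k d]) auto
    qed (rule small)
  qed
qed

text \<open>Tiny pieces are split off one at a time. The offset \<open>d\<close> is quantified
  inside the induction because what remains of the arc, renormalised to start at 0, has both indices
  moved by \<open>l\<close>.\<close>

lemma exch_normalizers:
  assumes "disjoint_shifts (A k) i j"
  shows "exch (A k) i j \<in> normalizers"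
proof (cases "i = j")
  case True
  then show ?thesis using GZ_comp by (auto simp: exch_same normalizers_def)
next
  case False
  obtain l where l: "tiny \<bar>i - j\<bar> l" "0 < \<theta> l" using tiny_exists by blast
  have "\<forall>d. disjoint_shifts (A k) (i + d) (j + d) \<longrightarrow> exch (A k) (i + d) (j + d) \<in> normalizers"
  proof (rule arc_induct[OF l(2), of "\<lambda>k _. \<forall>d. disjoint_shifts (A k) (i + d) (j + d) \<longrightarrow> exch (A k) (i + d) (j + d) \<in> normalizers"])
    show "\<forall>d. disjoint_shifts (A k) (i + d) (j + d) \<longrightarrow> exch (A k) (i + d) (j + d) \<in> normalizers"
      if "\<theta> k \<le> \<theta> l" for k
      using False tiny_mono[OF l(1) that] by (auto intro: exch_tiny_normalizers)
    show "\<forall>d. disjoint_shifts (A k) (i + d) (j + d) \<longrightarrow> exch (A k) (i + d) (j + d) \<in> normalizers"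
      if kl: "\<theta> l \<le> \<theta> k"
        and IH: "\<forall>d. disjoint_shifts (A (k - l)) (i + d) (j + d) \<longrightarrow> exch (A (k - l)) (i + d) (j + d) \<in> normalizers" for k
    proof (intro allI impI)
      fix d assume d: "disjoint_shifts (A k) (i + d) (j + d)"
      have "exch (A (k - l)) (i + d + l) (j + d + l) \<in> normalizers"
        using IH disjoint_A_split(3)[OF d kl] by (metis add.assoc)
      moreover have "exch (A l) (i + d) (j + d) \<in> normalizers"
        by (rule exch_tiny_normalizers[OF l(1)]) (use False in auto)
      ultimately show "exch (A k) (i + d) (j + d) \<in> normalizers"
        unfolding exch_A_split[OF d kl] using normalizers_comp by blast
    qed
  qed
  from this[rule_format, of 0] show ?thesis using assms by simp
qed

text \<open>Two involutions whose product is an involution commute. Hence f1 f2 g1 g2 = (f2 (f1 g1)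
  f2) (f2 g2), and the first factor is a conjugate by the normalizing element f2.\<close>

lemma GZ_comp_pairs:
  assumes f: "f1 \<circ> f1 = id" "f2 \<circ> f2 = id" "(f1 \<circ> f2) \<circ> (f1 \<circ> f2) = id" "f2 \<in> normalizers"
    and "f1 \<circ> g1 \<in> GZ" "f2 \<circ> g2 \<in> GZ"
  shows "(f1 \<circ> f2) \<circ> (g1 \<circ> g2) \<in> GZ"
proof -
  have "f1 \<circ> f2 = f2 \<circ> f1"
  proof -
    have "f2 \<circ> f1 = f2 \<circ> f1 \<circ> ((f1 \<circ> f2) \<circ> (f1 \<circ> f2))" unfolding f(3) by (simp only: comp_id)
    also have "\<dots> = f2 \<circ> (f1 \<circ> f1) \<circ> f2 \<circ> (f1 \<circ> f2)" by (simp only: comp_assoc)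
    also have "\<dots> = f1 \<circ> f2" unfolding f(1) comp_id f(2) by (simp only: id_comp)
    finally show ?thesis by simp
  qed
  then have "(f1 \<circ> f2) \<circ> (g1 \<circ> g2) = f2 \<circ> (f1 \<circ> g1) \<circ> (id \<circ> g2)" by (simp only: comp_assoc id_comp)
  also have "\<dots> = (f2 \<circ> (f1 \<circ> g1) \<circ> f2) \<circ> (f2 \<circ> g2)" unfolding f(2)[symmetric] by (simp only: comp_assoc)
  finally show ?thesis
    using GZ_comp[OF normalizers_involution[OF f(4,2) assms(5)] assms(6)] by (simp only:)
qed

lemma exch_equiv:
  assumes "disjoint_shifts (A k) i j" "disjoint_shifts (A k) i' j'" "i \<noteq> j" "i' \<noteq> j'"
  shows "exch (A k) i j \<circ> exch (A k) i' j' \<in> GZ"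
proof -
  define L where "L = max \<bar>i - j\<bar> \<bar>i' - j'\<bar>"
  obtain l where l: "tiny L l" "0 < \<theta> l" using tiny_exists by blast
  \<comment> \<open>The offset \<open>d\<close> marks the beginning of the piece still to be
    treated. Disjointness is stated without it, since it depends only on the difference of the
    indices.\<close>
  define P where "P k d \<longleftrightarrow> (disjoint_shifts (A k) i j \<longrightarrow> disjoint_shifts (A k) i' j' \<longrightarrow>
    exch (A k) (i + d) (j + d) \<circ> exch (A k) (i' + d) (j' + d) \<in> GZ)" for k d
  have "P k 0"
  proof (rule arc_induct[OF l(2)])
    show "P k d" if "\<theta> k \<le> \<theta> l" for k d
      unfolding P_def by (intro impI exch_tiny[OF tiny_mono[OF l(1) that]]) (use assms in \<open>auto simp: L_def\<close>)
    show "P k d" if kl: "\<theta> l \<le> \<theta> k" and IH: "P (k - l) (d + l)" for k d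
      unfolding P_def
    proof (intro impI)
      assume d: "disjoint_shifts (A k) i j" "disjoint_shifts (A k) i' j'"
      have dd: "disjoint_shifts (A k) (i + d) (j + d)" "disjoint_shifts (A k) (i' + d) (j' + d)"
        using d by (auto intro: disjoint_shifts_diff)
      note sp = disjoint_A_split[OF dd(1) kl]
      have "exch (A k) (i + d) (j + d) \<circ> exch (A k) (i + d) (j + d) = id"
        by (rule exch_involutory[OF dd(1)])
      moreover have "exch (A (k - l)) (i + (d + l)) (j + (d + l)) \<circ> exch (A (k - l)) (i' + (d + l)) (j' + (d + l)) \<in> GZ"
        using IH disjoint_A_split(2)[OF d(1) kl] disjoint_A_split(2)[OF d(2) kl] unfolding P_def by blast
      moreover have "exch (A l) (i + d) (j + d) \<circ> exch (A l) (i' + d) (j' + d) \<in> GZ"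
        by (rule exch_tiny[OF l(1)]) (use assms in \<open>auto simp: L_def\<close>)
      ultimately show "exch (A k) (i + d) (j + d) \<circ> exch (A k) (i' + d) (j' + d) \<in> GZ"
        unfolding exch_A_split[OF dd(1) kl] exch_A_split[OF dd(2) kl] add.assoc[symmetric]
        by (intro GZ_comp_pairs exch_involutory sp exch_normalizers)
    qed
  qed
  then show ?thesis using assms by (simp add: P_def)
qed

section \<open>Parity of the length of an arc\<close>

definition turns :: "int \<Rightarrow> int" where
  "turns k = \<lfloor>of_int k * \<alpha>\<rfloor>"

lemma turns_decomp: "of_int k * \<alpha> = \<theta> k + of_int (turns k)"
  unfolding turns_def by (rule \<theta>_decomp)

lemma turns_diff:
  assumes "\<theta> l \<le> \<theta> k"
  shows "turns (k - l) = turns k - turns l"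
proof -
  have "\<theta> (k - l) = \<theta> k - \<theta> l" using assms by (simp add: \<theta>_diff)
  then have "real_of_int (turns (k - l)) = of_int (turns k - turns l)"
    using turns_decomp[of "k - l"] turns_decomp[of k] turns_decomp[of l] by (simp add: algebra_simps)
  then show ?thesis by (simp only: of_int_eq_iff)
qed

lemma turns_1: "turns 1 = 0"
  using turns_decomp[of 1] by (simp add: \<theta>_1)

text \<open>The length of \<open>A k\<close> is k \<alpha> - \<open>turns k\<close>. If both
  coordinates are even, half of this length is again the length of an arc, so the exchange is a
  product of two congruent exchanges.\<close>

lemma exch_GZ_even_even:
  assumes d: "disjoint_shifts (A k) i j" and "even k" "even (turns k)"
  shows "exch (A k) i j \<in> GZ"
proof (cases "i = j")
  case True
  then show ?thesis using id_GZ by (simp only: exch_same)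
next
  case False
  obtain k' m where k': "k = 2 * k'" "turns k = 2 * m" using assms by (auto elim!: evenE)
  have \<theta>: "\<theta> k' = \<theta> k / 2"
    by (rule \<theta>_eqI[of _ _ m]) (use turns_decomp[of k] \<theta>_ge_0[of k] \<theta>_less_1[of k] k' in auto)
  have le: "\<theta> k' \<le> \<theta> k" using \<theta> \<theta>_ge_0[of k] by simp
  have kk: "k - k' = k'" using k' by simp
  show ?thesis
    unfolding exch_A_split[OF d le] kk
    using disjoint_A_split[OF d le] False unfolding kk by (intro exch_equiv) auto
qed

text \<open>For odd \<open>k\<close> the arc is compared with \<open>A 1\<close>, whose exchange is
  \<open>\<sigma>\<close>: either its complement in \<open>A 1\<close> or what is left after
  removing \<open>A 1\<close> has a length with both coordinates even.\<close>

lemma exch_GZ_even: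
  assumes d: "disjoint_shifts (A k) i j" and ev: "even (turns k)"
  shows "exch (A k) i j \<in> GZ"
proof -
  consider "i = j" | "i \<noteq> j" "even k" | "i \<noteq> j" "odd k" "\<theta> k < \<alpha>" | "i \<noteq> j" "odd k" "\<alpha> \<le> \<theta> k" by force
  then show ?thesis
  proof cases
    case 1
    then show ?thesis using id_GZ by (simp only: exch_same)
  next
    case 2
    then show ?thesis using d ev exch_GZ_even_even by blast
  next
    case 3
    then have le: "\<theta> k \<le> \<theta> 1" by (simp add: \<theta>_1)
    note sp = disjoint_A_split[OF disjoint_A1_01 le]
    have "exch (A (1 - k)) (0 + k) (1 + k) \<in> GZ"
      by (rule exch_GZ_even_even[OF sp(3)]) (use 3 ev turns_diff[OF le] in \<open>auto simp: turns_1\<close>)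
    then have 01: "exch (A k) 0 1 \<in> GZ"
      using \<sigma>_GZ unfolding exch_A_split[OF disjoint_A1_01 le] by (rule GZ_cancel_right)
    show ?thesis
      by (rule GZ_cancel_right[OF 01 exch_equiv[OF d sp(1)]]) (use 3 in auto)
  next
    case 4
    then have le: "\<theta> 1 \<le> \<theta> k" by (simp add: \<theta>_1)
    note sp = disjoint_A_split[OF d le]
    have "exch (A (k - 1)) (i + 1) (j + 1) \<in> GZ"
      by (rule exch_GZ_even_even[OF sp(3)]) (use 4 ev turns_diff[OF le] in \<open>auto simp: turns_1\<close>)
    moreover have "exch (A 1) i j \<in> GZ"
      by (rule GZ_cancel_right[OF \<sigma>_GZ exch_equiv[OF sp(1) disjoint_A1_01]]) (use 4 in auto)
    ultimately show ?thesis unfolding exch_A_split[OF d le] using GZ_comp by blast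
  qed
qed

text \<open>Cutting the shorter length off the longer arc leaves a length with even
  \<open>turns\<close>, whose exchange is in \<open>GZ\<close>; the two remaining exchanges have
  equal length.\<close>

lemma exch_GZ_odd_pair:
  assumes d: "disjoint_shifts (A k) i j" "disjoint_shifts (A l) i' j'" "i \<noteq> j" "i' \<noteq> j'"
    and odd: "odd (turns k)" "odd (turns l)"
  shows "exch (A k) i j \<circ> exch (A l) i' j' \<in> GZ"
proof -
  have *: "exch (A k) i j \<circ> exch (A l) i' j' \<in> GZ"
    if d: "disjoint_shifts (A k) i j" "disjoint_shifts (A l) i' j'" "i \<noteq> j" "i' \<noteq> j'"
    and odd: "odd (turns k)" "odd (turns l)" and le: "\<theta> l \<le> \<theta> k" for i j k i' j' l
  proof -
    note sp = disjoint_A_split[OF d(1) le]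
    let ?f = "exch (A l) i j" and ?h = "exch (A (k - l)) (i + l) (j + l)" and ?g = "exch (A l) i' j'"
    have h: "?h \<in> GZ" by (rule exch_GZ_even[OF sp(3)]) (use odd turns_diff[OF le] in auto)
    have ff: "?f \<circ> ?f = id" by (rule exch_involutory[OF sp(1)])
    have "?f \<circ> ?h \<circ> ?g = ?f \<circ> ?h \<circ> (?f \<circ> ?f) \<circ> ?g" unfolding ff by (simp only: comp_id)
    also have "\<dots> = (?f \<circ> ?h \<circ> ?f) \<circ> (?f \<circ> ?g)" by (simp only: comp_assoc)
    finally have eq: "?f \<circ> ?h \<circ> ?g = (?f \<circ> ?h \<circ> ?f) \<circ> (?f \<circ> ?g)" .
    show ?thesis
      unfolding exch_A_split[OF d(1) le] eq
      by (rule GZ_comp[OF normalizers_involution[OF exch_normalizers[OF sp(1)] ff h] exch_equiv[OF sp(1) d(2-4)]])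
  qed
  show ?thesis
  proof (cases "\<theta> l \<le> \<theta> k")
    case True
    then show ?thesis using * assms by blast
  next
    case False
    then have "exch (A l) i' j' \<circ> exch (A k) i j \<in> GZ" using * assms by auto
    then show ?thesis by (rule GZ_sym) (use d in \<open>auto simp: exch_involutory\<close>)
  qed
qed

definition arc_exchanges :: "(int \<Rightarrow> int) set" where
  "arc_exchanges = {exch (A k) i j | k i j. disjoint_shifts (A k) i j}"

text \<open>The subgroup on which the exchange calculus applies. It turns out to be the whole full
  group on the orbit, by \<open>MZ_FZ\<close> and \<open>FZ_MZ\<close>.\<close>

definition MZ :: "(int \<Rightarrow> int) set" where
  "MZ = compositions ({translation 1, translation (- 1)} \<union> arc_exchanges)"

lemma arc_exchanges_dichotomy:
  assumes "S \<in> arc_exchanges" "T \<in> arc_exchanges" "S \<notin> GZ" "T \<notin> GZ"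
  shows "S \<circ> T \<in> GZ"
proof -
  have *: "\<exists>k i j. R = exch (A k) i j \<and> disjoint_shifts (A k) i j \<and> i \<noteq> j \<and> odd (turns k)"
    if "R \<in> arc_exchanges" "R \<notin> GZ" for R
  proof -
    have "R \<in> arc_exchanges" by (rule that)
    then obtain k i j where R: "R = exch (A k) i j" "disjoint_shifts (A k) i j"
      unfolding arc_exchanges_def by blast
    moreover have "odd (turns k)" using R that exch_GZ_even by blast
    moreover have "i \<noteq> j" using R(1) that(2) id_GZ exch_same by metis
    ultimately show ?thesis by blast
  qed
  show ?thesis using *[OF assms(1,3)] *[OF assms(2,4)] exch_GZ_odd_pair by blast
qed

text \<open>The cosets \<open>GZ\<close> and \<open>GZ\<close> T exhaust \<open>MZ\<close>: a
  generator outside \<open>GZ\<close> is congruent to T, and it normalizes \<open>GZ\<close>, so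
  multiplying by it interchanges the two cosets.\<close>

lemma MZ_cases:
  assumes T: "T \<in> arc_exchanges" "T \<notin> GZ" and "f \<in> MZ"
  shows "f \<in> GZ \<or> f \<circ> T \<in> GZ"
  using assms(3) unfolding MZ_def
proof induction
  case id
  show ?case using id_GZ by blast
next
  case (step s f)
  have TT: "T \<circ> T = id" using T exch_involutory by (auto simp: arc_exchanges_def)
  show ?case
  proof (cases "s \<in> GZ")
    case True
    then show ?thesis using step.IH GZ_comp[OF True] by (metis comp_assoc)
  next
    case False
    moreover have "translation 1 \<in> GZ" "translation (- 1) \<in> GZ" by (rule translation_GZ)+
    ultimately have s: "s \<in> arc_exchanges" using step(1) by auto
    then have ss: "s \<circ> s = id" and sN: "s \<in> normalizers"
      using exch_involutory exch_normalizers by (auto simp: arc_exchanges_def)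
    have sT: "s \<circ> T \<in> GZ" by (rule arc_exchanges_dichotomy[OF s T(1) False T(2)])
    from step.IH show ?thesis
    proof
      assume "f \<in> GZ"
      have "s \<circ> f \<circ> T = s \<circ> f \<circ> (s \<circ> s) \<circ> T" unfolding ss by (simp only: comp_id)
      also have "\<dots> = (s \<circ> f \<circ> s) \<circ> (s \<circ> T)" by (simp only: comp_assoc)
      finally show ?thesis
        using GZ_comp[OF normalizers_involution[OF sN ss \<open>f \<in> GZ\<close>] sT] by (simp only: simp_thms)
    next
      assume fT: "f \<circ> T \<in> GZ"
      have "s \<circ> f = s \<circ> f \<circ> (T \<circ> (s \<circ> s) \<circ> T)" unfolding ss comp_id TT ..
      also have "\<dots> = (s \<circ> (f \<circ> T) \<circ> s) \<circ> (s \<circ> T)" by (simp only: comp_assoc)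
      finally show ?thesis
        using GZ_comp[OF normalizers_involution[OF sN ss fT] sT] by (simp only: simp_thms)
    qed
  qed
qed

theorem MZ_index_two:
  assumes "f \<in> MZ" "g \<in> MZ" "f \<notin> GZ" "g \<notin> GZ"
  shows "f \<circ> g \<in> GZ"
proof -
  \<comment> \<open>The element \<open>f\<close> supplies T: if all arc exchanges were in
    \<open>GZ\<close>, then so would be all of \<open>MZ\<close>.\<close>
  have "\<exists>T\<in>arc_exchanges. T \<notin> GZ"
  proof (rule ccontr)
    assume *: "\<not> (\<exists>T\<in>arc_exchanges. T \<notin> GZ)"
    have "translation 1 \<in> GZ" "translation (- 1) \<in> GZ" by (rule translation_GZ)+
    with * have sub: "{translation 1, translation (- 1)} \<union> arc_exchanges \<subseteq> GZ" by blast
    show False using compositions_subset[OF sub[unfolded GZ_def]] assms(1,3) unfolding MZ_def GZ_def by blast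
  qed
  then obtain T where T: "T \<in> arc_exchanges" "T \<notin> GZ" by blast
  have TT: "T \<circ> T = id" and TN: "T \<in> normalizers"
    using T exch_involutory exch_normalizers by (auto simp: arc_exchanges_def)
  have fT: "f \<circ> T \<in> GZ" and gT: "g \<circ> T \<in> GZ" using MZ_cases[OF T] assms by blast+
  have "f \<circ> g = (f \<circ> (T \<circ> T)) \<circ> (g \<circ> (T \<circ> T))" unfolding TT comp_id ..
  also have "\<dots> = (f \<circ> T) \<circ> (T \<circ> (g \<circ> T) \<circ> T)" by (simp only: comp_assoc)
  finally show ?thesis using GZ_comp[OF fT normalizers_involution[OF TN TT gT]] by (simp only:)
qed

section \<open>The full group on the orbit\<close>

definition w :: "int \<Rightarrow> bool" where
  "w n \<longleftrightarrow> \<theta> n < \<alpha>"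

definition agree :: "int \<Rightarrow> int \<Rightarrow> int \<Rightarrow> bool" where
  "agree N n n' \<longleftrightarrow> (\<forall>j. \<bar>j\<bar> \<le> N \<longrightarrow> w (n + j) = w (n' + j))"

lemma agree_mono: "agree N n n' \<Longrightarrow> M \<le> N \<Longrightarrow> agree M n n'"
  by (simp add: agree_def)

lemma agree_shift:
  assumes "agree M n n'" "N + \<bar>d\<bar> \<le> M"
  shows "agree N (n + d) (n' + d)"
  unfolding agree_def
proof (intro allI impI)
  fix j :: int assume "\<bar>j\<bar> \<le> N"
  then have "\<bar>d + j\<bar> \<le> M" using assms(2) by linarith
  then show "w (n + d + j) = w (n' + d + j)" using assms(1) unfolding agree_def by (metis add.assoc)
qed

text \<open>The traces on the orbit of the clopen subsets of the shift.\<close>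

definition window_set :: "int set \<Rightarrow> bool" where
  "window_set V \<longleftrightarrow> (\<exists>N\<ge>0. \<forall>n n'. agree N n n' \<longrightarrow> (n \<in> V \<longleftrightarrow> n' \<in> V))"

lemma window_set_Compl: "window_set V \<Longrightarrow> window_set (- V)"
  by (auto simp: window_set_def)

lemma window_set_Int:
  assumes "window_set V" "window_set W"
  shows "window_set (V \<inter> W)"
proof -
  obtain N M where "N \<ge> 0" "M \<ge> 0" "\<And>n n'. agree N n n' \<Longrightarrow> n \<in> V \<longleftrightarrow> n' \<in> V" "\<And>n n'. agree M n n' \<Longrightarrow> n \<in> W \<longleftrightarrow> n' \<in> W"
    using assms unfolding window_set_def by blast
  then have "0 \<le> max N M" "\<forall>n n'. agree (max N M) n n' \<longrightarrow> (n \<in> V \<inter> W \<longleftrightarrow> n' \<in> V \<inter> W)"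
    using agree_mono[of "max N M" _ _ N] agree_mono[of "max N M" _ _ M] by (simp, metis Int_iff max.cobounded1 max.cobounded2)
  then show ?thesis unfolding window_set_def by blast
qed

lemma window_set_Un: "window_set V \<Longrightarrow> window_set W \<Longrightarrow> window_set (V \<union> W)"
  using window_set_Compl[OF window_set_Int[OF window_set_Compl window_set_Compl, of V W]] by simp

lemma window_set_shift:
  assumes "window_set V"
  shows "window_set (shift_set V d)"
proof -
  obtain N where N: "N \<ge> 0" "\<And>n n'. agree N n n' \<Longrightarrow> n \<in> V \<longleftrightarrow> n' \<in> V"
    using assms unfolding window_set_def by blast
  have "n - d \<in> V \<longleftrightarrow> n' - d \<in> V" if "agree (N + \<bar>d\<bar>) n n'" for n n'
    using N(2)[OF agree_shift[OF that, of N "- d"]] by simp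
  then show ?thesis unfolding window_set_def using N(1) by (intro exI[of _ "N + \<bar>d\<bar>"]) auto
qed

lemma window_set_A1: "window_set (A 1)"
  unfolding window_set_def
proof (intro exI[of _ 0] conjI allI impI)
  fix n n' assume "agree 0 n n'"
  then have "w n = w n'" unfolding agree_def by (metis abs_zero add_0_right order_refl)
  then show "n \<in> A 1 \<longleftrightarrow> n' \<in> A 1" by (simp add: mem_A w_def \<theta>_1)
qed simp

text \<open>Moving the end point of the arc forward by \<alpha> adjoins a translate of [0, \<alpha>)
  when it does not pass 0. When it does, the new arc is the part of that translate lying beyond 0,
  an intersection with the old arc. Backward steps use complements in the same way.\<close>

lemma window_set_A: "window_set (A k)"
proof (induction k rule: int_induct[of _ 0])
  case base
  have "A 0 = {}" using \<theta>_ge_0 by (auto simp: A_def not_less)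
  then show ?case by (auto simp: window_set_def)
next
  case (step1 k)
  have sh: "window_set (shift_set (A 1) k)" by (rule window_set_shift[OF window_set_A1])
  show ?case
  proof (cases "\<theta> k + \<alpha> < 1")
    case True
    then have "\<theta> k \<le> \<theta> (k + 1)" using \<alpha>_pos by (simp add: \<theta>_add \<theta>_1)
    then have "A (k + 1) = A k \<union> shift_set (A 1) k" using A_split(1)[of k "k + 1"] by simp
    then show ?thesis using window_set_Un[OF step1(2) sh] by simp
  next
    case False
    then have e: "\<theta> (k + 1) = \<theta> k + \<alpha> - 1" using \<theta>_add[of k 1] by (simp add: \<theta>_1)
    have "n \<in> A (k + 1) \<longleftrightarrow> n \<in> A k \<inter> shift_set (A 1) k" for n
      using \<theta>_diff[of n k] \<theta>_less_1[of n] \<alpha>_less False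
      by (auto simp: mem_A e \<theta>_1 split: if_splits)
    then have "A (k + 1) = A k \<inter> shift_set (A 1) k" by blast
    then show ?thesis using window_set_Int[OF step1(2) sh] by simp
  qed
next
  case (step2 k)
  have sh: "window_set (shift_set (A 1) (k - 1))" by (rule window_set_shift[OF window_set_A1])
  show ?case
  proof (cases "\<alpha> \<le> \<theta> k")
    case True
    then have "\<theta> (k - 1) \<le> \<theta> k" using \<alpha>_pos by (simp add: \<theta>_diff \<theta>_1)
    from A_split[OF this] have "A (k - 1) = A k \<inter> - shift_set (A 1) (k - 1)" by auto
    then show ?thesis using window_set_Int[OF step2(2) window_set_Compl[OF sh]] by simp
  next
    case False
    then have e: "\<theta> (k - 1) = \<theta> k - \<alpha> + 1" using \<theta>_diff[of k 1] by (simp add: \<theta>_1)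
    have "n \<in> A (k - 1) \<longleftrightarrow> n \<in> - shift_set (A 1) (k - 1) \<union> A k" for n
    proof -
      have "\<theta> (n - (k - 1)) = (if \<theta> k - \<alpha> + 1 \<le> \<theta> n then \<theta> n - (\<theta> k - \<alpha> + 1) else \<theta> n - (\<theta> k - \<alpha> + 1) + 1)"
        unfolding \<theta>_diff[of n "k - 1"] e ..
      then show ?thesis
        unfolding Un_iff Compl_iff mem_shift_set mem_A e \<theta>_1
        using \<theta>_less_1[of n] \<theta>_ge_0[of k] \<alpha>_less \<alpha>_pos by (cases "\<theta> k - \<alpha> + 1 \<le> \<theta> n") auto
    qed
    then have "A (k - 1) = - shift_set (A 1) (k - 1) \<union> A k" by blast
    then show ?thesis using window_set_Un[OF window_set_Compl[OF sh] step2(2)] by simp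
  qed
qed

text \<open>The topological full group, acting on the orbit of the point \<open>0\<close> of the circle.\<close>

definition FZ :: "(int \<Rightarrow> int) set" where
  "FZ = {g. bij g \<and> (\<exists>N\<ge>0. \<forall>n n'. agree N n n' \<longrightarrow> g n - n = g n' - n')}"

text \<open>The displacement is a function of a window of fixed size, and there are finitely many
  such windows.\<close>

lemma FZ_bounded:
  assumes "g \<in> FZ"
  obtains B where "B \<ge> 0" "\<And>n. \<bar>g n - n\<bar> \<le> B"
proof -
  obtain N where N: "N \<ge> 0" "\<And>n n'. agree N n n' \<Longrightarrow> g n - n = g n' - n'"
    using assms unfolding FZ_def by blast
  define pat where "pat n = {j \<in> {-N..N}. w (n + j)}" for n
  have "g n - n = g n' - n'" if "pat n = pat n'" for n n'
  proof (rule N(2))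
    show "agree N n n'"
      unfolding agree_def
    proof (intro allI impI)
      fix j assume "\<bar>j\<bar> \<le> N"
      then have "j \<in> {-N..N}" by auto
      then have "w (m + j) \<longleftrightarrow> j \<in> pat m" for m by (simp add: pat_def)
      then show "w (n + j) = w (n' + j)" using that by simp
    qed
  qed
  note same = this
  have some: "pat (SOME n'. pat n' = pat n) = pat n" for n by (rule someI) simp
  define F where "F p = g (SOME n. pat n = p) - (SOME n. pat n = p)" for p
  have F: "g n - n = F (pat n)" for n unfolding F_def by (rule same[OF some[symmetric]])
  have "finite (range pat)"
    by (rule finite_subset[of _ "Pow {-N..N}"]) (auto simp: pat_def)
  then have fin: "finite (range (\<lambda>n. \<bar>g n - n\<bar>))"
    using finite_imageI[of "range pat" "\<lambda>p. \<bar>F p\<bar>"] by (simp add: F image_image)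
  show thesis
  proof (rule that[of "Max (range (\<lambda>n. \<bar>g n - n\<bar>))"])
    show le: "\<bar>g n - n\<bar> \<le> Max (range (\<lambda>n. \<bar>g n - n\<bar>))" for n
      by (rule Max_ge[OF fin]) simp
    show "0 \<le> Max (range (\<lambda>n. \<bar>g n - n\<bar>))" using le[of 0] by linarith
  qed
qed

lemma FZ_comp:
  assumes f: "f \<in> FZ" and g: "g \<in> FZ"
  shows "f \<circ> g \<in> FZ"
proof -
  obtain N where N: "N \<ge> 0" "\<And>n n'. agree N n n' \<Longrightarrow> f n - n = f n' - n'"
    using f unfolding FZ_def by blast
  obtain M where M: "M \<ge> 0" "\<And>n n'. agree M n n' \<Longrightarrow> g n - n = g n' - n'"
    using g unfolding FZ_def by blast
  obtain B where B: "B \<ge> 0" "\<And>n. \<bar>g n - n\<bar> \<le> B" using FZ_bounded[OF g] by blast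
  have "f (g n) - n = f (g n') - n'" if a: "agree (M + N + B) n n'" for n n'
  proof -
    have e: "g n - n = g n' - n'" by (rule M(2)[OF agree_mono[OF a]]) (use N B in auto)
    have "agree N (n + (g n - n)) (n' + (g n - n))"
      by (rule agree_shift[OF a]) (use B(2)[of n] M in auto)
    moreover have "n + (g n - n) = g n" "n' + (g n - n) = g n'" using e by simp_all
    ultimately have "f (g n) - g n = f (g n') - g n'" using N(2) by metis
    then show ?thesis using e by simp
  qed
  then have "\<forall>n n'. agree (M + N + B) n n' \<longrightarrow> (f \<circ> g) n - n = (f \<circ> g) n' - n'" by simp
  moreover have "bij (f \<circ> g)" using f g unfolding FZ_def by (auto intro: bij_comp)
  moreover have "0 \<le> M + N + B" using N M B by simp
  ultimately show ?thesis unfolding FZ_def by blast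
qed

lemma translation_FZ: "translation k \<in> FZ"
  unfolding FZ_def by auto

lemma exch_FZ:
  assumes "window_set V" "disjoint_shifts V i j"
  shows "exch V i j \<in> FZ"
proof -
  obtain N where N: "N \<ge> 0" "\<And>n n'. agree N n n' \<Longrightarrow> n \<in> V \<longleftrightarrow> n' \<in> V"
    using assms unfolding window_set_def by blast
  have "exch V i j n - n = exch V i j n' - n'" if a: "agree (N + \<bar>i\<bar> + \<bar>j\<bar>) n n'" for n n'
  proof -
    have "agree N (n + (- i)) (n' + (- i))" "agree N (n + (- j)) (n' + (- j))"
      by (rule agree_shift[OF a]; simp)+
    then have "n - i \<in> V \<longleftrightarrow> n' - i \<in> V" "n - j \<in> V \<longleftrightarrow> n' - j \<in> V" using N(2) by auto
    then show ?thesis by (simp add: exch_def)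
  qed
  moreover have "0 \<le> N + \<bar>i\<bar> + \<bar>j\<bar>" using N by simp
  ultimately show ?thesis using bij_exch[OF assms(2)] unfolding FZ_def by blast
qed

lemma MZ_FZ: "f \<in> MZ \<Longrightarrow> f \<in> FZ"
  unfolding MZ_def
proof (induction rule: compositions.induct)
  case id
  show ?case using translation_FZ[of 0] unfolding translation_0 .
next
  case (step s f)
  have "s \<in> FZ"
    using step(1) translation_FZ exch_FZ[OF window_set_A] by (auto simp: arc_exchanges_def)
  then show ?case using step.IH by (rule FZ_comp)
qed

lemma bij_MZ: "f \<in> MZ \<Longrightarrow> bij f"
  using MZ_FZ by (auto simp: FZ_def)

lemma MZ_comp: "f \<in> MZ \<Longrightarrow> g \<in> MZ \<Longrightarrow> f \<circ> g \<in> MZ"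
  unfolding MZ_def by (rule compositions_comp)

lemma inv_MZ: "f \<in> MZ \<Longrightarrow> inv_into UNIV f \<in> MZ"
  unfolding MZ_def
proof (erule inv_compositions[rotated 2])
  fix s assume s: "s \<in> {translation 1, translation (- 1)} \<union> arc_exchanges"
  then show "bij s" by (auto simp: arc_exchanges_def intro: bij_exch)
  have "inv_into UNIV s \<in> {translation 1, translation (- 1)} \<union> arc_exchanges"
    using s inv_exch by (auto simp: inv_translation arc_exchanges_def)
  then show "inv_into UNIV s \<in> compositions ({translation 1, translation (- 1)} \<union> arc_exchanges)"
    by (rule compositions_base)
qed

lemma translation_MZ: "translation k \<in> MZ"
  using translation_GZ[of k] unfolding GZ_def MZ_def
proof (rule compositions_subset[rotated])
  have "\<sigma> \<in> arc_exchanges" using disjoint_A1_01 unfolding arc_exchanges_def by blast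
  then show "{translation 1, translation (- 1), \<sigma>} \<subseteq> compositions ({translation 1, translation (- 1)} \<union> arc_exchanges)"
    by (auto intro: compositions_base)
qed

text \<open>As n runs through the arc, \<open>w (n + j)\<close> can change only where \<theta> n
  passes \<theta>(- j) or \<theta>(1 - j). The breakpoints of a window of radius N are therefore the
  orbit points with index from -N to N + 1. One of them may be the left end \<open>d\<close>, since
  the arcs of the coding contain their left ends.\<close>

lemma agree_arc:
  assumes clean: "\<And>c. c \<in> {-N..N + 1} \<Longrightarrow> c - d \<in> A k \<Longrightarrow> c = d" and n: "n - d \<in> A k"
  shows "agree N n d"
  unfolding agree_def
proof (intro allI impI)
  fix j :: int assume j: "\<bar>j\<bar> \<le> N"
  define x where "x = n - d"
  have x: "\<theta> x < \<theta> k" using n by (simp add: x_def mem_A)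
  have nj: "n + j = (d + j) + x" by (simp add: x_def)
  show "w (n + j) = w (d + j)"
  proof (cases "\<theta> (d + j) < \<alpha>")
    case True
    then have y: "\<theta> (1 - (d + j)) = \<alpha> - \<theta> (d + j)" by (simp add: \<theta>_diff \<theta>_1)
    have "1 - j \<in> {-N..N + 1}" using j by auto
    moreover have e: "1 - j - d = 1 - (d + j)" by simp
    moreover have "1 - j \<noteq> d"
    proof
      assume "1 - j = d"
      then have "1 - (d + j) = 0" by simp
      then show False using y True by simp
    qed
    ultimately have "\<not> \<theta> (1 - (d + j)) < \<theta> k" using clean[of "1 - j"] unfolding mem_A e by blast
    then have "\<theta> (d + j) + \<theta> x < \<alpha>" using x y by linarith
    moreover from this have "\<theta> (n + j) = \<theta> (d + j) + \<theta> x" unfolding nj \<theta>_add[of "d + j" x] using \<alpha>_less by simp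
    ultimately show ?thesis using True by (simp add: w_def)
  next
    case False
    then have "d + j \<noteq> 0" using \<alpha>_pos by auto
    then have y: "\<theta> (- (d + j)) = 1 - \<theta> (d + j)" by (rule \<theta>_uminus)
    have "- j \<in> {-N..N + 1}" using j by auto
    moreover have e: "- j - d = - (d + j)" by simp
    moreover have "- j \<noteq> d" using \<open>d + j \<noteq> 0\<close> by auto
    ultimately have "\<not> \<theta> (- (d + j)) < \<theta> k" using clean[of "- j"] unfolding mem_A e by blast
    then have "\<theta> (d + j) + \<theta> x < 1" using x y by linarith
    then have "\<theta> (n + j) = \<theta> (d + j) + \<theta> x" unfolding nj \<theta>_add[of "d + j" x] by simp
    then show ?thesis using False \<theta>_ge_0[of x] by (simp add: w_def)
  qed
qed

text \<open>The pair (k, d) stands for the arc of length \<theta> k starting at \<open>d\<close>.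
  Cutting at a point of \<open>F\<close> other than \<open>d\<close> leaves strictly fewer such
  points in each part.\<close>

lemma arc_cut_induct:
  assumes "finite F"
    and clean: "\<And>k d. (\<And>c. c \<in> F \<Longrightarrow> c - d \<in> A k \<Longrightarrow> c = d) \<Longrightarrow> P k d"
    and cut: "\<And>k d c. c - d \<in> A k \<Longrightarrow> P (c - d) d \<Longrightarrow> P (k - (c - d)) c \<Longrightarrow> P k d"
  shows "P k d"
proof (induction "card {c \<in> F. c - d \<in> A k \<and> c \<noteq> d}" arbitrary: k d rule: less_induct)
  case less
  show ?case
  proof (cases "\<exists>c\<in>F. c - d \<in> A k \<and> c \<noteq> d")
    case False
    then show ?thesis by (intro clean) blast
  next
    case True
    then obtain c where c: "c \<in> F" "c - d \<in> A k" "c \<noteq> d" by blast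
    let ?S = "{c \<in> F. c - d \<in> A k \<and> c \<noteq> d}"
    have fin: "finite ?S" using \<open>finite F\<close> by simp
    have le: "\<theta> (c - d) \<le> \<theta> k" using c by (simp add: mem_A)
    note sp = A_split[OF le]
    have "P (c - d) d"
    proof (rule less, rule psubset_card_mono[OF fin])
      show "{c' \<in> F. c' - d \<in> A (c - d) \<and> c' \<noteq> d} \<subset> ?S"
        using c sp(1) by (auto simp: mem_A)
    qed
    moreover have "P (k - (c - d)) c"
    proof (rule less, rule psubset_card_mono[OF fin])
      have "c' - d \<in> A k \<and> c' \<noteq> d" if "c' - c \<in> A (k - (c - d))" "c' \<noteq> c" for c'
      proof -
        have sh: "c' - d \<in> shift_set (A (k - (c - d))) (c - d)" using that by simp
        then have "c' - d \<notin> A (c - d)" using sp(2) by blast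
        moreover have "d - d \<in> A (c - d)" using c by (simp add: mem_A \<theta>_pos)
        ultimately show ?thesis using sh sp(1) by blast
      qed
      then show "{c' \<in> F. c' - c \<in> A (k - (c - d)) \<and> c' \<noteq> c} \<subset> ?S"
        using c by auto
    qed
    ultimately show ?thesis using cut[OF c(2)] by blast
  qed
qed

text \<open>Steps of length \<theta> s < \<theta> k cannot jump over the arc, and at most 1 /
  \<theta> s of them, rounded up, lead around the circle.\<close>

lemma arc_return_bounded:
  assumes "0 < \<theta> k"
  obtains r where "0 < r" "\<And>n. \<exists>j\<in>{1..r}. n + j \<in> A k"
proof -
  obtain s where s: "0 < \<theta> s" "\<theta> s < \<theta> k" using \<theta>_small[OF assms] by blast
  define R where "R = \<lceil>1 / \<theta> s\<rceil>"
  have R: "0 < R" "1 / \<theta> s \<le> of_int R" using s by (auto simp: R_def)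
  have visit: "\<exists>i. 0 \<le> i \<and> i \<le> R \<and> n + i * s \<in> A k" for n
  proof -
    define i where "i = \<lceil>(1 - \<theta> n) / \<theta> s\<rceil>"
    have "(1 - \<theta> n) / \<theta> s \<le> 1 / \<theta> s" using \<theta>_ge_0[of n] s by (intro divide_right_mono) auto
    then have "i \<le> R" unfolding i_def R_def by (rule ceiling_mono)
    have "0 < (1 - \<theta> n) / \<theta> s" using \<theta>_less_1[of n] s by simp
    then have "0 \<le> i" unfolding i_def by simp
    have "(1 - \<theta> n) / \<theta> s \<le> of_int i" "of_int i < (1 - \<theta> n) / \<theta> s + 1"
      unfolding i_def by linarith+
    then have b: "1 \<le> \<theta> n + of_int i * \<theta> s" "\<theta> n + of_int i * \<theta> s < 1 + \<theta> s"
      using s by (simp_all add: field_simps)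
    have "\<theta> (n + i * s) = \<theta> n + of_int i * \<theta> s - 1"
    proof (rule \<theta>_eqI)
      show "of_int (n + i * s) * \<alpha> = \<theta> n + of_int i * \<theta> s - 1 + of_int (turns n + i * turns s + 1)"
        using turns_decomp[of n] arg_cong[OF turns_decomp[of s], of "\<lambda>x. of_int i * x"] by (simp add: algebra_simps)
    qed (use b s \<theta>_less_1[of s] in auto)
    then show ?thesis using b s \<open>0 \<le> i\<close> \<open>i \<le> R\<close> by (intro exI[of _ i]) (auto simp: mem_A)
  qed
  show thesis
  \<comment> \<open>The integer \<open>s\<close> may be negative, so the search starts at n + R |s|
    + 1; up to R steps of size |s| in either direction then stay between n + 1 and n + 2 R |s| +
    1.\<close>
  proof (rule that[of "2 * R * \<bar>s\<bar> + 1"])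
    show "0 < 2 * R * \<bar>s\<bar> + 1" using R by (simp add: add_nonneg_pos)
    show "\<exists>j\<in>{1..2 * R * \<bar>s\<bar> + 1}. n + j \<in> A k" for n
    proof -
      obtain i where i: "0 \<le> i" "i \<le> R" "n + (R * \<bar>s\<bar> + 1) + i * s \<in> A k" using visit by blast
      have "\<bar>i * s\<bar> \<le> R * \<bar>s\<bar>" using i by (simp add: abs_mult mult_right_mono)
      then show ?thesis using i by (intro bexI[of _ "R * \<bar>s\<bar> + 1 + i * s"]) (auto simp: algebra_simps abs_le_iff)
    qed
  qed
qed

end

section \<open>Flux through the cut at 0 and its correction\<close>

definition flux :: "(int \<Rightarrow> int) \<Rightarrow> int" where
  "flux h = int (card {m. m < 0 \<and> h m \<ge> 0}) - int (card {m. m \<ge> 0 \<and> h m < 0})"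

lemma finite_crossings:
  assumes "\<And>n. \<bar>h n - n\<bar> \<le> B"
  shows "finite {m. m < (0::int) \<and> h m \<ge> (0::int)}" "finite {m. m \<ge> (0::int) \<and> h m < (0::int)}"
proof -
  have "m \<in> {-B..B}" if "m < 0 \<and> h m \<ge> 0 \<or> m \<ge> 0 \<and> h m < 0" for m
    using assms[of m] that by auto
  then show "finite {m. m < (0::int) \<and> h m \<ge> (0::int)}" "finite {m. m \<ge> (0::int) \<and> h m < (0::int)}"
    by (auto intro: finite_subset[of _ "{-B..B}"])
qed

text \<open>Only the value -1 is carried over the cut, so only its preimage p changes status: it
  joins the upward crossings if p < 0 and leaves the downward ones otherwise. Bounded displacement
  keeps both crossing sets finite, without which \<open>card\<close> would be 0 by
  convention.\<close>

lemma flux_translation_1: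
  assumes "bij h" and B: "\<And>n. \<bar>h n - n\<bar> \<le> B"
  shows "flux (translation 1 \<circ> h) = flux h + 1"
proof -
  obtain p where p: "h p = -1" using \<open>bij h\<close> by (metis bij_pointE)
  have p': "h m = -1 \<longleftrightarrow> m = p" for m using p \<open>bij h\<close> by (metis bij_pointE)
  have up: "(translation 1 \<circ> h) m \<ge> 0 \<longleftrightarrow> h m \<ge> 0 \<or> m = p" for m using p'[of m] by auto
  have down: "(translation 1 \<circ> h) m < 0 \<longleftrightarrow> h m < 0 \<and> m \<noteq> p" for m using p'[of m] by auto
  note fin = finite_crossings[of h, OF B]
  show ?thesis
  proof (cases "p < 0")
    case True
    have "{m. m < 0 \<and> (translation 1 \<circ> h) m \<ge> 0} = insert p {m. m < 0 \<and> h m \<ge> 0}"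
      unfolding up down using True by auto
    moreover have "{m. m \<ge> 0 \<and> (translation 1 \<circ> h) m < 0} = {m. m \<ge> 0 \<and> h m < 0}"
      unfolding up down using True by auto
    moreover have "p \<notin> {m. m < 0 \<and> h m \<ge> 0}" using p by simp
    ultimately show ?thesis unfolding flux_def using fin(1) by simp
  next
    case False
    have "{m. m < 0 \<and> (translation 1 \<circ> h) m \<ge> 0} = {m. m < 0 \<and> h m \<ge> 0}"
      unfolding up down using False by auto
    moreover have ins: "{m. m \<ge> 0 \<and> h m < 0} = insert p {m. m \<ge> 0 \<and> (translation 1 \<circ> h) m < 0}"
      unfolding up down using False p by auto
    moreover have "p \<notin> {m. m \<ge> 0 \<and> (translation 1 \<circ> h) m < 0}" using p by simp
    moreover have "finite {m. m \<ge> 0 \<and> (translation 1 \<circ> h) m < 0}"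
      using fin(2) unfolding ins by simp
    ultimately show ?thesis unfolding flux_def by (simp only: card_insert_disjoint) simp
  qed
qed

lemma flux_translation:
  assumes "bij h" and B: "\<And>n. \<bar>h n - n\<bar> \<le> B"
  shows "flux (translation k \<circ> h) = flux h + k"
proof -
  have bt: "bij (translation i \<circ> h)" for i using assms(1) by (auto intro: bij_comp)
  have Bt: "\<bar>(translation i \<circ> h) n - n\<bar> \<le> B + \<bar>i\<bar>" for i n using B[of n] by simp
  have step: "flux (translation (i + 1) \<circ> h) = flux (translation i \<circ> h) + 1" for i
  proof -
    have "translation (i + 1) \<circ> h = translation 1 \<circ> (translation i \<circ> h)"
      by (simp only: comp_assoc[symmetric] translation_comp add.commute)
    then show ?thesis using flux_translation_1[OF bt Bt] by (simp only:)
  qed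
  show ?thesis
  proof (induction k rule: int_induct[of _ 0])
    case base
    show ?case unfolding translation_0 id_comp by simp
  next
    case (step1 i)
    show ?case unfolding step step1(2) by simp
  next
    case (step2 i)
    then show ?case using step[of "i - 1"] by (simp only: diff_add_cancel)
  qed
qed

lemma exists_swapping_permutation:
  assumes W: "finite W" "P \<subseteq> W" "Q \<subseteq> W" and "P \<inter> Q = {}" "card P = card Q"
  obtains \<pi> where "\<pi> permutes W" "\<And>x. x \<in> P \<Longrightarrow> \<pi> x \<in> Q" "\<And>x. x \<in> Q \<Longrightarrow> \<pi> x \<in> P"
    "\<And>x. x \<notin> P \<Longrightarrow> x \<notin> Q \<Longrightarrow> \<pi> x = x"
proof -
  have fin: "finite P" "finite Q" using W finite_subset by blast+
  then obtain b where b: "bij_betw b P Q" using assms(5) finite_same_card_bij by blast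
  define c where "c = inv_into P b"
  have c: "bij_betw c Q P" unfolding c_def by (rule bij_betw_inv_into[OF b])
  have cb: "c (b x) = x" if "x \<in> P" for x using that b unfolding c_def by (simp add: bij_betw_inv_into_left)
  have bc: "b (c x) = x" if "x \<in> Q" for x using that b unfolding c_def by (simp add: bij_betw_inv_into_right)
  define \<pi> where "\<pi> x = (if x \<in> P then b x else if x \<in> Q then c x else x)" for x
  have PQ: "\<pi> x \<in> Q" if "x \<in> P" for x using that b by (auto simp: \<pi>_def bij_betw_def)
  have QP: "\<pi> x \<in> P" if "x \<in> Q" for x
    using that c \<open>P \<inter> Q = {}\<close> by (auto simp: \<pi>_def bij_betw_def)
  have inv: "\<pi> (\<pi> x) = x" for x
  proof -
    consider "x \<in> P" | "x \<in> Q" | "x \<notin> P" "x \<notin> Q" by blast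
    then show ?thesis
    proof cases
      case 1
      then show ?thesis using PQ[OF 1] \<open>P \<inter> Q = {}\<close> cb by (auto simp: \<pi>_def)
    next
      case 2
      then show ?thesis using QP[OF 2] \<open>P \<inter> Q = {}\<close> bc by (auto simp: \<pi>_def)
    qed (simp add: \<pi>_def)
  qed
  have "\<pi> permutes W"
    unfolding permutes_def
  proof (intro conjI allI impI)
    show "\<exists>!x. \<pi> x = y" for y using inv by metis
    show "\<pi> x = x" if "x \<notin> W" for x using that W by (auto simp: \<pi>_def)
  qed
  then show thesis using that[of \<pi>] PQ QP by (simp add: \<pi>_def)
qed

context irrational_rotation
begin

definition preserves_cuts :: "int set \<Rightarrow> (int \<Rightarrow> int) \<Rightarrow> bool" where
  "preserves_cuts J g \<longleftrightarrow> (\<forall>n\<in>J. \<forall>m. m < n \<longleftrightarrow> g m < n)"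

text \<open>Near every visit n to a short enough arc, \<open>h\<close> acts as it does near 0, up to
  translation by n. One finite permutation chosen at 0 therefore repairs all cuts: zero flux says
  that as many points cross 0 upwards as downwards, and \<pi> interchanges the two sets of image
  points.\<close>

lemma exists_preserving_cuts:
  assumes "h \<in> FZ" "flux h = 0"
  obtains k \<psi> where "0 < \<theta> k" "\<psi> \<in> MZ" "preserves_cuts (A k) (\<psi> \<circ> h)"
proof -
  obtain N where N: "N \<ge> 0" "\<And>n n'. agree N n n' \<Longrightarrow> h n - n = h n' - n'"
    using assms unfolding FZ_def by blast
  obtain B where B: "B \<ge> 0" "\<And>n. \<bar>h n - n\<bar> \<le> B" using FZ_bounded[OF assms(1)] by blast
  have "bij h" using assms by (simp add: FZ_def)
  then have inj: "h x = h y \<Longrightarrow> x = y" for x y by (auto dest: bij_is_inj injD)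
  \<comment> \<open>Room for windows of radius N at distance up to B from a visit, for disjoint
    floors with indices from -B to B, and for visits so far apart that their corrections do not
    interfere.\<close>
  obtain k where k: "tiny (N + 2 * B + 2) k" "0 < \<theta> k" using tiny_exists by blast
  have far: "\<bar>n - n'\<bar> > 2 * B + 2" if "n \<in> A k" "n' \<in> A k" "n \<noteq> n'" for n n'
  proof (rule ccontr)
    assume "\<not> ?thesis"
    then have "disjoint_shifts (A k) 0 (n' - n)"
      using that N by (intro disjoint_tiny[OF k(1)]) auto
    then show False using disjoint_shiftsD[of "A k" 0 "n' - n" n'] that by simp
  qed
  have disj: "disjoint_shifts (A k) i j" if "i \<in> {-B..B}" "j \<in> {-B..B}" "i \<noteq> j" for i j
    using that N by (intro disjoint_tiny[OF k(1)]) auto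
  have hn: "h (n + i) = n + h i" if "n \<in> A k" "\<bar>i\<bar> \<le> B" for n i
  proof -
    have "agree (N + B) n 0"
    proof (rule agree_arc)
      show "c = 0" if "c \<in> {- (N + B)..N + B + 1}" "c - 0 \<in> A k" for c
      proof (rule ccontr)
        assume "c \<noteq> 0"
        then have "\<theta> k < \<theta> c" using k(1) that B N unfolding tiny_def by auto
        then show False using that by (simp add: mem_A)
      qed
    qed (use that in simp)
    then have "agree N (n + i) (0 + i)" by (rule agree_shift) (use that in auto)
    from N(2)[OF this] show ?thesis by simp
  qed
  define P where "P = h ` {m. m < 0 \<and> h m \<ge> 0}"
  define Q where "Q = h ` {m. m \<ge> 0 \<and> h m < 0}"
  have "card P = card {m. m < 0 \<and> h m \<ge> 0}" "card Q = card {m. m \<ge> 0 \<and> h m < 0}"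
    unfolding P_def Q_def using inj by (auto intro!: card_image inj_onI)
  then have "card P = card Q" using assms(2) by (simp add: flux_def)
  have Pb: "0 \<le> x \<and> x < B" if "x \<in> P" for x
    using that B(2) unfolding P_def by (auto, smt (verit))
  have Qb: "- B \<le> x \<and> x < 0" if "x \<in> Q" for x
    using that B(2) unfolding Q_def by (auto, smt (verit))
  obtain \<pi> where \<pi>: "\<pi> permutes {-B..B}" "\<And>x. x \<in> P \<Longrightarrow> \<pi> x \<in> Q" "\<And>x. x \<in> Q \<Longrightarrow> \<pi> x \<in> P"
    "\<And>x. x \<notin> P \<Longrightarrow> x \<notin> Q \<Longrightarrow> \<pi> x = x"
  proof (rule exists_swapping_permutation[of "{-B..B}" P Q])
    show "P \<subseteq> {-B..B}" "Q \<subseteq> {-B..B}" "P \<inter> Q = {}" using Pb Qb B(1) by fastforce+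
  qed (use \<open>card P = card Q\<close> in auto)
  define \<psi> where "\<psi> = tower_perm (A k) {-B..B} \<pi>"
  have in_tower: "\<psi> v = v - i + \<pi> i" if "i \<in> {-B..B}" "v - i \<in> A k" for v i
    unfolding \<psi>_def by (rule tower_perm_in[OF disj that])
  have crossP: "v - n \<in> P \<longleftrightarrow> m < n \<and> n \<le> v" if "n \<in> A k" "v = h m" for n m v
  proof
    assume "v - n \<in> P"
    then obtain m' where m': "m' < 0" "h m' \<ge> 0" "v - n = h m'" by (auto simp: P_def)
    then have "\<bar>m'\<bar> \<le> B" using B(2)[of m'] by auto
    then have "h (n + m') = v" using hn[OF that(1)] m' by simp
    then have "m = n + m'" using inj that by simp
    then show "m < n \<and> n \<le> v" using m' by simp
  next
    assume *: "m < n \<and> n \<le> v"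
    then have "\<bar>m - n\<bar> \<le> B" using B(2)[of m] that by auto
    then have "h (m - n) = v - n" using hn[OF that(1), of "m - n"] that by simp
    then show "v - n \<in> P" unfolding P_def using * by (intro image_eqI[of _ _ "m - n"]) auto
  qed
  have crossQ: "v - n \<in> Q \<longleftrightarrow> v < n \<and> n \<le> m" if "n \<in> A k" "v = h m" for n m v
  proof
    assume "v - n \<in> Q"
    then obtain m' where m': "m' \<ge> 0" "h m' < 0" "v - n = h m'" by (auto simp: Q_def)
    then have "\<bar>m'\<bar> \<le> B" using B(2)[of m'] by auto
    then have "h (n + m') = v" using hn[OF that(1)] m' by simp
    then have "m = n + m'" using inj that by simp
    then show "v < n \<and> n \<le> m" using m' by simp
  next
    assume *: "v < n \<and> n \<le> m"
    then have "\<bar>m - n\<bar> \<le> B" using B(2)[of m] that by auto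
    then have "h (m - n) = v - n" using hn[OF that(1), of "m - n"] that by simp
    then show "v - n \<in> Q" unfolding Q_def using * by (intro image_eqI[of _ _ "m - n"]) auto
  qed
  have "m < n \<longleftrightarrow> \<psi> (h m) < n" if n: "n \<in> A k" for n m
  proof -
    define v where "v = h m"
    show ?thesis
    proof (cases "\<exists>n1\<in>A k. m < n1 \<and> n1 \<le> v \<or> v < n1 \<and> n1 \<le> m")
      case True
      then obtain n1 where n1: "n1 \<in> A k" "m < n1 \<and> n1 \<le> v \<or> v < n1 \<and> n1 \<le> m" by blast
      have mv: "\<bar>v - m\<bar> \<le> B" using B(2)[of m] by (simp add: v_def)
      then have "v - n1 \<in> {-B..B}" using n1 by auto
      then have \<psi>v: "\<psi> v = n1 + \<pi> (v - n1)" using in_tower[of "v - n1" v] n1 by simp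
      \<comment> \<open>After the correction, m and its image are on the same side of
        \<open>n1\<close> and within B of it. Every other visit is farther away and cannot separate
        them.\<close>
      from n1(2) have "m < n1 \<and> \<psi> v < n1 \<and> n1 - B \<le> m \<and> n1 - B \<le> \<psi> v
        \<or> n1 \<le> m \<and> n1 \<le> \<psi> v \<and> m \<le> n1 + B \<and> \<psi> v \<le> n1 + B"
      proof
        assume *: "m < n1 \<and> n1 \<le> v"
        then have "\<pi> (v - n1) \<in> Q" using crossP[OF n1(1) v_def] \<pi>(2) by blast
        from Qb[OF this] show ?thesis using * mv \<psi>v by auto
      next
        assume *: "v < n1 \<and> n1 \<le> m"
        then have "\<pi> (v - n1) \<in> P" using crossQ[OF n1(1) v_def] \<pi>(3) by blast
        from Pb[OF this] show ?thesis using * mv \<psi>v by auto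
      qed
      moreover have "n = n1 \<or> \<bar>n - n1\<bar> > 2 * B + 2" using far[OF n n1(1)] by blast
      ultimately show ?thesis unfolding v_def[symmetric] using B(1) by auto
    next
      case False
      have "\<psi> v = v"
      proof (cases "\<exists>i\<in>{-B..B}. v - i \<in> A k")
        case True
        then obtain i where i: "i \<in> {-B..B}" "v - i \<in> A k" by blast
        have "\<pi> i = i" using \<pi>(4)[of i] crossP[OF i(2) v_def] crossQ[OF i(2) v_def] False i(2) by auto
        then show ?thesis using in_tower[OF i] by simp
      next
        case False
        then show ?thesis unfolding \<psi>_def by (intro tower_perm_out) auto
      qed
      then show ?thesis using False n unfolding v_def[symmetric] by auto
    qed
  qed
  then have "preserves_cuts (A k) (\<psi> \<circ> h)" unfolding preserves_cuts_def comp_apply by blast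
  moreover have "\<psi> \<in> MZ" unfolding MZ_def \<psi>_def
    by (rule tower_perm_mem_compositions[OF _ disj \<pi>(1)]) (auto simp: arc_exchanges_def)
  ultimately show thesis using that k(2) by blast
qed

section \<open>Elements preserving the blocks between visits\<close>

definition last_visit :: "int \<Rightarrow> int \<Rightarrow> int" where
  "last_visit k m = m - int (LEAST i. m - int i \<in> A k)"

lemma last_visit:
  assumes "0 < \<theta> k"
  shows "last_visit k m \<in> A k" "last_visit k m \<le> m"
    "\<And>n. last_visit k m < n \<Longrightarrow> n \<le> m \<Longrightarrow> n \<notin> A k"
proof -
  obtain r where r: "\<And>n. \<exists>j\<in>{1..r}. n + j \<in> A k" using arc_return_bounded[OF assms] by blast
  obtain j where "j \<in> {1..r}" "m - r - 1 + j \<in> A k" using r by blast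
  then have "m - int (nat (r + 1 - j)) \<in> A k" by (simp add: algebra_simps)
  then have L: "m - int (LEAST i. m - int i \<in> A k) \<in> A k" by (rule LeastI)
  then show "last_visit k m \<in> A k" "last_visit k m \<le> m" by (simp_all add: last_visit_def)
  fix n assume n: "last_visit k m < n" "n \<le> m"
  then have "nat (m - n) < (LEAST i. m - int i \<in> A k)" by (auto simp: last_visit_def)
  from not_less_Least[OF this] show "n \<notin> A k" using n by simp
qed

lemma last_visit_eqI:
  assumes "0 < \<theta> k" "b \<in> A k" "b \<le> m" "\<And>n. b < n \<Longrightarrow> n \<le> m \<Longrightarrow> n \<notin> A k"
  shows "last_visit k m = b"
proof (cases "last_visit k m" b rule: linorder_cases)
  case less
  then show ?thesis using last_visit(3)[OF assms(1) less assms(3)] assms(2) by blast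
next
  case greater
  then show ?thesis using assms(4)[OF greater last_visit(2)[OF assms(1)]] last_visit(1)[OF assms(1)] by blast
qed

lemma last_visit_preserved:
  assumes "0 < \<theta> k" "preserves_cuts (A k) g"
  shows "last_visit k (g m) = last_visit k m"
proof (rule last_visit_eqI[OF assms(1)])
  have pc: "m < n \<longleftrightarrow> g m < n" if "n \<in> A k" for n
    using assms(2) that unfolding preserves_cuts_def by blast
  show "last_visit k m \<in> A k" by (rule last_visit[OF assms(1)])
  then show "last_visit k m \<le> g m" using pc last_visit(2)[OF assms(1), of m] by (meson not_less)
  show "n \<notin> A k" if "last_visit k m < n" "n \<le> g m" for n
  proof
    assume n: "n \<in> A k"
    then have "n \<le> m" using pc that(2) by (meson not_less)
    then show False using last_visit(3)[OF assms(1) that(1)] n by blast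
  qed
qed

text \<open>The arc is cut until the window of radius M is constant on each piece. Blocks that begin
  in one piece then have the same length and are permuted by \<open>g\<close> in the same way, so
  \<open>g\<close> acts on them as a permutation of the floors of a tower. Multiplying over the
  pieces recovers \<open>g\<close>.\<close>

lemma preserves_cuts_MZ:
  assumes g: "g \<in> FZ" and k: "0 < \<theta> k" and pc: "preserves_cuts (A k) g"
  shows "g \<in> MZ"
proof -
  note lv = last_visit[OF k] and lvI = last_visit_eqI[OF k] and lvg = last_visit_preserved[OF k pc]
  obtain N where N: "N \<ge> 0" "\<And>n n'. agree N n n' \<Longrightarrow> g n - n = g n' - n'"
    using g unfolding FZ_def by blast
  have "bij g" using g by (simp add: FZ_def)
  then have inj: "g x = g y \<Longrightarrow> x = y" for x y by (auto dest: bij_is_inj injD)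
  obtain r where r: "0 < r" "\<And>n. \<exists>j\<in>{1..r}. n + j \<in> A k" using arc_return_bounded[OF k] by blast
  obtain K where K: "K \<ge> 0" "\<And>n n'. agree K n n' \<Longrightarrow> n \<in> A k \<longleftrightarrow> n' \<in> A k"
    using window_set_A[of k] unfolding window_set_def by blast
  \<comment> \<open>A block is at most r long; at each of its points the N-window determines the
    displacement of \<open>g\<close> and the K-window decides whether the point is a visit.\<close>
  define M where "M = N + K + r"
  \<comment> \<open>The restriction of \<open>g\<close> to the blocks beginning in V. Since
    \<open>g\<close> keeps the starting point of each block, restrictions to disjoint sets compose
    to the restriction to their union.\<close>
  define gr where "gr V m = (if last_visit k m \<in> V then g m else m)" for V m
  have gr_Un: "gr (V1 \<union> V2) = gr V1 \<circ> gr V2" if "V1 \<inter> V2 = {}" for V1 V2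
    using that by (auto simp: gr_def fun_eq_iff lvg)
  define P where "P l d \<longleftrightarrow> (shift_set (A l) d \<subseteq> A k \<longrightarrow> gr (shift_set (A l) d) \<in> MZ)" for l d
  have "P k 0"
  proof (rule arc_cut_induct[of "{-M..M + 1}"])
    fix l d assume clean: "\<And>c. c \<in> {-M..M + 1} \<Longrightarrow> c - d \<in> A l \<Longrightarrow> c = d"
    define V where "V = shift_set (A l) d"
    show "P l d"
      unfolding P_def V_def[symmetric]
    proof
      assume V: "V \<subseteq> A k"
      show "gr V \<in> MZ"
      proof (cases "l = 0")
        case True
        then have "V = {}" using leD[OF \<theta>_ge_0] by (auto simp: V_def mem_A)
        then have "gr V = id" by (auto simp: gr_def)
        then show ?thesis using compositions.id unfolding MZ_def by (simp only:)
      next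
        case False
        have dV: "d \<in> V" using False by (simp add: V_def mem_A \<theta>_pos)
        have agr: "agree M n d" if "n \<in> V" for n
          by (rule agree_arc[OF clean]) (use that in \<open>auto simp: V_def\<close>)
        have visit: "n + j \<in> A k \<longleftrightarrow> d + j \<in> A k" if "n \<in> V" "0 \<le> j" "j \<le> r" for n j
          by (rule K(2), rule agree_shift[OF agr[OF that(1)]]) (use that N in \<open>auto simp: M_def\<close>)
        have disp: "g (n + j) - n = g (d + j) - d" if "n \<in> V" "0 \<le> j" "j \<le> r" for n j
        proof -
          have "agree N (n + j) (d + j)"
            by (rule agree_shift[OF agr[OF that(1)]]) (use that K in \<open>auto simp: M_def\<close>)
          from N(2)[OF this] show ?thesis by simp
        qed
        \<comment> \<open>The return time from \<open>d\<close>, common to all starting points in V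
          because their windows reach beyond the next visit.\<close>
        define \<rho> where "\<rho> = int (LEAST j. 0 < j \<and> d + int j \<in> A k)"
        obtain j0 where "j0 \<in> {1..r}" "d + j0 \<in> A k" using r by blast
        then have "0 < nat j0 \<and> d + int (nat j0) \<in> A k" by auto
        then have \<rho>: "0 < \<rho>" "d + \<rho> \<in> A k" "\<rho> \<le> r" and \<rho>_min: "\<And>j. 0 < j \<Longrightarrow> j < \<rho> \<Longrightarrow> d + j \<notin> A k"
        proof -
          assume *: "0 < nat j0 \<and> d + int (nat j0) \<in> A k"
          show "0 < \<rho>" "d + \<rho> \<in> A k"
            using LeastI[of "\<lambda>j. 0 < j \<and> d + int j \<in> A k", OF *] by (auto simp: \<rho>_def)
          show "\<rho> \<le> r"
            using Least_le[of "\<lambda>j. 0 < j \<and> d + int j \<in> A k", OF *] \<open>j0 \<in> {1..r}\<close> by (auto simp: \<rho>_def)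
          show "d + j \<notin> A k" if "0 < j" "j < \<rho>" for j
            using not_less_Least[of "nat j" "\<lambda>j. 0 < j \<and> d + int j \<in> A k"] that by (auto simp: \<rho>_def)
        qed
        have block: "last_visit k m = n \<longleftrightarrow> m - n \<in> {0..<\<rho>}" if n: "n \<in> V" for n m
        proof
          assume "last_visit k m = n"
          have "\<not> \<rho> \<le> m - n"
          proof
            assume "\<rho> \<le> m - n"
            moreover have "n + \<rho> \<in> A k" using visit[OF n, of \<rho>] \<rho> by simp
            ultimately show False using lv(3)[of m "n + \<rho>"] \<rho>(1) \<open>last_visit k m = n\<close> by auto
          qed
          moreover have "n \<le> m" using lv(2)[of m] \<open>last_visit k m = n\<close> by simp
          ultimately show "m - n \<in> {0..<\<rho>}" by auto
        next
          assume m: "m - n \<in> {0..<\<rho>}"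
          show "last_visit k m = n"
          proof (rule lvI)
            show "n \<in> A k" using n V by blast
            show "n \<le> m" using m by simp
            show "n' \<notin> A k" if "n < n'" "n' \<le> m" for n'
              using \<rho>_min[of "n' - n"] visit[OF n, of "n' - n"] that m \<rho>(3) by auto
          qed
        qed
        define \<pi> where "\<pi> i = (if i \<in> {0..<\<rho>} then g (d + i) - d else i)" for i
        have \<pi>_mem: "\<pi> i \<in> {0..<\<rho>}" if "i \<in> {0..<\<rho>}" for i
        proof -
          have "last_visit k (d + i) = d" using block[OF dV, of "d + i"] that by simp
          then have "last_visit k (g (d + i)) = d" by (simp add: lvg)
          then show ?thesis using block[OF dV, of "g (d + i)"] that by (simp add: \<pi>_def)
        qed
        have "\<pi> permutes {0..<\<rho>}"
        proof (rule bij_imp_permutes)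
          have "inj_on \<pi> {0..<\<rho>}"
          proof (rule inj_onI)
            fix x y assume "x \<in> {0..<\<rho>}" "y \<in> {0..<\<rho>}" "\<pi> x = \<pi> y"
            then have "g (d + x) = g (d + y)" by (simp add: \<pi>_def)
            then have "d + x = d + y" by (rule inj)
            then show "x = y" by simp
          qed
          moreover have "\<pi> ` {0..<\<rho>} \<subseteq> {0..<\<rho>}" using \<pi>_mem by blast
          ultimately show "bij_betw \<pi> {0..<\<rho>} {0..<\<rho>}"
            unfolding bij_betw_def by (intro conjI endo_inj_surj) auto
        qed (auto simp: \<pi>_def)
        have disj: "disjoint_shifts V i j" if "i \<in> {0..<\<rho>}" "j \<in> {0..<\<rho>}" "i \<noteq> j" for i j
          unfolding disjoint_shifts_def
        proof (intro allI impI notI)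
          fix n assume "n - i \<in> V" "n - j \<in> V"
          then have "last_visit k n = n - i" "last_visit k n = n - j" using block[of _ n] that by simp_all
          then show False using that by simp
        qed
        have "gr V = tower_perm V {0..<\<rho>} \<pi>"
        proof
          fix m
          show "gr V m = tower_perm V {0..<\<rho>} \<pi> m"
          proof (cases "last_visit k m \<in> V")
            case True
            define n where "n = last_visit k m"
            have n: "n \<in> V" "m - n \<in> {0..<\<rho>}" using True block[of n m] by (auto simp: n_def)
            have "tower_perm V {0..<\<rho>} \<pi> m = m - (m - n) + \<pi> (m - n)"
              by (rule tower_perm_in[OF disj n(2)]) (use n in auto)
            also have "\<dots> = g m" using disp[OF n(1), of "m - n"] n(2) \<rho>(3) by (simp add: \<pi>_def)
            finally show ?thesis using True by (simp add: gr_def)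
          next
            case False
            have "m - i \<notin> V" if "i \<in> {0..<\<rho>}" for i
              using block[of "m - i" m] that False by auto
            then have "tower_perm V {0..<\<rho>} \<pi> m = m" by (rule tower_perm_out)
            then show ?thesis using False by (simp add: gr_def)
          qed
        qed
        moreover have "tower_perm V {0..<\<rho>} \<pi> \<in> MZ"
          unfolding MZ_def
        proof (rule tower_perm_mem_compositions[OF _ disj \<open>\<pi> permutes {0..<\<rho>}\<close>])
          fix i j assume "disjoint_shifts V i j"
          then have dd: "disjoint_shifts (A l) (i + d) (j + d)"
            unfolding V_def disjoint_shifts_shift_set by (auto intro: disjoint_shifts_diff)
          show "exch V i j \<in> {translation 1, translation (- 1)} \<union> arc_exchanges"
            unfolding V_def exch_shift_set arc_exchanges_def using dd by blast
        qed simp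
        ultimately show ?thesis by (simp only:)
      qed
    qed
  next
    fix l d c assume c: "c - d \<in> A l" and IH: "P (c - d) d" "P (l - (c - d)) c"
    have le: "\<theta> (c - d) \<le> \<theta> l" using c by (simp add: mem_A)
    have 1: "shift_set (A l) d = shift_set (A (c - d)) d \<union> shift_set (A (l - (c - d))) c"
    proof -
      have "n - d \<in> A l \<longleftrightarrow> n - d \<in> A (c - d) \<or> n - c \<in> A (l - (c - d))" for n
        using A_split(1)[OF le] by simp
      then show ?thesis by auto
    qed
    have 2: "shift_set (A (c - d)) d \<inter> shift_set (A (l - (c - d))) c = {}"
    proof -
      have "\<not> (n - d \<in> A (c - d) \<and> n - d - (c - d) \<in> A (l - (c - d)))" for n
        using A_split(2)[OF le] by auto
      then show ?thesis by auto
    qed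
    show "P l d"
      unfolding P_def
    proof
      assume "shift_set (A l) d \<subseteq> A k"
      then have "gr (shift_set (A (c - d)) d) \<in> MZ" "gr (shift_set (A (l - (c - d))) c) \<in> MZ"
        using IH 1 unfolding P_def by blast+
      then show "gr (shift_set (A l) d) \<in> MZ" unfolding 1 gr_Un[OF 2] by (rule MZ_comp)
    qed
  qed simp
  moreover have "shift_set (A k) 0 = A k" by auto
  ultimately have "gr (A k) \<in> MZ" by (simp add: P_def)
  moreover have "gr (A k) = g" using lv(1) by (auto simp: gr_def)
  ultimately show ?thesis by simp
qed

theorem FZ_MZ:
  assumes "g \<in> FZ"
  shows "g \<in> MZ"
proof -
  obtain B where B: "\<And>n. \<bar>g n - n\<bar> \<le> B" using FZ_bounded[OF assms] by blast
  define h where "h = translation (- flux g) \<circ> g"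
  have h: "h \<in> FZ" unfolding h_def by (rule FZ_comp[OF translation_FZ assms])
  have "flux h = 0"
    unfolding h_def using assms B by (subst flux_translation) (auto simp: FZ_def)
  then obtain k \<psi> where k: "0 < \<theta> k" "\<psi> \<in> MZ" "preserves_cuts (A k) (\<psi> \<circ> h)"
    using exists_preserving_cuts[OF h] by blast
  have "\<psi> \<circ> h \<in> MZ" by (rule preserves_cuts_MZ[OF FZ_comp[OF MZ_FZ[OF k(2)] h] k(1,3)])
  then have "inv_into UNIV \<psi> \<circ> (\<psi> \<circ> h) \<in> MZ" by (rule MZ_comp[OF inv_MZ[OF k(2)]])
  moreover have "inv_into UNIV \<psi> \<circ> (\<psi> \<circ> h) = h"
    using bij_MZ[OF k(2)] by (simp add: o_assoc bij_is_inj)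
  ultimately have "translation (flux g) \<circ> h \<in> MZ" using MZ_comp[OF translation_MZ] by simp
  moreover have "translation (flux g) \<circ> h = g"
    unfolding h_def o_assoc translation_comp by (simp add: translation_0)
  ultimately show ?thesis by (simp only:)
qed

end

section \<open>Parity along periodic approximations\<close>

definition commutes_shift :: "int \<Rightarrow> (int \<Rightarrow> int) \<Rightarrow> bool" where
  "commutes_shift q f \<longleftrightarrow> bij f \<and> (\<forall>n. f (n + q) = f n + q)"

lemma commutes_shift_mult:
  assumes "commutes_shift q f"
  shows "f (n + k * q) = f n + k * q"
proof (induction k rule: int_induct[of _ 0])
  case (step1 i)
  have "f (n + (i + 1) * q) = f ((n + i * q) + q)" by (simp add: algebra_simps)
  also have "\<dots> = f (n + i * q) + q" using assms by (simp add: commutes_shift_def)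
  finally show ?case using step1 by (simp add: algebra_simps)
next
  case (step2 i)
  have "f (n + i * q) = f ((n + (i - 1) * q) + q)" by (simp add: algebra_simps)
  also have "\<dots> = f (n + (i - 1) * q) + q" using assms by (simp add: commutes_shift_def)
  finally show ?case using step2 by (simp add: algebra_simps)
qed simp

lemma commutes_shift_comp: "commutes_shift q f \<Longrightarrow> commutes_shift q g \<Longrightarrow> commutes_shift q (f \<circ> g)"
  by (auto simp: commutes_shift_def intro: bij_comp)

lemma commutes_shift_translation: "commutes_shift q (translation k)"
  by (simp add: commutes_shift_def)

text \<open>The permutation of Z/q that \<open>f\<close> lifts, on the representatives from 0 to q -
  1. Elsewhere it is the identity, as \<open>permutes\<close> demands.\<close>

definition cyclic_perm :: "int \<Rightarrow> (int \<Rightarrow> int) \<Rightarrow> int \<Rightarrow> int" where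
  "cyclic_perm q f i = (if i \<in> {0..<q} then f i mod q else i)"

lemma commutes_shift_mod:
  assumes "commutes_shift q f"
  shows "f (n mod q) mod q = f n mod q"
proof -
  have "f n = f (n mod q + (n div q) * q)" by simp
  also have "\<dots> = f (n mod q) + (n div q) * q" by (rule commutes_shift_mult[OF assms])
  finally show ?thesis by simp
qed

lemma cyclic_perm_permutes:
  assumes "0 < q" "commutes_shift q f"
  shows "cyclic_perm q f permutes {0..<q}"
proof (rule bij_imp_permutes)
  have inj: "inj f" using assms(2) by (simp add: commutes_shift_def bij_is_inj)
  have "inj_on (cyclic_perm q f) {0..<q}"
  proof (rule inj_onI)
    fix i j assume ij: "i \<in> {0..<q}" "j \<in> {0..<q}" "cyclic_perm q f i = cyclic_perm q f j"
    then have "f i mod q = f j mod q" by (simp add: cyclic_perm_def)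
    then have "q dvd f i - f j" by (simp add: mod_eq_dvd_iff)
    then obtain k where "f i = f j + k * q" by (metis dvd_def mult.commute diff_eq_eq add.commute)
    then have "f i = f (j + k * q)" using commutes_shift_mult[OF assms(2)] by simp
    then have "i = j + k * q" using inj by (simp add: inj_eq)
    then have "i mod q = j mod q" by simp
    then show "i = j" using ij by simp
  qed
  moreover have "cyclic_perm q f ` {0..<q} \<subseteq> {0..<q}" using assms(1) by (auto simp: cyclic_perm_def)
  ultimately show "bij_betw (cyclic_perm q f) {0..<q} {0..<q}"
    unfolding bij_betw_def by (intro conjI endo_inj_surj) auto
qed (auto simp: cyclic_perm_def)

lemma cyclic_perm_comp:
  assumes "0 < q" "commutes_shift q f"
  shows "cyclic_perm q (f \<circ> g) = cyclic_perm q f \<circ> cyclic_perm q g"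
proof
  fix i
  show "cyclic_perm q (f \<circ> g) i = (cyclic_perm q f \<circ> cyclic_perm q g) i"
    using assms(1) commutes_shift_mod[OF assms(2), of "g i"] by (auto simp: cyclic_perm_def)
qed

definition cyclic_sign :: "int \<Rightarrow> (int \<Rightarrow> int) \<Rightarrow> int" where
  "cyclic_sign q f = sign (cyclic_perm q f)"

lemma cyclic_sign_comp:
  assumes "0 < q" "commutes_shift q f" "commutes_shift q g"
  shows "cyclic_sign q (f \<circ> g) = cyclic_sign q f * cyclic_sign q g"
  unfolding cyclic_sign_def cyclic_perm_comp[OF assms(1,2)]
  by (rule sign_compose; rule permutes_imp_permutation[OF _ cyclic_perm_permutes[OF assms(1)]])
    (simp_all add: assms)

lemma cyclic_sign_id: "cyclic_sign q id = 1"
proof -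
  have "cyclic_perm q id = id" by (auto simp: cyclic_perm_def)
  then show ?thesis by (simp add: cyclic_sign_def)
qed

text \<open>A rotation of odd order \<open>q\<close> is even, because its \<open>q\<close>-th power is trivial.\<close>

lemma cyclic_sign_translation_1:
  assumes "0 < q" "odd q"
  shows "cyclic_sign q (translation 1) = 1"
proof -
  have pow: "cyclic_sign q (translation (int n)) = cyclic_sign q (translation 1) ^ n" for n
  proof (induction n)
    case 0
    show ?case unfolding of_nat_0 translation_0 cyclic_sign_id by simp
  next
    case (Suc n)
    have eq: "translation (int (Suc n)) = translation 1 \<circ> translation (int n)"
      by (simp add: translation_comp)
    show ?case
      unfolding eq cyclic_sign_comp[OF assms(1) commutes_shift_translation commutes_shift_translation]
        Suc.IH power_Suc ..
  qed
  have "cyclic_perm q (translation q) = id"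
    by (auto simp: cyclic_perm_def)
  then have "cyclic_sign q (translation q) = 1" by (simp add: cyclic_sign_def)
  then have "cyclic_sign q (translation 1) ^ nat q = 1" using pow[of "nat q"] assms(1) by simp
  moreover have "cyclic_sign q (translation 1) = 1 \<or> cyclic_sign q (translation 1) = -1"
    by (auto simp: cyclic_sign_def sign_def)
  moreover have "odd (nat q)" using assms by (simp add: even_nat_iff)
  ultimately show ?thesis by auto
qed

lemma cyclic_sign_translation_minus_1:
  assumes "0 < q" "odd q"
  shows "cyclic_sign q (translation (- 1)) = 1"
  using cyclic_sign_comp[OF assms(1) commutes_shift_translation commutes_shift_translation, of 1 "-1"]
    cyclic_sign_translation_1[OF assms]
  by (simp add: translation_comp translation_0 cyclic_sign_id)

lemma commutes_shift_exch:
  assumes "disjoint_shifts V i j" "\<And>n. n + q \<in> V \<longleftrightarrow> n \<in> V"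
  shows "commutes_shift q (exch V i j)"
proof -
  have "n + q - d \<in> V \<longleftrightarrow> n - d \<in> V" for n d using assms(2)[of "n - d"] by (simp add: algebra_simps)
  then show ?thesis using bij_exch[OF assms(1)] by (auto simp: commutes_shift_def exch_def)
qed

text \<open>Modulo q the exchange is a product of disjoint transpositions of s and s + 1, one for
  each residue s in \<open>S\<close>. The bound 2 \<le> q keeps s and s + 1 distinct as
  residues.\<close>

lemma cyclic_sign_exch:
  assumes "2 \<le> q" "finite S" "S \<subseteq> {0..<q}" "disjoint_shifts {n. n mod q \<in> S} 0 1"
  shows "cyclic_sign q (exch {n. n mod q \<in> S} 0 1) = (- 1) ^ card S"
  using assms(2-4)
proof (induction S rule: finite_induct)
  case empty
  have "exch {n. n mod q \<in> {}} 0 1 = id" by (auto simp: exch_def)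
  then show ?case by (simp only: cyclic_sign_id) simp
next
  case (insert s S)
  let ?V = "\<lambda>S. {n. n mod q \<in> S}"
  have d: "disjoint_shifts (?V {s}) 0 1" "disjoint_shifts (?V S) 0 1"
    using insert.prems(2) by (auto elim!: disjoint_shifts_mono)
  have c: "commutes_shift q (exch (?V T) 0 1)" if "disjoint_shifts (?V T) 0 1" for T
    by (rule commutes_shift_exch[OF that]) simp
  have "exch (?V (insert s S)) 0 1 = exch (?V {s}) 0 1 \<circ> exch (?V S) (0 + 0) (1 + 0)"
    by (rule exch_Un) (use insert in auto)
  then have "cyclic_sign q (exch (?V (insert s S)) 0 1)
      = cyclic_sign q (exch (?V {s}) 0 1) * cyclic_sign q (exch (?V S) 0 1)"
    using cyclic_sign_comp[of q, OF _ c[OF d(1)] c[OF d(2)]] assms(1) by simp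
  moreover have "cyclic_perm q (exch (?V {s}) 0 1) = Transposition.transpose s ((s + 1) mod q)"
  proof
    fix i
    have s: "0 \<le> s" "s < q" using insert by auto
    have iff: "(i - 1) mod q = s \<longleftrightarrow> i = (s + 1) mod q" if "i \<in> {0..<q}"
    proof
      assume *: "(i - 1) mod q = s"
      have "(s + 1) mod q = ((i - 1) + 1) mod q" unfolding *[symmetric] by (rule mod_add_left_eq)
      then show "i = (s + 1) mod q" using that by simp
    next
      assume *: "i = (s + 1) mod q"
      have "(i - 1) mod q = (s + 1 - 1) mod q" unfolding * by (rule mod_diff_left_eq)
      then show "(i - 1) mod q = s" using s by simp
    qed
    have "s \<noteq> (s + 1) mod q" using s assms(1) by (cases "s + 1 = q") auto
    then show "cyclic_perm q (exch (?V {s}) 0 1) i = Transposition.transpose s ((s + 1) mod q) i"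
      using iff s assms(1) by (auto simp: cyclic_perm_def exch_def Transposition.transpose_def)
  qed
  moreover have "s \<noteq> (s + 1) mod q"
    using insert assms(1) by (cases "s + 1 = q") auto
  ultimately show ?case using insert d by (simp add: cyclic_sign_def sign_swap_id)
qed

section \<open>Words in the generators and long gaps of a coding\<close>

fun eval_word :: "(int \<Rightarrow> bool) \<Rightarrow> int list \<Rightarrow> int \<Rightarrow> int" where
  "eval_word y [] = id"
| "eval_word y (a # l) = (if a = 0 then exch {n. y n} 0 1 else translation a) \<circ> eval_word y l"

text \<open>The coding is a parameter, so that one word can be evaluated on two codings. The letter
  0, the exchange, reads the coding at the current position and one step to the left, and every
  letter moves by at most 1; the window therefore grows by 1 per letter.\<close>

lemma eval_word_local:
  assumes "set l \<subseteq> {-1, 0, 1}" "\<And>j. \<bar>j\<bar> \<le> int (length l) \<Longrightarrow> y (n + j) = y' (n' + j)"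
  shows "eval_word y l n - n = eval_word y' l n' - n'" "\<bar>eval_word y l n - n\<bar> \<le> int (length l)"
proof -
  have "eval_word y l n - n = eval_word y' l n' - n' \<and> \<bar>eval_word y l n - n\<bar> \<le> int (length l)"
    using assms
  proof (induction l)
    case (Cons a l)
    define d where "d = eval_word y l n - n"
    have d: "eval_word y l n = n + d" "eval_word y' l n' = n' + d" "\<bar>d\<bar> \<le> int (length l)"
      using Cons by (auto simp: d_def)
    have "y (n + d) = y' (n' + d)" "y (n + d - 1) = y' (n' + d - 1)"
      using Cons.prems(2)[of d] Cons.prems(2)[of "d - 1"] d(3) by (simp_all add: algebra_simps)
    then show ?case using d Cons.prems(1) by (auto simp: exch_def)
  qed simp
  then show "eval_word y l n - n = eval_word y' l n' - n'" "\<bar>eval_word y l n - n\<bar> \<le> int (length l)" by auto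
qed

text \<open>Runs of zeros of length \<open>m - 1\<close> or \<open>m\<close> between consecutive ones.\<close>

definition gaps :: "int \<Rightarrow> (int \<Rightarrow> bool) \<Rightarrow> bool" where
  "gaps m y \<longleftrightarrow> (\<forall>n j. 0 < j \<longrightarrow> j < m \<longrightarrow> \<not> (y n \<and> y (n + j))) \<and> (\<forall>n. \<exists>j\<in>{0..m}. y (n - j))"

text \<open>For the Sturmian coding and m = \<open>max_gap\<close> these are the n with \<theta> n
  in [m \<alpha>, 1). Written through the coding, the arc has a counterpart for the rational
  rotation.\<close>

definition long_gap :: "int \<Rightarrow> (int \<Rightarrow> bool) \<Rightarrow> int set" where
  "long_gap m y = {n. \<forall>j\<in>{0..<m}. \<not> y (n - j)}"

lemma disjoint_ones:
  assumes "gaps m y" "2 \<le> m"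
  shows "disjoint_shifts {n. y n} 0 1"
  unfolding disjoint_shifts_def
proof (intro allI impI notI)
  fix n assume "n - 0 \<in> {n. y n}" "n - 1 \<in> {n. y n}"
  then have "y (n - 1) \<and> y (n - 1 + 1)" by simp
  moreover have "0 < (1::int)" "1 < m" using assms(2) by auto
  ultimately show False using assms(1) unfolding gaps_def by blast
qed

lemma disjoint_long_gap:
  assumes "gaps m y" "0 < m"
  shows "disjoint_shifts (long_gap m y) 0 1"
  unfolding disjoint_shifts_def
proof (intro allI impI notI)
  fix n assume n: "n - 0 \<in> long_gap m y" "n - 1 \<in> long_gap m y"
  obtain j where j: "j \<in> {0..m}" "y (n - j)" using assms(1) unfolding gaps_def by blast
  show False
  proof (cases "j = m")
    case True
    then have "n - 1 - (j - 1) = n - j" "j - 1 \<in> {0..<m}" using assms(2) by auto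
    then show False using n(2) j(2) unfolding long_gap_def by (metis mem_Collect_eq)
  next
    case False
    then show False using n(1) j unfolding long_gap_def by auto
  qed
qed

lemma card_shift_periodic:
  fixes y :: "int \<Rightarrow> bool"
  assumes "0 < q" and per: "\<And>n. y (n + q) = y n"
  shows "card {n \<in> {0..<q}. y (n - j)} = card {n \<in> {0..<q}. y n}"
proof -
  have mult: "y (n + k * q) = y n" for n k
  proof (induction k rule: int_induct[of _ 0])
    case (step1 i)
    then show ?case using per[of "n + i * q"] by (simp add: algebra_simps)
  next
    case (step2 i)
    then show ?case using per[of "n + (i - 1) * q"] by (simp add: algebra_simps)
  qed simp
  have mod: "y (n mod q) = y n" for n
    using mult[of "n mod q" "n div q"] by simp
  have "bij_betw (\<lambda>n. (n - j) mod q) {n \<in> {0..<q}. y (n - j)} {n \<in> {0..<q}. y n}"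
  proof (rule bij_betw_byWitness[where f' = "\<lambda>n. (n + j) mod q"])
    have "y ((n + j) mod q - j) = y n" for n
    proof -
      have "y ((n + j) mod q - j) = y (((n + j) mod q - j) mod q)" by (rule mod[symmetric])
      also have "((n + j) mod q - j) mod q = n mod q" by (simp add: mod_diff_left_eq)
      finally show ?thesis by (simp add: mod)
    qed
    then show "(\<lambda>n. (n + j) mod q) ` {n \<in> {0..<q}. y n} \<subseteq> {n \<in> {0..<q}. y (n - j)}"
      using assms(1) by auto
  qed (use assms(1) in \<open>auto simp: mod mod_simps\<close>)
  then show ?thesis by (rule bij_betw_same_card)
qed

text \<open>Modulo q the complement of \<open>long_gap\<close> is a disjoint union of m translates
  of the set of ones. It has an even number of elements, while q is odd.\<close>

lemma odd_card_long_gap: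
  assumes "gaps m y" "0 < m" "0 < q" "odd q" and per: "\<And>n. y (n + q) = y n"
    and even: "even (card {n \<in> {0..<q}. y n})"
  shows "odd (card {n \<in> {0..<q}. n \<in> long_gap m y})"
proof -
  let ?U = "\<lambda>j. {n \<in> {0..<q}. y (n - j)}"
  have fin: "finite (?U j)" for j by (rule finite_subset[of _ "{0..<q}"]) auto
  have disj: "\<forall>i\<in>{0..<m}. \<forall>j\<in>{0..<m}. i \<noteq> j \<longrightarrow> ?U i \<inter> ?U j = {}"
  proof (intro ballI impI)
    have *: "\<not> (y (n - i) \<and> y (n - j))" if "i < j" "i \<in> {0..<m}" "j \<in> {0..<m}" for i j n
    proof -
      have "0 < j - i" "j - i < m" using that by auto
      then have "\<not> (y (n - j) \<and> y (n - j + (j - i)))" using assms(1) unfolding gaps_def by blast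
      moreover have "n - j + (j - i) = n - i" by simp
      ultimately show ?thesis by metis
    qed
    show "?U i \<inter> ?U j = {}" if "i \<in> {0..<m}" "j \<in> {0..<m}" "i \<noteq> j" for i j
      using *[of i j] *[of j i] that by (cases i j rule: linorder_cases) auto
  qed
  have "card (\<Union>j\<in>{0..<m}. ?U j) = (\<Sum>j\<in>{0..<m}. card (?U j))"
    by (rule card_UN_disjoint[OF _ _ disj]) (use fin in auto)
  also have "\<dots> = (\<Sum>j\<in>{0..<m}. card (?U 0))"
    using card_shift_periodic[of q y, OF assms(3) per] by simp
  finally have "even (card (\<Union>j\<in>{0..<m}. ?U j))" using even by simp
  moreover have "{0..<q} = {n \<in> {0..<q}. n \<in> long_gap m y} \<union> (\<Union>j\<in>{0..<m}. ?U j)"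
    by (auto simp: long_gap_def)
  then have "card {0..<q} = card {n \<in> {0..<q}. n \<in> long_gap m y} + card (\<Union>j\<in>{0..<m}. ?U j)"
  proof -
    have "finite ({n \<in> {0..<q}. n \<in> long_gap m y})" "finite (\<Union>j\<in>{0..<m}. ?U j)"
      using fin by (auto intro: finite_subset[of _ "{0..<q}"])
    moreover have "{n \<in> {0..<q}. n \<in> long_gap m y} \<inter> (\<Union>j\<in>{0..<m}. ?U j) = {}" by (auto simp: long_gap_def)
    ultimately show ?thesis by (subst \<open>{0..<q} = _\<close>) (rule card_Un_disjoint)
  qed
  moreover have "odd (card {0..<q})" using assms(3,4) by (simp add: even_nat_iff)
  ultimately show ?thesis by (simp only: even_add simp_thms)
qed

lemma cyclic_sign_exch_periodic:
  assumes "2 \<le> q" "disjoint_shifts V 0 1" and per: "\<And>n. n mod q \<in> V \<longleftrightarrow> n \<in> V"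
  shows "cyclic_sign q (exch V 0 1) = (- 1) ^ card {n \<in> {0..<q}. n \<in> V}"
proof -
  let ?S = "{n \<in> {0..<q}. n \<in> V}"
  have eq: "{n. n mod q \<in> ?S} = V" using assms(1) per by auto
  have "finite ?S" by (rule finite_subset[of _ "{0..<q}"]) auto
  moreover have "?S \<subseteq> {0..<q}" by auto
  ultimately show ?thesis using cyclic_sign_exch[OF assms(1), of ?S] assms(2) unfolding eq by blast
qed

lemma cyclic_sign_eval_word:
  assumes "3 \<le> q" "odd q" and d: "disjoint_shifts {n. y n} 0 1" and per: "\<And>n. y (n mod q) = y n"
    and even: "even (card {n \<in> {0..<q}. y n})" and l: "set l \<subseteq> {-1, 0, 1}"
  shows "commutes_shift q (eval_word y l) \<and> cyclic_sign q (eval_word y l) = 1"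
  using l
proof (induction l)
  case Nil
  have "commutes_shift q id" by (simp add: commutes_shift_def)
  then show ?case by (simp only: eval_word.simps cyclic_sign_id simp_thms)
next
  case (Cons a l)
  have "y (n + q) = y n" for n using per[of "n + q"] per[of n] by simp
  then have c: "commutes_shift q (exch {n. y n} 0 1)" by (intro commutes_shift_exch[OF d]) simp
  have "cyclic_sign q (exch {n. y n} 0 1) = 1"
    using cyclic_sign_exch_periodic[OF _ d] per assms(1) even by simp
  moreover have q: "0 < q" using assms(1) by simp
  ultimately have s: "commutes_shift q s \<and> cyclic_sign q s = 1"
    if "s = (if a = 0 then exch {n. y n} 0 1 else translation a)" for s
    using that Cons.prems c commutes_shift_translation cyclic_sign_translation_1[OF q assms(2)]
      cyclic_sign_translation_minus_1[OF q assms(2)]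
    by (cases "a = 0"; cases "a = 1") auto
  have "set l \<subseteq> {-1, 0, 1}" using Cons.prems by auto
  note IH = Cons.IH[OF this] and s' = s[OF refl]
  show ?case
    unfolding eval_word.simps cyclic_sign_comp[OF q conjunct1[OF s'] conjunct1[OF IH]]
      conjunct2[OF s'] conjunct2[OF IH]
    using commutes_shift_comp[OF conjunct1[OF s'] conjunct1[OF IH]] by (simp only: mult_1 simp_thms)
qed

text \<open>The coding of the rational rotation by \<open>p / q\<close>.\<close>

definition rational_coding :: "int \<Rightarrow> int \<Rightarrow> int \<Rightarrow> bool" where
  "rational_coding p q n \<longleftrightarrow> (n * p) mod q < p"

text \<open>The indicator of the coding is the increment of the integer part of n p / q from n - 1
  to n, so the sum over a period telescopes to (p - 1) - (-1).\<close>

lemma card_rational_coding: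
  assumes "0 < p" "p < q"
  shows "card {n \<in> {0..<q}. rational_coding p q n} = nat p"
proof -
  define f where "f n = int (of_bool (rational_coding p q n))" for n
  have step: "f n = (n * p) div q - ((n - 1) * p) div q" for n
  proof -
    let ?r = "(n * p) mod q" and ?D = "(n * p) div q"
    have np: "n * p = q * ?D + ?r" by simp
    have r: "0 \<le> ?r" "?r < q" using assms by auto
    show ?thesis
    proof (cases "?r < p")
      case True
      have "(n - 1) * p = q * (?D - 1) + (?r - p + q)" using np by (simp add: algebra_simps)
      moreover have "0 \<le> ?r - p + q" "?r - p + q < q" using True r assms by linarith+
      ultimately have "((n - 1) * p) div q = ?D - 1" by (intro int_div_pos_eq)
      then show ?thesis using True by (simp add: f_def rational_coding_def)
    next
      case False
      have "(n - 1) * p = q * ?D + (?r - p)" using np by (simp add: algebra_simps)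
      moreover have "0 \<le> ?r - p" "?r - p < q" using False r assms by linarith+
      ultimately have "((n - 1) * p) div q = ?D" by (intro int_div_pos_eq)
      then show ?thesis using False by (simp add: f_def rational_coding_def)
    qed
  qed
  have sum: "(\<Sum>n\<in>{0..<int k}. f n) = ((int k - 1) * p) div q - (- p) div q" for k
  proof (induction k)
    case (Suc k)
    have "{0..<int (Suc k)} = insert (int k) {0..<int k}" by auto
    then show ?case using Suc step[of "int k"] by simp
  qed simp
  have "(- p) div q = -1" by (rule int_div_pos_eq[of _ _ _ "q - p"]) (use assms in auto)
  moreover have "((q - 1) * p) div q = p - 1"
    by (rule int_div_pos_eq[of _ _ _ "q - p"]) (use assms in \<open>auto simp: algebra_simps\<close>)
  ultimately have "(\<Sum>n\<in>{0..<q}. f n) = p"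
    using sum[of "nat q"] assms by simp
  moreover have "{n \<in> {0..<q}. rational_coding p q n} = {0..<q} \<inter> {n. rational_coding p q n}" by auto
  then have "(\<Sum>n\<in>{0..<q}. f n) = int (card {n \<in> {0..<q}. rational_coding p q n})" by (simp add: f_def)
  ultimately show ?thesis by simp
qed

section \<open>Transfer from rational rotations to the Sturmian coding\<close>

context irrational_rotation
begin

text \<open>The parities come from approximating \<open>\<alpha> / 2\<close> modulo \<open>1\<close>.\<close>

lemma parity_approximation:
  assumes "0 < \<epsilon>"
  obtains p q :: int where "0 < p" "p < q" "even p" "odd q" "3 \<le> q" "\<bar>of_int q * \<alpha> - of_int p\<bar> < \<epsilon>"
proof -
  \<comment> \<open>An error below \<alpha> also forces 0 < p < q.\<close>
  define \<delta> where "\<delta> = min \<epsilon> \<alpha>"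
  have \<delta>: "0 < \<delta>" "\<delta> \<le> \<epsilon>" "\<delta> \<le> \<alpha>" using assms \<alpha>_pos by (auto simp: \<delta>_def)
  then have "0 < \<delta> / 2" by simp
  then obtain h k :: int where k: "k > 0" "\<bar>of_int k * \<alpha> - of_int h - (- \<alpha> / 2)\<bar> < \<delta> / 2"
    by (rule sequence_of_fractional_parts_is_dense[OF \<alpha>_irrational])
  \<comment> \<open>Doubling the approximation k \<alpha> - h of -\<alpha>/2 gives (2 k + 1)
    \<alpha> close to 2 h, which fixes both parities.\<close>
  define p q where "p = 2 * h" and "q = 2 * k + 1"
  have "of_int q * \<alpha> - of_int p = 2 * (of_int k * \<alpha> - of_int h - (- \<alpha> / 2))"
    by (simp add: p_def q_def algebra_simps)
  then have twice: "\<bar>of_int q * \<alpha> - of_int p\<bar> = 2 * \<bar>of_int k * \<alpha> - of_int h - (- \<alpha> / 2)\<bar>"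
    by (simp only: abs_mult abs_numeral)
  have "x < \<delta> / 2 \<Longrightarrow> 2 * x < \<delta>" for x by simp
  from this[OF k(2)] have close: "\<bar>of_int q * \<alpha> - of_int p\<bar> < \<delta>" unfolding twice .
  have q: "3 \<le> q" using k by (simp add: q_def)
  have "\<alpha> \<le> of_int q * \<alpha>" using q \<alpha>_pos by simp
  then have "0 < real_of_int p" using close \<delta> by linarith
  moreover have "of_int q * \<alpha> + \<alpha> \<le> of_int q"
  proof -
    have "(of_int q + 1) * \<alpha> \<le> (of_int q + 1) * (1 / 2)" using q \<alpha>_less by (intro mult_left_mono) auto
    also have "\<dots> \<le> of_int q" using q by simp
    finally show ?thesis by (simp add: algebra_simps)
  qed
  then have "real_of_int p < of_int q" using close \<delta> by linarith
  ultimately show thesis using that[of p q] q close \<delta> by (auto simp: p_def q_def)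
qed

text \<open>Every window of the rational coding occurs in \<open>w\<close>. Measured in units of
  1/q, three errors of at most 1/8 arise: the choice of N (\<open>e1\<close>), the drift over at
  most R steps (\<open>e2\<close>), and the difference between q \<alpha> and p. Their sum stays
  below the margin 1/2.\<close>

lemma rational_coding_windows:
  assumes pq: "0 < p" "p < q" and R: "0 \<le> R" and close: "\<bar>of_int q * \<alpha> - of_int p\<bar> < 1 / (8 * (of_int R + 1))"
  obtains N where "\<And>j. \<bar>j\<bar> \<le> R \<Longrightarrow> rational_coding p q (n + j) = w (N + j)"
proof -
  have q: "0 < real_of_int q" using pq by simp
  \<comment> \<open>The summand 1/2 puts the point midway between two multiples of 1/q, away from
    the end points of the coding arcs.\<close>
  define x where "x = (of_int n * of_int p + 1 / 2) / real_of_int q"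
  have "0 < 1 / (8 * real_of_int q)" using q by simp
  then obtain h N :: int where "N > 0" and N: "\<bar>of_int N * \<alpha> - of_int h - x\<bar> < 1 / (8 * of_int q)"
    by (rule sequence_of_fractional_parts_is_dense[OF \<alpha>_irrational])
  show thesis
  proof (rule that)
    fix j :: int assume j: "\<bar>j\<bar> \<le> R"
    define K D where "K = ((n + j) * p) mod q" and "D = ((n + j) * p) div q"
    have K: "0 \<le> K" "K < q" using pq by (auto simp: K_def)
    have KD: "(n + j) * p = q * D + K" by (simp add: K_def D_def)
    define e1 where "e1 = of_int q * (of_int N * \<alpha> - of_int h - x)"
    define e2 where "e2 = of_int j * (of_int q * \<alpha> - of_int p)"
    have e1: "\<bar>e1\<bar> < 1 / 8" unfolding e1_def abs_mult using N q by (simp add: field_simps)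
    have e2: "\<bar>e2\<bar> \<le> 1 / 8"
    proof -
      have "\<bar>e2\<bar> \<le> (of_int R + 1) * (1 / (8 * (of_int R + 1)))"
        unfolding e2_def abs_mult using close j by (intro mult_mono) auto
      also have "\<dots> = 1 / 8" using R by (simp add: field_simps)
      finally show ?thesis .
    qed
    have e3: "\<bar>of_int q * \<alpha> - of_int p\<bar> \<le> 1 / 8"
    proof -
      have "1 / (8 * (real_of_int R + 1)) \<le> 1 / 8" using R by (simp add: field_simps)
      then show ?thesis using close by linarith
    qed
    define y where "y = (of_int K + 1 / 2 + e1 + e2) / real_of_int q"
    have KD': "of_int n * of_int p + of_int j * of_int p = of_int q * of_int D + (of_int K :: real)"
      using arg_cong[OF KD, of real_of_int] by (simp add: distrib_right)
    have "of_int q * (of_int (N + j) * \<alpha>) = of_int q * (y + of_int (h + D))"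
    proof -
      have "of_int q * y = of_int K + 1 / 2 + e1 + e2" using q by (simp add: y_def)
      moreover have "of_int q * x = of_int n * of_int p + 1 / 2" using q by (simp add: x_def)
      moreover have "e1 = of_int q * (of_int N * \<alpha>) - of_int q * of_int h - of_int q * x"
        by (simp add: e1_def algebra_simps)
      moreover have "e2 = of_int q * (of_int j * \<alpha>) - of_int j * of_int p"
        by (simp add: e2_def algebra_simps)
      ultimately show ?thesis using KD' by (simp add: distrib_left distrib_right)
    qed
    then have "of_int (N + j) * \<alpha> = y + of_int (h + D)" using q by simp
    moreover have qy: "of_int q * y = of_int K + 1 / 2 + e1 + e2" using q by (simp add: y_def)
    have K': "0 \<le> real_of_int K" "real_of_int K \<le> of_int q - 1" using K by (simp, linarith)
    have "0 \<le> y" unfolding y_def using e1 e2 K' q by (intro divide_nonneg_pos) linarith+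
    moreover have "y < 1" unfolding y_def using e1 e2 K' q by (subst divide_less_eq_1_pos) linarith+
    ultimately have \<theta>: "\<theta> (N + j) = y" by (rule \<theta>_eqI)
    have "rational_coding p q (n + j) \<longleftrightarrow> K < p" by (simp add: rational_coding_def K_def)
    also have "\<dots> \<longleftrightarrow> of_int q * y < of_int q * \<alpha>"
    proof
      assume "K < p"
      then have "real_of_int K \<le> of_int p - 1" by linarith
      then show "of_int q * y < of_int q * \<alpha>" unfolding qy using e1 e2 e3 by linarith
    next
      assume *: "of_int q * y < of_int q * \<alpha>"
      then have "real_of_int K < of_int p" unfolding qy using e1 e2 e3 by linarith
      then show "K < p" by simp
    qed
    also have "\<dots> \<longleftrightarrow> w (N + j)" using q by (simp add: w_def \<theta>)
    finally show "rational_coding p q (n + j) = w (N + j)" .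
  qed
qed

definition max_gap :: int where
  "max_gap = \<lfloor>1 / \<alpha>\<rfloor>"

lemma max_gap: "of_int max_gap * \<alpha> \<le> 1" "1 < (of_int max_gap + 1) * \<alpha>" "6 \<le> max_gap"
proof -
  have "of_int max_gap \<le> 1 / \<alpha>" "1 / \<alpha> < of_int max_gap + 1" unfolding max_gap_def by linarith+
  then show "of_int max_gap * \<alpha> \<le> 1" "1 < (of_int max_gap + 1) * \<alpha>"
    using \<alpha>_pos by (simp_all add: field_simps)
  have "6 \<le> 1 / \<alpha>" using \<alpha>_pos \<alpha>_less by (simp add: field_simps)
  then show "6 \<le> max_gap" unfolding max_gap_def by (simp add: le_floor_iff)
qed

lemma gaps_w: "gaps max_gap w"
  unfolding gaps_def
proof (intro conjI allI impI)
  fix n j :: int assume j: "0 < j" "j < max_gap"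
  show "\<not> (w n \<and> w (n + j))"
  proof
    assume wn: "w n \<and> w (n + j)"
    have "of_int (j + 1) * \<alpha> \<le> of_int max_gap * \<alpha>" using j \<alpha>_pos by (intro mult_right_mono) simp_all
    then have le: "of_int j * \<alpha> + \<alpha> \<le> 1" using max_gap(1) by (simp add: algebra_simps)
    have ge: "\<alpha> \<le> of_int j * \<alpha>" using j \<alpha>_pos by simp
    have "\<theta> j = of_int j * \<alpha>" using \<theta>_mult[of j 1] le ge \<alpha>_pos by (simp add: \<theta>_1)
    then have "\<theta> (n + j) = \<theta> n + of_int j * \<alpha>" using wn le by (simp add: \<theta>_add w_def)
    then show False using wn ge \<theta>_ge_0[of n] by (simp add: w_def)
  qed
next
  fix n :: int
  define j where "j = \<lfloor>\<theta> n / \<alpha>\<rfloor>"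
  have "of_int j \<le> \<theta> n / \<alpha>" "\<theta> n / \<alpha> < of_int j + 1" unfolding j_def by linarith+
  then have b: "of_int j * \<alpha> \<le> \<theta> n" "\<theta> n < of_int j * \<alpha> + \<alpha>"
    using \<alpha>_pos by (simp_all add: field_simps)
  have "0 \<le> j" unfolding j_def using \<theta>_ge_0[of n] \<alpha>_pos by simp
  have "\<theta> n / \<alpha> \<le> 1 / \<alpha>" using \<theta>_less_1[of n] \<alpha>_pos by (intro divide_right_mono) auto
  then have "j \<le> max_gap" unfolding j_def max_gap_def by (rule floor_mono)
  moreover have "\<theta> (n - j) = \<theta> n - of_int j * \<alpha>"
    by (rule \<theta>_eqI[of _ _ "turns n"])
      (use turns_decomp[of n] b \<alpha>_less in \<open>auto simp: algebra_simps\<close>)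
  ultimately show "\<exists>j\<in>{0..max_gap}. w (n - j)"
    using b \<open>0 \<le> j\<close> by (intro bexI[of _ j]) (auto simp: w_def)
qed

lemma GZ_eval_word:
  assumes "f \<in> GZ"
  obtains l where "set l \<subseteq> {-1, 0, 1}" "f = eval_word w l"
proof -
  have A1: "{n. w n} = A 1" by (auto simp: w_def A_def \<theta>_1)
  have "\<exists>l. set l \<subseteq> {-1, 0, 1} \<and> f = eval_word w l"
    using assms unfolding GZ_def
  proof induction
    case id
    show ?case by (intro exI[of _ "[]"]) simp
  next
    case (step s f)
    then obtain l where l: "set l \<subseteq> {-1, 0, 1}" "f = eval_word w l" by blast
    have "\<exists>a\<in>{-1, 0, 1}. s = (if a = 0 then exch {n. w n} 0 1 else translation a)"
      using step(1) unfolding A1 by auto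
    then obtain a where a: "a \<in> {-1, 0, 1}" "s = (if a = 0 then exch {n. w n} 0 1 else translation a)" by blast
    show ?case by (rule exI[of _ "a # l"]) (use l a in \<open>simp only: eval_word.simps set_simps insert_subset simp_thms\<close>)
  qed
  then show thesis using that by blast
qed

theorem exch_long_gap_notin_GZ: "exch (long_gap max_gap w) 0 1 \<notin> GZ"
proof
  assume "exch (long_gap max_gap w) 0 1 \<in> GZ"
  then obtain l where l: "set l \<subseteq> {-1, 0, 1}" "exch (long_gap max_gap w) 0 1 = eval_word w l"
    using GZ_eval_word by blast
  \<comment> \<open>Large enough for the window of the word, for the tests of \<open>gaps\<close>,
    and for membership in \<open>long_gap\<close> at n and n - 1.\<close>
  define R where "R = int (length l) + max_gap + 1"
  have R: "0 \<le> R" "int (length l) \<le> R" "max_gap < R" using max_gap(3) by (auto simp: R_def)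
  then obtain p q where pq: "0 < p" "p < q" "even p" "odd q" "3 \<le> q"
    and close: "\<bar>of_int q * \<alpha> - of_int p\<bar> < 1 / (8 * (of_int R + 1))"
    using parity_approximation[of "1 / (8 * (of_int R + 1))"] by auto
  define y where "y = rational_coding p q"
  have window: "\<exists>N. \<forall>j. \<bar>j\<bar> \<le> R \<longrightarrow> y (n + j) = w (N + j)" for n
    using rational_coding_windows[OF pq(1,2) R(1) close, of n] unfolding y_def by metis
  have per: "y (n mod q) = y n" for n
    by (simp add: y_def rational_coding_def mod_mult_left_eq)
  then have per': "y (n + q) = y n" for n by (metis mod_add_self2)
  have gaps: "gaps max_gap y"
    unfolding gaps_def
  proof (intro conjI allI impI)
    fix n j :: int assume j: "0 < j" "j < max_gap"
    obtain N where N: "\<And>j. \<bar>j\<bar> \<le> R \<Longrightarrow> y (n + j) = w (N + j)" using window by blast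
    have "y n = w N" "y (n + j) = w (N + j)" using N[of 0] N[of j] j R by auto
    then show "\<not> (y n \<and> y (n + j))" using gaps_w j unfolding gaps_def by blast
  next
    fix n :: int
    obtain N where N: "\<And>j. \<bar>j\<bar> \<le> R \<Longrightarrow> y (n + j) = w (N + j)" using window by blast
    obtain j where j: "j \<in> {0..max_gap}" "w (N - j)" using gaps_w unfolding gaps_def by blast
    then have "y (n - j)" using N[of "- j"] R by auto
    then show "\<exists>j\<in>{0..max_gap}. y (n - j)" using j by blast
  qed
  have even: "even (card {n \<in> {0..<q}. y n})"
    unfolding y_def card_rational_coding[OF pq(1,2)] using pq by (simp add: even_nat_iff)
  \<comment> \<open>Both displacements read \<open>y\<close> only within distance R of n, hence
    equal those of \<open>w\<close> at the matching place N, where the assumed equation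
    holds.\<close>
  have "exch (long_gap max_gap y) 0 1 n = eval_word y l n" for n
  proof -
    obtain N where N: "\<And>j. \<bar>j\<bar> \<le> R \<Longrightarrow> y (n + j) = w (N + j)" using window by blast
    have "n - i \<in> long_gap max_gap y \<longleftrightarrow> N - i \<in> long_gap max_gap w" if "i \<in> {0, 1}" for i
    proof -
      have "y (n - i - j) = w (N - i - j)" if "j \<in> {0..<max_gap}" for j
        using N[of "- i - j"] that \<open>i \<in> {0, 1}\<close> R by (auto simp: algebra_simps)
      then show ?thesis by (simp add: long_gap_def)
    qed
    from this[of 0] this[of 1]
    have "exch (long_gap max_gap y) 0 1 n - n = exch (long_gap max_gap w) 0 1 N - N"
      by (simp add: exch_def)
    also have "\<dots> = eval_word y l n - n"
      unfolding l(2) by (rule eval_word_local(1)[OF l(1), symmetric]) (use N R in auto)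
    finally show ?thesis by simp
  qed
  then have eq: "exch (long_gap max_gap y) 0 1 = eval_word y l" by blast
  have "disjoint_shifts {n. y n} 0 1" using max_gap(3) by (intro disjoint_ones[OF gaps]) simp
  then have 1: "cyclic_sign q (eval_word y l) = 1"
    using cyclic_sign_eval_word[OF pq(5,4) _ per even l(1)] by blast
  have "n mod q \<in> long_gap max_gap y \<longleftrightarrow> n \<in> long_gap max_gap y" for n
  proof -
    have "y (n mod q - j) = y (n - j)" for j
      using per[of "n mod q - j"] per[of "n - j"] by (simp add: mod_diff_left_eq)
    then show ?thesis by (simp add: long_gap_def)
  qed
  moreover have "disjoint_shifts (long_gap max_gap y) 0 1"
    using max_gap(3) by (intro disjoint_long_gap[OF gaps]) simp
  ultimately have "cyclic_sign q (eval_word y l) = (- 1) ^ card {n \<in> {0..<q}. n \<in> long_gap max_gap y}"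
    unfolding eq[symmetric] using pq(5) by (intro cyclic_sign_exch_periodic) auto
  moreover have "odd (card {n \<in> {0..<q}. n \<in> long_gap max_gap y})"
    using max_gap(3) pq by (intro odd_card_long_gap[OF gaps _ _ _ per' even]) auto
  ultimately show False using 1 by simp
qed

end

section \<open>Topological full groups of subshifts\<close>

lemma BijGroup_mult_apply:
  assumes "f \<in> Bij X" "g \<in> Bij X" "x \<in> X"
  shows "(f \<otimes>\<^bsub>BijGroup X\<^esub> g) x = f (g x)"
  using assms by (simp add: BijGroup_def compose_def)

lemma BijGroup_mult_closed:
  assumes "f \<in> Bij X" "g \<in> Bij X"
  shows "f \<otimes>\<^bsub>BijGroup X\<^esub> g \<in> Bij X"
  using assms by (simp add: BijGroup_def compose_Bij)

lemma carrier_BijGroup: "carrier (BijGroup X) = Bij X"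
  by (simp add: BijGroup_def)

lemma Bij_mem: "f \<in> Bij X \<Longrightarrow> x \<in> X \<Longrightarrow> f x \<in> X"
  using Bij_imp_funcset by blast

lemma Bij_ext:
  assumes "f \<in> Bij X" "g \<in> Bij X" "\<And>x. x \<in> X \<Longrightarrow> f x = g x"
  shows "f = g"
  using assms by (intro extensionalityI[of f X g]) (auto intro: Bij_imp_extensional)

lemma inv_BijGroup_closed: "f \<in> Bij X \<Longrightarrow> inv\<^bsub>BijGroup X\<^esub> f \<in> Bij X"
  using group.inv_closed[OF group_BijGroup, of f X] by (simp add: carrier_BijGroup)

lemma inv_BijGroup_apply:
  assumes "f \<in> Bij X" "x \<in> X"
  shows "f ((inv\<^bsub>BijGroup X\<^esub> f) x) = x" "(inv\<^bsub>BijGroup X\<^esub> f) (f x) = x"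
proof -
  have "f \<otimes>\<^bsub>BijGroup X\<^esub> inv\<^bsub>BijGroup X\<^esub> f = \<one>\<^bsub>BijGroup X\<^esub>" "inv\<^bsub>BijGroup X\<^esub> f \<otimes>\<^bsub>BijGroup X\<^esub> f = \<one>\<^bsub>BijGroup X\<^esub>"
    using group.r_inv[OF group_BijGroup, of f X] group.l_inv[OF group_BijGroup, of f X] assms
    by (simp_all add: carrier_BijGroup)
  moreover have "\<one>\<^bsub>BijGroup X\<^esub> x = x" using assms by (simp add: BijGroup_def)
  ultimately show "f ((inv\<^bsub>BijGroup X\<^esub> f) x) = x" "(inv\<^bsub>BijGroup X\<^esub> f) (f x) = x"
    using BijGroup_mult_apply[OF assms(1) inv_BijGroup_closed[OF assms(1)] assms(2)]
      BijGroup_mult_apply[OF inv_BijGroup_closed[OF assms(1)] assms(1) assms(2)] by simp_all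
qed

lemma int_pow_BijGroup_add:
  assumes "\<phi> \<in> Bij X" "x \<in> X"
  shows "(\<phi> [^]\<^bsub>BijGroup X\<^esub> (i + j :: int)) x = (\<phi> [^]\<^bsub>BijGroup X\<^esub> i) ((\<phi> [^]\<^bsub>BijGroup X\<^esub> j) x)"
proof -
  have "\<phi> [^]\<^bsub>BijGroup X\<^esub> (i :: int) \<in> Bij X" for i
    using group.int_pow_closed[OF group_BijGroup, of \<phi> X i] assms(1) by (simp add: carrier_BijGroup)
  then show ?thesis
    using group.int_pow_mult[OF group_BijGroup, of \<phi> X i j] assms
    by (simp add: carrier_BijGroup BijGroup_mult_apply)
qed

text \<open>The exponents form a cocycle: a product has exponent c1(\<psi>2 x) + c2 x, and the
  inverse of \<psi> has the negative of c evaluated at the preimage of x.\<close>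

lemma subgroup_topological_full_group:
  assumes \<phi>: "\<phi> \<in> Bij X"
  shows "subgroup (carrier (topological_full_group X \<phi>)) (BijGroup X)"
proof -
  let ?B = "BijGroup X"
  let ?S = "carrier (topological_full_group X \<phi>)"
  interpret B: group ?B by (rule group_BijGroup)
  have S: "\<psi> \<in> ?S \<longleftrightarrow> \<psi> \<in> Bij X \<and> (\<exists>\<psi>'. homeomorphism X X \<psi> \<psi>') \<and>
       (\<exists>c :: 'a \<Rightarrow> int. continuous_on X c \<and> (\<forall>x\<in>X. \<psi> x = (\<phi> [^]\<^bsub>?B\<^esub> c x) x))" for \<psi>
    by (simp add: topological_full_group_def carrier_BijGroup)
  show ?thesis
  proof
    show "?S \<subseteq> carrier ?B" using S by (auto simp: carrier_BijGroup)
    show "\<one>\<^bsub>?B\<^esub> \<in> ?S"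
      unfolding S
    proof (intro conjI)
      show "\<one>\<^bsub>?B\<^esub> \<in> Bij X" using B.one_closed by (simp add: carrier_BijGroup)
      have 1: "\<one>\<^bsub>?B\<^esub> x = x" if "x \<in> X" for x using that by (simp add: BijGroup_def)
      have "homeomorphism X X id id" by (auto simp: homeomorphism_def)
      then have "homeomorphism X X \<one>\<^bsub>?B\<^esub> id" by (rule homeomorphism_cong) (auto simp: 1)
      then show "\<exists>\<psi>'. homeomorphism X X \<one>\<^bsub>?B\<^esub> \<psi>'" by blast
      show "\<exists>c :: 'a \<Rightarrow> int. continuous_on X c \<and> (\<forall>x\<in>X. \<one>\<^bsub>?B\<^esub> x = (\<phi> [^]\<^bsub>?B\<^esub> c x) x)"
        by (intro exI[of _ "\<lambda>_. 0"]) simp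
    qed
  next
    fix \<psi>1 \<psi>2 assume "\<psi>1 \<in> ?S" "\<psi>2 \<in> ?S"
    then obtain h1 h2 c1 c2 where b: "\<psi>1 \<in> Bij X" "\<psi>2 \<in> Bij X"
      and h: "homeomorphism X X \<psi>1 h1" "homeomorphism X X \<psi>2 h2"
      and c: "continuous_on X c1" "continuous_on X c2"
      and e: "\<And>x. x \<in> X \<Longrightarrow> \<psi>1 x = (\<phi> [^]\<^bsub>?B\<^esub> (c1 x :: int)) x" "\<And>x. x \<in> X \<Longrightarrow> \<psi>2 x = (\<phi> [^]\<^bsub>?B\<^esub> (c2 x :: int)) x"
      unfolding S by blast
    have m: "(\<psi>1 \<otimes>\<^bsub>?B\<^esub> \<psi>2) x = \<psi>1 (\<psi>2 x)" if "x \<in> X" for x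
      using BijGroup_mult_apply[OF b that] .
    show "\<psi>1 \<otimes>\<^bsub>?B\<^esub> \<psi>2 \<in> ?S"
      unfolding S
    proof (intro conjI)
      show "\<psi>1 \<otimes>\<^bsub>?B\<^esub> \<psi>2 \<in> Bij X" by (rule BijGroup_mult_closed[OF b])
      have "homeomorphism X X (\<psi>1 \<otimes>\<^bsub>?B\<^esub> \<psi>2) (h2 \<circ> h1)"
        by (rule homeomorphism_cong[OF homeomorphism_compose[OF h(2,1)]]) (auto simp: m)
      then show "\<exists>\<psi>'. homeomorphism X X (\<psi>1 \<otimes>\<^bsub>?B\<^esub> \<psi>2) \<psi>'" by blast
      have "continuous_on X (\<lambda>x. c1 (\<psi>2 x))"
        using h(2) by (intro continuous_on_compose2[OF c(1)]) (auto simp: homeomorphism_def)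
      then have "continuous_on X (\<lambda>x. c1 (\<psi>2 x) + c2 x)" using c(2) by (rule continuous_on_add)
      moreover have "(\<psi>1 \<otimes>\<^bsub>?B\<^esub> \<psi>2) x = (\<phi> [^]\<^bsub>?B\<^esub> (c1 (\<psi>2 x) + c2 x)) x" if "x \<in> X" for x
        unfolding m[OF that] int_pow_BijGroup_add[OF \<phi> that] e(2)[OF that, symmetric]
        by (rule e(1)[OF Bij_mem[OF b(2) that]])
      ultimately show "\<exists>c. continuous_on X c \<and> (\<forall>x\<in>X. (\<psi>1 \<otimes>\<^bsub>?B\<^esub> \<psi>2) x = (\<phi> [^]\<^bsub>?B\<^esub> (c x :: int)) x)"
        by blast
    qed
  next
    fix \<psi> assume "\<psi> \<in> ?S"
    then obtain h c where b: "\<psi> \<in> Bij X" and h: "homeomorphism X X \<psi> h" and c: "continuous_on X c"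
      and e: "\<And>x. x \<in> X \<Longrightarrow> \<psi> x = (\<phi> [^]\<^bsub>?B\<^esub> (c x :: int)) x"
      unfolding S by blast
    let ?i = "inv\<^bsub>?B\<^esub> \<psi>"
    have iB: "?i \<in> Bij X" by (rule inv_BijGroup_closed[OF b])
    have ih: "?i x = h x" if "x \<in> X" for x
    proof -
      have "h x \<in> X" "\<psi> (h x) = x" using h that by (auto simp: homeomorphism_def)
      then show ?thesis using inv_BijGroup_apply(2)[OF b, of "h x"] by simp
    qed
    have hi: "homeomorphism X X ?i \<psi>"
      by (rule homeomorphism_cong[OF homeomorphism_symD[OF h]]) (auto simp: ih)
    show "?i \<in> ?S"
      unfolding S
    proof (intro conjI)
      show "?i \<in> Bij X" by (rule iB)
      show "\<exists>\<psi>'. homeomorphism X X ?i \<psi>'" using hi by blast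
      have "continuous_on X (\<lambda>x. c (?i x))"
        using hi by (intro continuous_on_compose2[OF c]) (auto simp: homeomorphism_def)
      then have "continuous_on X (uminus \<circ> (\<lambda>x. c (?i x)))"
        by (rule continuous_on_compose) simp
      then have "continuous_on X (\<lambda>x. - c (?i x))" by (simp add: comp_def)
      moreover have "?i x = (\<phi> [^]\<^bsub>?B\<^esub> (- c (?i x))) x" if "x \<in> X" for x
      proof -
        have y: "?i x \<in> X" "x = \<psi> (?i x)"
          using Bij_mem[OF iB that] inv_BijGroup_apply(1)[OF b that] by simp_all
        have "(\<phi> [^]\<^bsub>?B\<^esub> (- c (?i x))) x = (\<phi> [^]\<^bsub>?B\<^esub> (- c (?i x))) ((\<phi> [^]\<^bsub>?B\<^esub> (c (?i x))) (?i x))"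
          using e[OF y(1)] y(2) by simp
        also have "\<dots> = (\<phi> [^]\<^bsub>?B\<^esub> (- c (?i x) + c (?i x))) (?i x)"
          by (rule int_pow_BijGroup_add[OF \<phi> y(1), symmetric])
        also have "\<dots> = ?i x" using y(1) by (simp add: BijGroup_def)
        finally show ?thesis by simp
      qed
      ultimately show "\<exists>c. continuous_on X c \<and> (\<forall>x\<in>X. ?i x = (\<phi> [^]\<^bsub>?B\<^esub> (c x :: int)) x)" by blast
    qed
  qed
qed

section \<open>Continuity on sequences as dependence on a finite window\<close>

lemma open_cylinder: "open {y :: int \<Rightarrow> bool. \<forall>j. \<bar>j\<bar> \<le> N \<longrightarrow> y j = x j}"
proof -
  have "open {y :: int \<Rightarrow> bool. y j = x j}" for j
  proof -
    have "continuous_on UNIV (\<lambda>y :: int \<Rightarrow> bool. y j)"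
      by (intro continuous_on_product_coordinates)
    moreover have "open {x j}" by (rule open_discrete)
    ultimately have "open ((\<lambda>y :: int \<Rightarrow> bool. y j) -` {x j})" by (rule open_vimage[rotated])
    then show ?thesis by (simp add: vimage_def)
  qed
  then have "open (\<Inter>j\<in>{-N..N}. {y :: int \<Rightarrow> bool. y j = x j})" by (intro open_INT) auto
  moreover have "(\<Inter>j\<in>{-N..N}. {y :: int \<Rightarrow> bool. y j = x j}) = {y. \<forall>j. \<bar>j\<bar> \<le> N \<longrightarrow> y j = x j}"
    by (auto simp: abs_le_iff)
  ultimately show ?thesis by simp
qed

lemma cylinder_basis:
  fixes x :: "int \<Rightarrow> bool"
  assumes "open U" "x \<in> U"
  obtains N where "0 \<le> N" "\<And>y. (\<And>j. \<bar>j\<bar> \<le> N \<Longrightarrow> y j = x j) \<Longrightarrow> y \<in> U"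
proof -
  obtain Y where Y: "x \<in> (\<Pi>\<^sub>E i\<in>UNIV. Y i)" "finite {i. Y i \<noteq> UNIV}" "(\<Pi>\<^sub>E i\<in>UNIV. Y i) \<subseteq> U"
    using product_topology_open_contains_basis[of "\<lambda>_. euclidean" UNIV U x] assms
    unfolding open_fun_def by auto
  define N where "N = Max (insert 0 (abs ` {i. Y i \<noteq> UNIV}))"
  have N: "\<bar>i\<bar> \<le> N" if "Y i \<noteq> UNIV" for i
    unfolding N_def using Y(2) that by (intro Max_ge) auto
  have "y \<in> U" if "\<And>j. \<bar>j\<bar> \<le> N \<Longrightarrow> y j = x j" for y
  proof -
    have "y i \<in> Y i" for i
      using N[of i] that[of i] Y(1) by (cases "Y i = UNIV") (auto simp: PiE_def Pi_def)
    then show ?thesis using Y(3) by auto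
  qed
  moreover have "0 \<le> N" unfolding N_def using Y(2) by simp
  ultimately show thesis using that by blast
qed

lemma compact_UNIV_bool_sequences: "compact (UNIV :: (int \<Rightarrow> bool) set)"
proof -
  have "compact_space (euclidean :: bool topology)"
    by (simp add: compact_space_def finite_imp_compact)
  then have "compact_space (product_topology (\<lambda>_ :: int. euclidean :: bool topology) UNIV)"
    by (simp add: compact_space_product_topology)
  then show ?thesis by (simp add: euclidean_product_topology compact_space_def)
qed

definition window_determined :: "(int \<Rightarrow> bool) set \<Rightarrow> ((int \<Rightarrow> bool) \<Rightarrow> 'b) \<Rightarrow> bool" where
  "window_determined X f \<longleftrightarrow> (\<exists>N\<ge>0. \<forall>x\<in>X. \<forall>y\<in>X. (\<forall>j. \<bar>j\<bar> \<le> N \<longrightarrow> x j = y j) \<longrightarrow> f x = f y)"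

lemma window_determined_continuous:
  fixes f :: "(int \<Rightarrow> bool) \<Rightarrow> 'b::topological_space"
  assumes "window_determined X f"
  shows "continuous_on X f"
  unfolding continuous_on_def
proof
  fix x assume x: "x \<in> X"
  obtain N where N: "\<And>y z. y \<in> X \<Longrightarrow> z \<in> X \<Longrightarrow> (\<And>j. \<bar>j\<bar> \<le> N \<Longrightarrow> y j = z j) \<Longrightarrow> f y = f z"
    using assms unfolding window_determined_def by blast
  have "eventually (\<lambda>y. f y = f x) (at x within X)"
    unfolding eventually_at_topological
  proof (intro exI conjI ballI impI)
    show "open {y. \<forall>j. \<bar>j\<bar> \<le> N \<longrightarrow> y j = x j}" by (rule open_cylinder)
    show "f y = f x" if "y \<in> {y. \<forall>j. \<bar>j\<bar> \<le> N \<longrightarrow> y j = x j}" "y \<in> X" for y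
      using N[OF that(2) x] that(1) by blast
  qed simp
  then show "(f \<longlongrightarrow> f x) (at x within X)" by (rule tendsto_eventually)
qed

text \<open>A continuous integer-valued map is locally constant. By compactness finitely many
  cylinders suffice, and the largest of their radii serves everywhere.\<close>

lemma continuous_window_determined:
  fixes c :: "(int \<Rightarrow> bool) \<Rightarrow> int"
  assumes "closed X" "continuous_on X c"
  shows "window_determined X c"
proof -
  have "\<exists>N\<ge>0. \<forall>y\<in>X. (\<forall>j. \<bar>j\<bar> \<le> N \<longrightarrow> y j = x j) \<longrightarrow> c y = c x" if x: "x \<in> X" for x
  proof -
    have "open {c x}" by (rule open_discrete)
    then obtain U where U: "open U" "U \<inter> X = c -` {c x} \<inter> X"
      using assms(2) unfolding continuous_on_open_invariant by blast
    then have "x \<in> U" using x by auto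
    then obtain N where "0 \<le> N" "\<And>y. (\<And>j. \<bar>j\<bar> \<le> N \<Longrightarrow> y j = x j) \<Longrightarrow> y \<in> U"
      using cylinder_basis[OF U(1)] by metis
    then show ?thesis using U(2) by blast
  qed
  then obtain N where N: "\<And>x. x \<in> X \<Longrightarrow> 0 \<le> N x"
    "\<And>x y. x \<in> X \<Longrightarrow> y \<in> X \<Longrightarrow> (\<forall>j. \<bar>j\<bar> \<le> N x \<longrightarrow> y j = x j) \<Longrightarrow> c y = c x"
    by metis
  define C where "C x = {y :: int \<Rightarrow> bool. \<forall>j. \<bar>j\<bar> \<le> N x \<longrightarrow> y j = x j}" for x
  have "compact X" using compact_Int_closed[OF compact_UNIV_bool_sequences assms(1)] by simp
  moreover have "\<And>x. x \<in> X \<Longrightarrow> open (C x)" unfolding C_def by (rule open_cylinder)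
  moreover have "X \<subseteq> (\<Union>x\<in>X. C x)" by (auto simp: C_def)
  ultimately obtain F where F: "F \<subseteq> X" "finite F" "X \<subseteq> (\<Union>x\<in>F. C x)" by (rule compactE_image)
  define M where "M = Max (insert 0 (N ` F))"
  have M: "N x \<le> M" if "x \<in> F" for x unfolding M_def using F(2) that by (intro Max_ge) auto
  have "0 \<le> M" unfolding M_def using F(2) by simp
  moreover have "c y = c z" if yz: "y \<in> X" "z \<in> X" "\<forall>j. \<bar>j\<bar> \<le> M \<longrightarrow> y j = z j" for y z
  proof -
    obtain x where x: "x \<in> F" "y \<in> C x" using F(3) yz(1) by blast
    then have "x \<in> X" using F(1) by blast
    have "c y = c x" using N(2)[OF \<open>x \<in> X\<close> yz(1)] x(2) unfolding C_def by blast
    moreover have "\<forall>j. \<bar>j\<bar> \<le> N x \<longrightarrow> z j = x j"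
      using x(2) yz(3) M[OF x(1)] unfolding C_def by force
    then have "c z = c x" by (rule N(2)[OF \<open>x \<in> X\<close> yz(2)])
    ultimately show ?thesis by simp
  qed
  ultimately show ?thesis unfolding window_determined_def by blast
qed

section \<open>The Sturmian shift\<close>

definition shift_seq :: "int \<Rightarrow> (int \<Rightarrow> bool) \<Rightarrow> int \<Rightarrow> bool" where
  "shift_seq n x = (\<lambda>k. x (k + n))"

lemma shift_seq_apply: "shift_seq n x k = x (k + n)"
  by (simp add: shift_seq_def)

lemma shift_seq_shift_seq: "shift_seq m (shift_seq n x) = shift_seq (m + n) x"
  by (simp add: shift_seq_def fun_eq_iff add.assoc)

lemma shift_seq_0: "shift_seq 0 x = x"
  by (simp add: shift_seq_def)

context irrational_rotation
begin

abbreviation X :: "(int \<Rightarrow> bool) set" where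
  "X \<equiv> sturmian_space \<alpha>"

abbreviation \<phi> :: "(int \<Rightarrow> bool) \<Rightarrow> int \<Rightarrow> bool" where
  "\<phi> \<equiv> sturmian_shift \<alpha>"

definition orb :: "int \<Rightarrow> int \<Rightarrow> bool" where
  "orb n = shift_seq n w"

lemma orb_apply: "orb n k = w (k + n)"
  by (simp add: orb_def shift_seq_apply)

lemma shift_orb: "shift_seq m (orb n) = orb (m + n)"
  by (simp add: orb_def shift_seq_shift_seq)

lemma coding_eq: "sturmian_coding \<alpha> t k \<longleftrightarrow> frac (t + of_int k * \<alpha>) < \<alpha>"
  by (simp add: sturmian_coding_def)

lemma orb_coding: "orb n = sturmian_coding \<alpha> (of_int n * \<alpha>)"
  by (rule ext) (simp add: coding_eq orb_apply w_def \<theta>_def algebra_simps)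

lemma orb_X: "orb n \<in> X"
  unfolding orb_coding sturmian_space_def by (rule subsetD[OF closure_subset]) simp

text \<open>Equal sequences agree on all windows, and the window sets \<open>A n\<close> and
  \<open>A m\<close> separate distinct n and m. This makes the permutation induced on the orbit
  unique.\<close>

lemma orb_inj:
  assumes "orb n = orb m"
  shows "n = m"
proof -
  have ag: "agree N n m" for N
    unfolding agree_def using fun_cong[OF assms] by (simp add: orb_apply add.commute)
  have "n \<in> A k \<longleftrightarrow> m \<in> A k" for k
    using window_set_A[of k] ag unfolding window_set_def by blast
  from this[of n] this[of m] have "\<theta> n = \<theta> m" by (simp add: mem_A)
  then show ?thesis by (simp add: \<theta>_inj)
qed

text \<open>Density of the orbit of 0: the coding is continuous from the right in t, with
  \<open>\<delta> j\<close> the distance of the j-th point to its next discontinuity. A point n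
  \<alpha> slightly to the right of t modulo 1 has the same window.\<close>

lemma coding_window:
  obtains n where "\<And>j. \<bar>j\<bar> \<le> N \<Longrightarrow> sturmian_coding \<alpha> t j = orb n j"
proof -
  define v where "v j = frac (t + of_int j * \<alpha>)" for j :: int
  define \<delta> where "\<delta> j = (if v j < \<alpha> then \<alpha> - v j else 1 - v j)" for j
  have v: "0 \<le> v j" "v j < 1" for j by (simp_all add: v_def frac_lt_1)
  define e where "e = Min (insert 1 (\<delta> ` {-N..N}))"
  have "0 < e" unfolding e_def using v by (subst Min_gr_iff) (auto simp: \<delta>_def)
  have e: "e \<le> \<delta> j" if "\<bar>j\<bar> \<le> N" for j
    unfolding e_def by (rule Min_le) (use that in \<open>auto simp: abs_le_iff\<close>)
  have "0 < e / 2" using \<open>0 < e\<close> by simp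
  then obtain h n :: int where "n > 0" and n: "\<bar>of_int n * \<alpha> - of_int h - (t + e / 2)\<bar> < e / 2"
    by (rule sequence_of_fractional_parts_is_dense[OF \<alpha>_irrational])
  define d where "d = of_int n * \<alpha> - of_int h - t"
  have d: "0 < d" "d < e" using n unfolding d_def by (auto simp: abs_less_iff field_simps)
  show thesis
  proof (rule that)
    fix j :: int assume j: "\<bar>j\<bar> \<le> N"
    have "t + of_int j * \<alpha> = v j + of_int \<lfloor>t + of_int j * \<alpha>\<rfloor>" by (simp add: v_def frac_def)
    then have dec: "of_int (j + n) * \<alpha> = (v j + d) + of_int (h + \<lfloor>t + of_int j * \<alpha>\<rfloor>)"
      unfolding d_def by (simp add: algebra_simps)
    have "v j + d < 1" using e[OF j] d \<alpha>_less unfolding \<delta>_def by (auto split: if_splits)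
    then have "\<theta> (j + n) = v j + d" using v[of j] d by (intro \<theta>_eqI[OF dec]) auto
    then have "orb n j \<longleftrightarrow> v j + d < \<alpha>" by (simp add: orb_apply w_def)
    moreover have "\<dots> \<longleftrightarrow> v j < \<alpha>" using e[OF j] d unfolding \<delta>_def by (auto split: if_splits)
    ultimately show "sturmian_coding \<alpha> t j = orb n j" by (simp add: coding_eq v_def)
  qed
qed

lemma X_window:
  assumes "x \<in> X"
  obtains n where "\<And>j. \<bar>j\<bar> \<le> N \<Longrightarrow> x j = orb n j"
proof -
  let ?C = "{y. \<forall>j. \<bar>j\<bar> \<le> N \<longrightarrow> y j = x j}"
  have "x \<in> ?C \<inter> closure (range (sturmian_coding \<alpha>))" using assms by (simp add: sturmian_space_def)
  then have "?C \<inter> closure (range (sturmian_coding \<alpha>)) \<noteq> {}" by (metis empty_iff)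
  then have "?C \<inter> range (sturmian_coding \<alpha>) \<noteq> {}"
    unfolding open_Int_closure_eq_empty[OF open_cylinder] .
  then obtain t where "\<And>j. \<bar>j\<bar> \<le> N \<Longrightarrow> sturmian_coding \<alpha> t j = x j" by blast
  moreover obtain n where "\<And>j. \<bar>j\<bar> \<le> N \<Longrightarrow> sturmian_coding \<alpha> t j = orb n j"
    using coding_window by blast
  ultimately show thesis using that[of n] by simp
qed

lemma shift_X:
  assumes "x \<in> X"
  shows "shift_seq k x \<in> X"
proof -
  have "continuous_on UNIV (shift_seq k)"
    unfolding shift_seq_def by (intro continuous_on_coordinatewise_then_product continuous_on_product_coordinates)
  then have "continuous_on X (shift_seq k)" by (rule continuous_on_subset) simp
  moreover have "shift_seq k (sturmian_coding \<alpha> t) = sturmian_coding \<alpha> (t + of_int k * \<alpha>)" for t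
    by (rule ext) (simp add: coding_eq shift_seq_apply algebra_simps)
  then have "shift_seq k ` range (sturmian_coding \<alpha>) \<subseteq> X"
    unfolding sturmian_space_def using closure_subset by fastforce
  ultimately have "shift_seq k ` X \<subseteq> X"
    unfolding sturmian_space_def by (intro image_closure_subset) auto
  then show ?thesis using assms by blast
qed

lemma shift_Bij: "restrict (shift_seq k) X \<in> Bij X"
proof -
  have "bij_betw (shift_seq k) X X"
    by (rule bij_betw_byWitness[where f' = "shift_seq (- k)"])
      (auto simp: shift_seq_shift_seq shift_seq_0 shift_X)
  then have "bij_betw (restrict (shift_seq k) X) X X" by (subst bij_betw_restrict_eq)
  then show ?thesis by (simp add: Bij_def)
qed

lemma \<phi>_eq: "\<phi> = restrict (shift_seq 1) X"
  by (rule ext) (simp add: sturmian_shift_def shift_seq_def restrict_def)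

lemma \<phi>_Bij: "\<phi> \<in> Bij X"
  unfolding \<phi>_eq by (rule shift_Bij)

lemma \<phi>_pow:
  assumes "x \<in> X"
  shows "(\<phi> [^]\<^bsub>BijGroup X\<^esub> (n :: int)) x = shift_seq n x"
proof -
  let ?p = "\<lambda>n :: int. \<phi> [^]\<^bsub>BijGroup X\<^esub> n"
  have 1: "?p 1 x = shift_seq 1 x" if "x \<in> X" for x
    using group.int_pow_1[OF group_BijGroup, of \<phi> X] \<phi>_Bij that by (simp add: carrier_BijGroup) (simp add: \<phi>_eq)
  have 0: "?p 0 x = x" if "x \<in> X" for x using that by (simp add: BijGroup_def)
  have m1: "?p (- 1) x = shift_seq (- 1) x" if x: "x \<in> X" for x
  proof -
    have y: "shift_seq (- 1) x \<in> X" by (rule shift_X[OF x])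
    have "shift_seq (- 1) x = ?p (- 1 + 1) (shift_seq (- 1) x)" using 0[OF y] by simp
    also have "\<dots> = ?p (- 1) (?p 1 (shift_seq (- 1) x))" by (rule int_pow_BijGroup_add[OF \<phi>_Bij y])
    also have "?p 1 (shift_seq (- 1) x) = x" using 1[OF y] by (simp add: shift_seq_shift_seq shift_seq_0)
    finally show ?thesis by simp
  qed
  show ?thesis
  proof (induction n rule: int_induct[of _ 0])
    case base
    show ?case using 0[OF assms] by (simp add: shift_seq_0)
  next
    case (step1 i)
    have "?p (1 + i) x = ?p 1 (?p i x)" by (rule int_pow_BijGroup_add[OF \<phi>_Bij assms])
    also have "\<dots> = shift_seq (1 + i) x" using step1(2) 1[OF shift_X[OF assms]] by (simp add: shift_seq_shift_seq)
    finally show ?case by (simp add: add.commute)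
  next
    case (step2 i)
    have "?p (- 1 + i) x = ?p (- 1) (?p i x)" by (rule int_pow_BijGroup_add[OF \<phi>_Bij assms])
    also have "\<dots> = shift_seq (- 1 + i) x" using step2(2) m1[OF shift_X[OF assms]] by (simp add: shift_seq_shift_seq)
    finally show ?case by simp
  qed
qed

section \<open>The full group and its action on the orbit\<close>

abbreviation \<Gamma> :: "((int \<Rightarrow> bool) \<Rightarrow> int \<Rightarrow> bool) monoid" where
  "\<Gamma> \<equiv> topological_full_group X \<phi>"

lemma \<Gamma>_eq: "\<Gamma> = BijGroup X\<lparr>carrier := carrier \<Gamma>\<rparr>"
  by (simp add: topological_full_group_def)

lemma \<Gamma>_carrier:
  "\<psi> \<in> carrier \<Gamma> \<longleftrightarrow> \<psi> \<in> Bij X \<and> (\<exists>\<psi>'. homeomorphism X X \<psi> \<psi>') \<and>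
    (\<exists>c. window_determined X c \<and> (\<forall>x\<in>X. \<psi> x = shift_seq (c x) x))"
proof -
  have "closed X" by (simp add: sturmian_space_def)
  then have "window_determined X c \<longleftrightarrow> continuous_on X c" for c :: "(int \<Rightarrow> bool) \<Rightarrow> int"
    using window_determined_continuous continuous_window_determined by blast
  then show ?thesis by (simp add: topological_full_group_def carrier_BijGroup \<phi>_pow cong: ball_cong)
qed

lemma subgroup_\<Gamma>: "subgroup (carrier \<Gamma>) (BijGroup X)"
  by (rule subgroup_topological_full_group[OF \<phi>_Bij])

lemma group_\<Gamma>: "group \<Gamma>"
  using group.subgroup_imp_group[OF group_BijGroup subgroup_\<Gamma>] \<Gamma>_eq by simp

lemma \<Gamma>_Bij: "\<psi> \<in> carrier \<Gamma> \<Longrightarrow> \<psi> \<in> Bij X"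
  by (simp add: \<Gamma>_carrier)

lemma mult_\<Gamma>: "mult \<Gamma> = mult (BijGroup X)"
  by (simp add: topological_full_group_def)

lemma one_\<Gamma>: "\<one>\<^bsub>\<Gamma>\<^esub> = \<one>\<^bsub>BijGroup X\<^esub>"
  by (simp add: topological_full_group_def)

definition induces :: "((int \<Rightarrow> bool) \<Rightarrow> int \<Rightarrow> bool) \<Rightarrow> (int \<Rightarrow> int) \<Rightarrow> bool" where
  "induces \<psi> g \<longleftrightarrow> (\<forall>n. \<psi> (orb n) = orb (g n))"

lemma induces_mult:
  assumes "\<psi>1 \<in> carrier \<Gamma>" "\<psi>2 \<in> carrier \<Gamma>" "induces \<psi>1 g1" "induces \<psi>2 g2"
  shows "induces (\<psi>1 \<otimes>\<^bsub>\<Gamma>\<^esub> \<psi>2) (g1 \<circ> g2)"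
  using assms unfolding induces_def mult_\<Gamma>
  by (simp add: BijGroup_mult_apply[OF \<Gamma>_Bij \<Gamma>_Bij orb_X])

lemma induces_one: "induces \<one>\<^bsub>\<Gamma>\<^esub> id"
  unfolding induces_def one_\<Gamma> by (simp add: BijGroup_def orb_X)

lemma induces_unique: "induces \<psi> g \<Longrightarrow> induces \<psi> g' \<Longrightarrow> g = g'"
  unfolding induces_def using orb_inj by (metis ext)

lemma \<Gamma>_cocycle:
  assumes "\<psi> \<in> carrier \<Gamma>"
  obtains c N where "0 \<le> N" "\<And>x. x \<in> X \<Longrightarrow> \<psi> x = shift_seq (c x) x"
    "\<And>x y. x \<in> X \<Longrightarrow> y \<in> X \<Longrightarrow> (\<And>j. \<bar>j\<bar> \<le> N \<Longrightarrow> x j = y j) \<Longrightarrow> c x = c y"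
proof -
  obtain c where c: "window_determined X c" "\<And>x. x \<in> X \<Longrightarrow> \<psi> x = shift_seq (c x) x"
    using assms unfolding \<Gamma>_carrier by blast
  from c(1) obtain N where "0 \<le> N" "\<forall>x\<in>X. \<forall>y\<in>X. (\<forall>j. \<bar>j\<bar> \<le> N \<longrightarrow> x j = y j) \<longrightarrow> c x = c y"
    unfolding window_determined_def by blast
  then show thesis using that[of N c] c(2) by blast
qed

text \<open>The exponents give a map of the indices, not yet known to be a bijection. The inverse
  group element gives another, and both compositions induce the identity.\<close>

lemma induces_exists:
  assumes "\<psi> \<in> carrier \<Gamma>"
  obtains g where "induces \<psi> g" "g \<in> FZ"
proof -
  have ex: "\<exists>g. induces \<psi> g \<and> (\<exists>N\<ge>0. \<forall>n n'. agree N n n' \<longrightarrow> g n - n = g n' - n')"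
    if \<psi>: "\<psi> \<in> carrier \<Gamma>" for \<psi>
  proof -
    obtain c N where N: "0 \<le> N" and c: "\<And>x. x \<in> X \<Longrightarrow> \<psi> x = shift_seq (c x) x"
      and cN: "\<And>x y. x \<in> X \<Longrightarrow> y \<in> X \<Longrightarrow> (\<And>j. \<bar>j\<bar> \<le> N \<Longrightarrow> x j = y j) \<Longrightarrow> c x = c y"
      using \<Gamma>_cocycle[OF \<psi>] by metis
    have "induces \<psi> (\<lambda>n. c (orb n) + n)"
      unfolding induces_def using c[OF orb_X] by (simp add: shift_orb)
    moreover have "c (orb n) = c (orb n')" if "agree N n n'" for n n'
      by (rule cN[OF orb_X orb_X]) (use that in \<open>simp add: agree_def orb_apply add.commute\<close>)
    then have "\<forall>n n'. agree N n n' \<longrightarrow> (c (orb n) + n) - n = (c (orb n') + n') - n'" by simp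
    ultimately show ?thesis using N by blast
  qed
  obtain g where g: "induces \<psi> g" "\<exists>N\<ge>0. \<forall>n n'. agree N n n' \<longrightarrow> g n - n = g n' - n'" using ex[OF assms] by blast
  have inv: "inv\<^bsub>\<Gamma>\<^esub> \<psi> \<in> carrier \<Gamma>" by (rule group.inv_closed[OF group_\<Gamma> assms])
  obtain g' where g': "induces (inv\<^bsub>\<Gamma>\<^esub> \<psi>) g'" using ex[OF inv] by blast
  have "induces \<one>\<^bsub>\<Gamma>\<^esub> (g \<circ> g')" "induces \<one>\<^bsub>\<Gamma>\<^esub> (g' \<circ> g)"
    using induces_mult[OF assms inv g(1) g'] induces_mult[OF inv assms g' g(1)]
      group.r_inv[OF group_\<Gamma> assms] group.l_inv[OF group_\<Gamma> assms] by simp_all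
  then have "g \<circ> g' = id" "g' \<circ> g = id" using induces_unique[OF _ induces_one] by blast+
  then have "bij g" by (intro o_bij)
  then show thesis using that g unfolding FZ_def by blast
qed

lemma induces_inv:
  assumes "\<psi> \<in> carrier \<Gamma>" "induces \<psi> g"
  shows "induces (inv\<^bsub>\<Gamma>\<^esub> \<psi>) (inv_into UNIV g)"
proof -
  have inv: "inv\<^bsub>\<Gamma>\<^esub> \<psi> \<in> carrier \<Gamma>" by (rule group.inv_closed[OF group_\<Gamma> assms(1)])
  then obtain g' where g': "induces (inv\<^bsub>\<Gamma>\<^esub> \<psi>) g'" using induces_exists by blast
  have "induces \<one>\<^bsub>\<Gamma>\<^esub> (g \<circ> g')" "induces \<one>\<^bsub>\<Gamma>\<^esub> (g' \<circ> g)"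
    using induces_mult[OF assms(1) inv assms(2) g'] induces_mult[OF inv assms(1) g' assms(2)]
      group.r_inv[OF group_\<Gamma> assms(1)] group.l_inv[OF group_\<Gamma> assms(1)] by simp_all
  then have "g \<circ> g' = id" "g' \<circ> g = id" using induces_unique[OF _ induces_one] by blast+
  then have "inv_into UNIV g = g'" by (rule inv_unique_comp)
  then show ?thesis using g' by simp
qed

text \<open>Each x shares with some orbit point a window large enough for both exponents. At that
  point equal images force equal exponents by \<open>orb_inj\<close>, hence the exponents agree at
  x.\<close>

lemma induces_determines:
  assumes "\<psi> \<in> carrier \<Gamma>" "\<psi>' \<in> carrier \<Gamma>" "induces \<psi> g" "induces \<psi>' g"
  shows "\<psi> = \<psi>'"
proof (rule Bij_ext[OF \<Gamma>_Bij[OF assms(1)] \<Gamma>_Bij[OF assms(2)]])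
  fix x assume x: "x \<in> X"
  obtain c N where c: "\<And>x. x \<in> X \<Longrightarrow> \<psi> x = shift_seq (c x) x"
    and N: "\<And>x y. x \<in> X \<Longrightarrow> y \<in> X \<Longrightarrow> (\<And>j. \<bar>j\<bar> \<le> N \<Longrightarrow> x j = y j) \<Longrightarrow> c x = c y"
    using \<Gamma>_cocycle[OF assms(1)] by metis
  obtain c' N' where c': "\<And>x. x \<in> X \<Longrightarrow> \<psi>' x = shift_seq (c' x) x"
    and N': "\<And>x y. x \<in> X \<Longrightarrow> y \<in> X \<Longrightarrow> (\<And>j. \<bar>j\<bar> \<le> N' \<Longrightarrow> x j = y j) \<Longrightarrow> c' x = c' y"
    using \<Gamma>_cocycle[OF assms(2)] by metis
  obtain n where n: "\<And>j. \<bar>j\<bar> \<le> max N N' \<Longrightarrow> x j = orb n j" using X_window[OF x] by blast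
  have "c x = c (orb n)" "c' x = c' (orb n)"
    by (rule N[OF x orb_X] N'[OF x orb_X]; use n in simp)+
  moreover have "orb (c (orb n) + n) = orb (c' (orb n) + n)"
    using assms(3,4) c[OF orb_X, of n] c'[OF orb_X, of n] unfolding induces_def by (simp add: shift_orb)
  then have "c (orb n) + n = c' (orb n) + n" by (rule orb_inj)
  ultimately show "\<psi> x = \<psi>' x" using c[OF x] c'[OF x] by simp
qed

lemma \<phi>_\<Gamma>: "\<phi> \<in> carrier \<Gamma>"
  unfolding \<Gamma>_carrier
proof (intro conjI)
  show "\<phi> \<in> Bij X" by (rule \<phi>_Bij)
  have cont: "continuous_on X (shift_seq k)" for k
    unfolding shift_seq_def
    by (intro continuous_on_coordinatewise_then_product continuous_on_subset[OF continuous_on_product_coordinates]) simp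
  have img: "shift_seq k ` X = X" for k
  proof
    show "X \<subseteq> shift_seq k ` X"
    proof
      fix x assume "x \<in> X"
      then show "x \<in> shift_seq k ` X"
        by (intro image_eqI[of _ _ "shift_seq (- k) x"]) (simp_all add: shift_seq_shift_seq shift_seq_0 shift_X)
    qed
  qed (auto intro: shift_X)
  have "homeomorphism X X (shift_seq 1) (shift_seq (- 1))"
    unfolding homeomorphism_def by (simp add: cont img shift_seq_shift_seq shift_seq_0)
  then have "homeomorphism X X \<phi> (shift_seq (- 1))" by (rule homeomorphism_cong) (auto simp: \<phi>_eq)
  then show "\<exists>\<psi>'. homeomorphism X X \<phi> \<psi>'" by blast
  show "\<exists>c. window_determined X c \<and> (\<forall>x\<in>X. \<phi> x = shift_seq (c x) x)"
    by (intro exI[of _ "\<lambda>_. 1"]) (auto simp: window_determined_def \<phi>_eq)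
qed

lemma induces_\<phi>: "induces \<phi> (translation 1)"
  unfolding induces_def \<phi>_eq by (simp add: orb_X shift_orb add.commute)

text \<open>The predicate P describes a clopen set through a window. Disjointness from the image is
  asked only on the orbit and is carried to all of X by windows; it makes the swap an involution,
  and so its own inverse homeomorphism.\<close>

lemma swap_along_\<Gamma>:
  assumes V: "V = {x \<in> X. P x}"
    and N: "\<And>x y. (\<And>j. \<bar>j\<bar> \<le> N \<Longrightarrow> x j = y j) \<Longrightarrow> P x = P y" "0 \<le> N"
    and disj: "\<And>n. P (orb n) \<Longrightarrow> \<not> P (orb (n - 1))"
  shows "swap_along X \<phi> V \<in> carrier \<Gamma>" "induces (swap_along X \<phi> V) (exch {n. P (orb n)} 0 1)"
proof -
  let ?s = "swap_along X \<phi> V"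
  define c :: "(int \<Rightarrow> bool) \<Rightarrow> int" where "c x = (if P x then 1 else if P (shift_seq (- 1) x) then - 1 else 0)" for x
  have inv\<phi>: "(inv\<^bsub>BijGroup X\<^esub> \<phi>) x = shift_seq (- 1) x" if "x \<in> X" for x
  proof -
    have "inv\<^bsub>BijGroup X\<^esub> \<phi> = \<phi> [^]\<^bsub>BijGroup X\<^esub> (- 1 :: int)"
      using group.int_pow_neg[OF group_BijGroup, of \<phi> X 1] group.int_pow_1[OF group_BijGroup, of \<phi> X] \<phi>_Bij
      by (simp add: carrier_BijGroup)
    then show ?thesis using \<phi>_pow[OF that] by simp
  qed
  have \<phi>V: "x \<in> \<phi> ` V \<longleftrightarrow> P (shift_seq (- 1) x)" if "x \<in> X" for x
  proof
    assume "x \<in> \<phi> ` V"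
    then obtain y where "y \<in> X" "P y" "x = \<phi> y" by (auto simp: V)
    then show "P (shift_seq (- 1) x)" by (simp add: \<phi>_eq shift_seq_shift_seq shift_seq_0)
  next
    assume "P (shift_seq (- 1) x)"
    then show "x \<in> \<phi> ` V"
      by (intro image_eqI[of _ _ "shift_seq (- 1) x"])
        (simp_all add: V \<phi>_eq shift_seq_shift_seq shift_seq_0 shift_X that)
  qed
  have s: "?s x = shift_seq (c x) x" if "x \<in> X" for x
  proof -
    have "?s x = (if P x then \<phi> x else if P (shift_seq (- 1) x) then (inv\<^bsub>BijGroup X\<^esub> \<phi>) x else x)"
      unfolding swap_along_def using that \<phi>V[OF that] by (simp add: V)
    then show ?thesis using that inv\<phi>[OF that] by (simp add: c_def \<phi>_eq shift_seq_0)
  qed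
  have disjX: "\<not> P (shift_seq (- 1) x)" if x: "x \<in> X" "P x" for x
  proof -
    obtain n where n: "\<And>j. \<bar>j\<bar> \<le> N + 1 \<Longrightarrow> x j = orb n j" using X_window[OF x(1)] by blast
    have "P x = P (orb n)" by (rule N) (use n in auto)
    moreover have "P (shift_seq (- 1) x) = P (shift_seq (- 1) (orb n))"
      by (rule N) (use n in \<open>auto simp: shift_seq_apply\<close>)
    ultimately show ?thesis using x disj[of n] by (simp add: shift_orb)
  qed
  have invol: "?s (?s x) = x" if "x \<in> X" for x
  proof -
    have y: "?s x \<in> X" using s[OF that] shift_X[OF that] by simp
    have "\<not> P (shift_seq 1 x)" if "P x"
      using disjX[OF shift_X[OF \<open>x \<in> X\<close>], of 1] that by (auto simp: shift_seq_shift_seq shift_seq_0)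
    then have "c (?s x) + c x = 0"
      unfolding s[OF that] using disjX[OF that] by (auto simp: c_def shift_seq_shift_seq shift_seq_0)
    then show ?thesis unfolding s[OF y] by (simp add: s[OF that] shift_seq_shift_seq shift_seq_0)
  qed
  have mem: "?s x \<in> X" if "x \<in> X" for x using s[OF that] shift_X[OF that] by simp
  have cw: "c x = c y" if "\<And>j. \<bar>j\<bar> \<le> N + 1 \<Longrightarrow> x j = y j" for x y
  proof -
    have "P x = P y" by (rule N) (use that in auto)
    moreover have "P (shift_seq (- 1) x) = P (shift_seq (- 1) y)"
      by (rule N) (use that in \<open>auto simp: shift_seq_apply\<close>)
    ultimately show ?thesis by (simp add: c_def)
  qed
  have cont: "continuous_on X ?s"
  proof (intro continuous_on_coordinatewise_then_product window_determined_continuous)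
    fix k
    show "window_determined X (\<lambda>x. ?s x k)"
      unfolding window_determined_def
    proof (intro exI[of _ "N + \<bar>k\<bar> + 1"] conjI ballI impI)
      fix x y assume xy: "x \<in> X" "y \<in> X" "\<forall>j. \<bar>j\<bar> \<le> N + \<bar>k\<bar> + 1 \<longrightarrow> x j = y j"
      have "c x = c y" by (rule cw) (use xy(3) in auto)
      moreover have "x (k + c x) = y (k + c x)" using xy(3) N(2) by (auto simp: c_def)
      ultimately show "?s x k = ?s y k" by (simp add: s[OF xy(1)] s[OF xy(2)] shift_seq_apply)
    qed (use N(2) in auto)
  qed
  have img: "?s ` X = X"
  proof
    show "X \<subseteq> ?s ` X"
    proof
      fix x assume x: "x \<in> X"
      show "x \<in> ?s ` X" by (rule image_eqI[of _ _ "?s x"]) (simp_all add: invol[OF x] mem[OF x])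
    qed
  qed (use mem in blast)
  show "?s \<in> carrier \<Gamma>"
    unfolding \<Gamma>_carrier
  proof (intro conjI)
    have "bij_betw ?s X X"
      by (rule bij_betw_byWitness[where f' = ?s]) (use invol mem in auto)
    moreover have "?s \<in> extensional X" by (simp add: swap_along_def)
    ultimately show "?s \<in> Bij X" by (simp add: Bij_def)
    have "homeomorphism X X ?s ?s" unfolding homeomorphism_def using cont img invol by blast
    then show "\<exists>\<psi>'. homeomorphism X X ?s \<psi>'" by blast
    have "window_determined X c"
      unfolding window_determined_def
    proof (intro exI[of _ "N + 1"] conjI ballI impI)
      show "c x = c y" if "\<forall>j. \<bar>j\<bar> \<le> N + 1 \<longrightarrow> x j = y j" for x y
        by (rule cw) (use that in blast)
    qed (use N(2) in simp)
    then show "\<exists>c. window_determined X c \<and> (\<forall>x\<in>X. ?s x = shift_seq (c x) x)" using s by blast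
  qed
  show "induces ?s (exch {n. P (orb n)} 0 1)"
    unfolding induces_def
  proof
    fix n
    have "?s (orb n) = orb (c (orb n) + n)" using s[OF orb_X] by (simp add: shift_orb)
    moreover have "c (orb n) + n = exch {n. P (orb n)} 0 1 n"
      by (auto simp: c_def exch_def shift_orb)
    ultimately show "?s (orb n) = orb (exch {n. P (orb n)} 0 1 n)" by simp
  qed
qed

abbreviation \<sigma>\<^sub>X :: "(int \<Rightarrow> bool) \<Rightarrow> int \<Rightarrow> bool" where
  "\<sigma>\<^sub>X \<equiv> swap_along X \<phi> (sturmian_cylinder \<alpha>)"

lemma \<sigma>_\<Gamma>: "\<sigma>\<^sub>X \<in> carrier \<Gamma>" and induces_\<sigma>: "induces \<sigma>\<^sub>X \<sigma>"
proof -
  have disj: "\<not> orb (n - 1) 0" if "orb n 0" for n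
    using disjoint_shiftsD[OF disjoint_A1_01, of n] that by (auto simp: orb_apply w_def mem_A \<theta>_1)
  have "{n. orb n 0} = A 1" by (auto simp: orb_apply w_def mem_A \<theta>_1)
  then show "\<sigma>\<^sub>X \<in> carrier \<Gamma>" "induces \<sigma>\<^sub>X \<sigma>"
    using swap_along_\<Gamma>[of "sturmian_cylinder \<alpha>" "\<lambda>x. x 0" 0] disj by (simp_all add: sturmian_cylinder_def)
qed

lemma exists_\<Gamma>_notin_GZ:
  obtains \<tau> g where "\<tau> \<in> carrier \<Gamma>" "induces \<tau> g" "g \<notin> GZ"
proof -
  define P where "P x \<longleftrightarrow> (\<forall>j\<in>{0..<max_gap}. \<not> x (- j))" for x :: "int \<Rightarrow> bool"
  have eq: "{n. P (orb n)} = long_gap max_gap w"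
    by (simp add: P_def orb_apply long_gap_def)
  have d: "disjoint_shifts (long_gap max_gap w) 0 1"
    using max_gap(3) by (intro disjoint_long_gap[OF gaps_w]) simp
  have disj: "\<not> P (orb (n - 1))" if "P (orb n)" for n
    using disjoint_shiftsD[OF d, of n] that eq by auto
  have Pw: "P x = P y" if "\<And>j. \<bar>j\<bar> \<le> max_gap \<Longrightarrow> x j = y j" for x y
    unfolding P_def by (intro ball_cong) (use that in auto)
  have "0 \<le> max_gap" using max_gap(3) by simp
  note sw = swap_along_\<Gamma>[of "{x \<in> X. P x}" P max_gap, OF refl Pw this disj]
  show thesis using that[OF sw[unfolded eq]] exch_long_gap_notin_GZ by blast
qed

text \<open>An element of the full group inducing a permutation in \<open>GZ\<close> coincides with
  the corresponding word in \<phi> and \<open>\<sigma>\<^sub>X\<close>, because an element is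
  determined by what it induces.\<close>

lemma generate_eq:
  "generate \<Gamma> {\<phi>, \<sigma>\<^sub>X} = {\<psi> \<in> carrier \<Gamma>. \<exists>g\<in>GZ. induces \<psi> g}" (is "?G = ?H")
proof
  interpret group \<Gamma> by (rule group_\<Gamma>)
  show "?G \<subseteq> ?H"
  proof
    fix \<psi> assume "\<psi> \<in> ?G"
    then show "\<psi> \<in> ?H"
    proof induction
      case one
      show ?case using induces_one id_GZ by blast
    next
      case (incl h)
      then show ?case using \<phi>_\<Gamma> \<sigma>_\<Gamma> induces_\<phi> induces_\<sigma> translation_GZ \<sigma>_GZ by blast
    next
      case (inv h)
      then obtain g where h: "h \<in> carrier \<Gamma>" "induces h g" "g \<in> GZ"
        using \<phi>_\<Gamma> \<sigma>_\<Gamma> induces_\<phi> induces_\<sigma> translation_GZ \<sigma>_GZ by blast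
      then show ?case using induces_inv[OF h(1,2)] inv_GZ[OF h(3)] inv_closed[OF h(1)] by blast
    next
      case (eng h1 h2)
      then show ?case using induces_mult GZ_comp m_closed by blast
    qed
  qed
  have ex: "\<exists>\<psi>\<in>?G. induces \<psi> g" if "g \<in> GZ" for g
    using that unfolding GZ_def
  proof induction
    case id
    show ?case using generate.one induces_one by blast
  next
    case (step s f)
    then obtain \<psi> where \<psi>: "\<psi> \<in> ?G" "induces \<psi> f" by blast
    have "\<exists>\<rho>\<in>?G. induces \<rho> s"
    proof -
      have "inv\<^bsub>\<Gamma>\<^esub> \<phi> \<in> ?G" by (rule generate.inv) simp
      moreover have "induces (inv\<^bsub>\<Gamma>\<^esub> \<phi>) (translation (- 1))"
        using induces_inv[OF \<phi>_\<Gamma> induces_\<phi>] by (simp only: inv_translation)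
      moreover have "\<phi> \<in> ?G" "\<sigma>\<^sub>X \<in> ?G" by (auto intro: generate.incl)
      ultimately show ?thesis using step(1) induces_\<phi> induces_\<sigma> by blast
    qed
    then obtain \<rho> where \<rho>: "\<rho> \<in> ?G" "induces \<rho> s" by blast
    have "\<rho> \<in> carrier \<Gamma>" "\<psi> \<in> carrier \<Gamma>" using \<open>?G \<subseteq> ?H\<close> \<rho>(1) \<psi>(1) by blast+
    from induces_mult[OF this \<rho>(2) \<psi>(2)] generate.eng[OF \<rho>(1) \<psi>(1)] show ?case by blast
  qed
  show "?H \<subseteq> ?G"
  proof
    fix \<psi> assume "\<psi> \<in> ?H"
    then obtain g where g: "\<psi> \<in> carrier \<Gamma>" "g \<in> GZ" "induces \<psi> g" by blast
    then obtain \<psi>' where \<psi>': "\<psi>' \<in> ?G" "induces \<psi>' g" using ex by blast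
    then have "\<psi>' \<in> carrier \<Gamma>" using \<open>?G \<subseteq> ?H\<close> by blast
    then have "\<psi> = \<psi>'" using induces_determines[OF g(1) _ g(3) \<psi>'(2)] by blast
    then show "\<psi> \<in> ?G" using \<psi>' by simp
  qed
qed

text \<open>The map E, which is 0 on G and 1 off it, is a homomorphism to Z/2: products of two
  elements outside G fall into G by \<open>MZ_index_two\<close> and \<open>FZ_MZ\<close>. Its kernel
  is G, commutators have value 0, and the long-gap exchange gives the value 1.\<close>

lemma full_group_index_two:
  fixes G
  defines "G \<equiv> generate \<Gamma> {\<phi>, \<sigma>\<^sub>X}"
  shows "derived \<Gamma> (carrier \<Gamma>) \<subseteq> G \<and> (G \<lhd> \<Gamma> \<and> \<Gamma> Mod G \<cong> integer_mod_group 2)"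
proof -
  let ?Z = "integer_mod_group 2"
  interpret group \<Gamma> by (rule group_\<Gamma>)
  interpret Z: group ?Z by simp
  have G: "\<psi> \<in> G \<longleftrightarrow> \<psi> \<in> carrier \<Gamma> \<and> (\<exists>g\<in>GZ. induces \<psi> g)" for \<psi>
    unfolding G_def generate_eq by blast
  define E where "E \<psi> = (if \<psi> \<in> G then 0 else 1 :: int)" for \<psi>
  have carrier_Z: "carrier ?Z = {0, 1}" by (auto simp: carrier_integer_mod_group)
  have E: "E \<psi> = (if g \<in> GZ then 0 else 1)" if "\<psi> \<in> carrier \<Gamma>" "induces \<psi> g" for \<psi> g
    using that induces_unique unfolding E_def G by auto
  have Emult: "E (\<psi>1 \<otimes>\<^bsub>\<Gamma>\<^esub> \<psi>2) = (E \<psi>1 + E \<psi>2) mod 2"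
    if \<psi>: "\<psi>1 \<in> carrier \<Gamma>" "\<psi>2 \<in> carrier \<Gamma>" for \<psi>1 \<psi>2
  proof -
    obtain g1 where g1: "induces \<psi>1 g1" "g1 \<in> FZ" using induces_exists[OF \<psi>(1)] by blast
    obtain g2 where g2: "induces \<psi>2 g2" "g2 \<in> FZ" using induces_exists[OF \<psi>(2)] by blast
    note E12 = E[OF \<psi>(1) g1(1)] E[OF \<psi>(2) g2(1)] E[OF m_closed[OF \<psi>] induces_mult[OF \<psi> g1(1) g2(1)]]
    consider "g1 \<in> GZ" "g2 \<in> GZ" | "g1 \<in> GZ" "g2 \<notin> GZ" | "g1 \<notin> GZ" "g2 \<in> GZ" | "g1 \<notin> GZ" "g2 \<notin> GZ" by blast
    then show ?thesis
    proof cases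
      case 1
      then have "g1 \<circ> g2 \<in> GZ" by (rule GZ_comp)
      then show ?thesis unfolding E12 using 1 by simp
    next
      case 2
      then have "g1 \<circ> g2 \<notin> GZ" using GZ_cancel_left by blast
      then show ?thesis unfolding E12 using 2 by simp
    next
      case 3
      then have "g1 \<circ> g2 \<notin> GZ" using GZ_cancel_right by blast
      then show ?thesis unfolding E12 using 3 by simp
    next
      case 4
      then have "g1 \<circ> g2 \<in> GZ" using MZ_index_two FZ_MZ g1(2) g2(2) by blast
      then show ?thesis unfolding E12 using 4 by simp
    qed
  qed
  have "E \<in> hom \<Gamma> ?Z"
    using Emult by (intro homI) (auto simp: carrier_Z E_def integer_mod_group_def)
  then interpret E: group_hom \<Gamma> ?Z E by unfold_locales
  have ker: "kernel \<Gamma> ?Z E = G"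
    unfolding kernel_def using G by (auto simp: E_def integer_mod_group_def)
  have "1 \<in> E ` carrier \<Gamma>"
  proof -
    obtain \<tau> g where \<tau>: "\<tau> \<in> carrier \<Gamma>" "induces \<tau> g" "g \<notin> GZ" by (rule exists_\<Gamma>_notin_GZ)
    then have "E \<tau> = 1" using E by simp
    then show ?thesis using \<tau>(1) by force
  qed
  moreover have "0 \<in> E ` carrier \<Gamma>"
    by (rule image_eqI[of _ _ "\<one>\<^bsub>\<Gamma>\<^esub>"]) (simp_all add: E[OF one_closed induces_one] id_GZ)
  ultimately have surj: "E ` carrier \<Gamma> = carrier ?Z" unfolding carrier_Z by (auto simp: E_def)
  have "derived_set \<Gamma> (carrier \<Gamma>) \<subseteq> G"
  proof
    fix \<psi> assume "\<psi> \<in> derived_set \<Gamma> (carrier \<Gamma>)"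
    then obtain a b where ab: "a \<in> carrier \<Gamma>" "b \<in> carrier \<Gamma>"
      "\<psi> = a \<otimes>\<^bsub>\<Gamma>\<^esub> b \<otimes>\<^bsub>\<Gamma>\<^esub> (inv\<^bsub>\<Gamma>\<^esub> a) \<otimes>\<^bsub>\<Gamma>\<^esub> (inv\<^bsub>\<Gamma>\<^esub> b)" by blast
    have Einv: "E (inv\<^bsub>\<Gamma>\<^esub> x) = E x" if "x \<in> carrier \<Gamma>" for x
    proof -
      have "E \<one>\<^bsub>\<Gamma>\<^esub> = 0" using E[OF one_closed induces_one] id_GZ by (simp only: if_True)
      then have "(E x + E (inv\<^bsub>\<Gamma>\<^esub> x)) mod 2 = 0"
        using Emult[OF that inv_closed[OF that]] unfolding r_inv[OF that] by (simp only:)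
      then show ?thesis by (cases "x \<in> G"; cases "inv\<^bsub>\<Gamma>\<^esub> x \<in> G") (simp_all add: E_def)
    qed
    have "E \<psi> = 0"
      unfolding ab(3) using ab(1,2) by (simp add: Emult Einv) (simp add: E_def)
    then show "\<psi> \<in> G" by (simp add: E_def split: if_splits)
  qed
  moreover have "subgroup G \<Gamma>" using E.subgroup_kernel unfolding ker .
  ultimately have "derived \<Gamma> (carrier \<Gamma>) \<subseteq> G"
    unfolding derived_def by (rule generate_subgroup_incl)
  then show ?thesis using E.normal_kernel E.FactGroup_iso[OF surj] unfolding ker by blast
qed

end

theorem proposition3p1:
  fixes \<alpha> :: real
    and X U :: "(int \<Rightarrow> bool) set"
    and \<phi> \<sigma> :: "(int \<Rightarrow> bool) \<Rightarrow> (int \<Rightarrow> bool)"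
    and \<Gamma> :: "((int \<Rightarrow> bool) \<Rightarrow> (int \<Rightarrow> bool)) monoid"
    and G :: "((int \<Rightarrow> bool) \<Rightarrow> (int \<Rightarrow> bool)) set"
  assumes "0 < \<alpha>" and "\<alpha> < 1 / 6" and "\<alpha> \<notin> \<rat>"
  defines "X \<equiv> sturmian_space \<alpha>"
    and "\<phi> \<equiv> sturmian_shift \<alpha>"
    and "U \<equiv> sturmian_cylinder \<alpha>"
  defines "\<sigma> \<equiv> swap_along X \<phi> U"
    and "\<Gamma> \<equiv> topological_full_group X \<phi>"
  defines "G \<equiv> generate \<Gamma> {\<phi>, \<sigma>}"
  shows "derived \<Gamma> (carrier \<Gamma>) \<subseteq> G \<and>
    (G \<lhd> \<Gamma> \<and> \<Gamma> Mod G \<cong> integer_mod_group 2)"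
proof -
  interpret irrational_rotation \<alpha> using assms(1-3) by unfold_locales
  show ?thesis
    unfolding G_def \<sigma>_def \<Gamma>_def X_def \<phi>_def U_def by (rule full_group_index_two)
qed

end
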